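(* Let $p$ be a prime, $\Bbbk$ a field of characteristic $p$, $G$ a finite $p$-group, and $V$ a finite-dimensional $\Bbbk G$-module that contains $k+1$ non-trivial summands, i.e. $V=V_0\oplus\cdots\oplus V_k\oplus U$ as $\Bbbk G$-modules with each $V_i$ non-trivial and with $G$ acting trivially on $U$ (possibly $U=0$). Choose a basis $x_0,x_1,\ldots,x_n$ of $V^*$, compatible with this decomposition, in which $x_0,x_1,\ldots,x_k$ are terminal variables with $x_i$ coming from the summand $V_i$ (that is, $x_i\in V_i^*$) for $0\le i\le k$. Let $d_i=\deg(x_i)$ for $0\le i\le k$, let $A=\Bbbk[x_{k+1},\ldots,x_n]\subseteq \Bbbk[V]$, and let $X_i$ denote the image of $x_i$ in $\Bbbk[V]_G$. Then: (1) There is a choice of the polynomials $N(x_0),N(x_1),\ldots,N(x_k)$ such that the Hilbert ideal $\mathcal{H}=\Bbbk[V]^G_+\Bbbk[V]$ is generated by $N(x_0),N(x_1),\ldots,N(x_k)$ and polynomials in $A$. (2) The dimension $\dim_\Bbbk \Bbbk[V]_G$ is divisible by $\prod_{i=0}^k d_i$. Suppose in addition that $d_i=\deg(N^G(x_i))$ for all $0\le i\le k$. Then: (3) $\Bbbk[V]_G$ is free as a module over its subalgebra $\mathcal{T}$ generated by $X_0,X_1,\ldots,X_k$. (4) $\mathcal{T}\cong \Bbbk[t_0,\ldots,t_k]/(t_0^{d_0},\ldots,t_k^{d_k})$ as $\Bbbk$-algebras, where $t_0,\ldots,t_k$ are independent variables.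
   Context: $\Bbbk[V]=S(V^* )$ is the symmetric algebra on $V^*$, a polynomial ring in any basis of $V^*$, with $G$ acting by $\sigma(f)=f\circ\sigma^{-1}$. $\Bbbk[V]^G$ is the ring of invariants, $\Bbbk[V]^G_+$ the set of invariants with zero constant term, $\mathcal{H}=\Bbbk[V]^G_+\Bbbk[V]$ the Hilbert ideal (the ideal of $\Bbbk[V]$ generated by homogeneous invariants of positive degree), and $\Bbbk[V]_G=\Bbbk[V]/\mathcal{H}$ the algebra of coinvariants. Given a basis $x_0,\ldots,x_n$ of $V^*$, the element $x_i$ is called a terminal variable if the $\Bbbk$-span of the other basis elements $x_j$, $j\neq i$, is a $\Bbbk G$-submodule of $V^*$. A basis of $V^*$ is compatible with a decomposition of $V$ into a direct sum if it is the union of bases of the duals of the summands. For a terminal variable $x_i$, $N(x_i)$ denotes a chosen polynomial in $\Bbbk[V]^G$ which, viewed as a polynomial in $x_i$ (with coefficients in the polynomial ring in the other variables), is monic of minimal positive degree among such invariants. $N(x_i)$ is not unique, but its degree in $x_i$ is well-defined; this degree is denoted $\deg(x_i)$ and called the degree of $x_i$. For $f\in\Bbbk[V]$, $N^G(f)=\prod_{h\in G\cdot f}h$ is the product over the $G$-orbit of $f$. *)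

theory Defs
  imports
    "HOL-Algebra.Algebra"
    "HOL-Library.Poly_Mapping"
    "HOL-Library.Function_Algebras"
    "HOL-Computational_Algebra.Polynomial"
    "HOL-Computational_Algebra.Primes"
begin

section \<open>Representations and dual spaces\<close>

definition kG_submodule ::
  "('k::field \<Rightarrow> 'v::ab_group_add \<Rightarrow> 'v) \<Rightarrow> ('g, 'x) monoid_scheme \<Rightarrow> ('g \<Rightarrow> 'v \<Rightarrow> 'v) \<Rightarrow> 'v set \<Rightarrow> bool"
  where "kG_submodule scl G \<rho> W \<longleftrightarrow>
    Modules.module.subspace scl W \<and> (\<forall>g\<in>carrier G. \<rho> g ` W \<subseteq> W)"

definition trivial_on :: "('g, 'x) monoid_scheme \<Rightarrow> ('g \<Rightarrow> 'v \<Rightarrow> 'v) \<Rightarrow> 'v set \<Rightarrow> bool"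
  where "trivial_on G \<rho> W \<longleftrightarrow> (\<forall>g\<in>carrier G. \<forall>v\<in>W. \<rho> g v = v)"

text \<open>The \<open>kG\<close>-module is the whole type \<open>'v\<close>, with scalar multiplication \<open>scl\<close>.\<close>

locale fin_dim_kG_module =
  vector_space scl + group_action G UNIV \<rho>
  for scl :: "'k::field \<Rightarrow> 'v::ab_group_add \<Rightarrow> 'v" and G :: "('g, 'x) monoid_scheme" (structure)
    and \<rho> :: "'g \<Rightarrow> 'v \<Rightarrow> 'v" +
  assumes linear_act: "g \<in> carrier G \<Longrightarrow> Vector_Spaces.linear scl scl (\<rho> g)"
    and fin_dim: "\<exists>B. finite B \<and> span B = UNIV"

definition fscale :: "'k::field \<Rightarrow> ('v \<Rightarrow> 'k) \<Rightarrow> ('v \<Rightarrow> 'k)"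
  where "fscale c f = (\<lambda>v. c * f v)"

interpretation functional: vector_space fscale
  by standard (auto simp: fscale_def fun_eq_iff algebra_simps)

definition dual_space :: "('k::field \<Rightarrow> 'v::ab_group_add \<Rightarrow> 'v) \<Rightarrow> ('v \<Rightarrow> 'k) set"
  where "dual_space scl = {f. Vector_Spaces.linear scl (*) f}"

definition dual_act ::
  "('g, 'x) monoid_scheme \<Rightarrow> ('g \<Rightarrow> 'v \<Rightarrow> 'v) \<Rightarrow> 'g \<Rightarrow> ('v \<Rightarrow> 'k) \<Rightarrow> ('v \<Rightarrow> 'k)"
  where "dual_act G \<rho> g f = f \<circ> \<rho> (inv\<^bsub>G\<^esub> g)"

definition kG_direct_sum ::
  "('k::field \<Rightarrow> 'v::ab_group_add \<Rightarrow> 'v) \<Rightarrow> ('g, 'x) monoid_scheme \<Rightarrow> ('g \<Rightarrow> 'v \<Rightarrow> 'v) \<Rightarrow>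
    'i set \<Rightarrow> ('i \<Rightarrow> 'v set) \<Rightarrow> bool"
  where "kG_direct_sum scl G \<rho> I W \<longleftrightarrow>
    (\<forall>i\<in>I. kG_submodule scl G \<rho> (W i)) \<and> (\<forall>v. \<exists>!w. w \<in> (\<Pi>\<^sub>E i\<in>I. W i) \<and> v = (\<Sum>i\<in>I. w i))"

text \<open>The dual of the summand \<open>W i\<close>, embedded in the dual of the whole space by extending
  functionals by zero on the other summands.\<close>

definition summand_dual ::
  "('k::field \<Rightarrow> 'v::ab_group_add \<Rightarrow> 'v) \<Rightarrow> 'i set \<Rightarrow> ('i \<Rightarrow> 'v set) \<Rightarrow> 'i \<Rightarrow> ('v \<Rightarrow> 'k) set"
  where "summand_dual scl I W i =
    {f \<in> dual_space scl. \<forall>j\<in>I - {i}. \<forall>v\<in>W j. f v = 0}"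

definition functional_basis :: "('v \<Rightarrow> 'k::field) set \<Rightarrow> ('v \<Rightarrow> 'k) set \<Rightarrow> bool"
  where "functional_basis B E \<longleftrightarrow> functional.independent B \<and> functional.span B = E"

definition dual_basis ::
  "('k::field \<Rightarrow> 'v::ab_group_add \<Rightarrow> 'v) \<Rightarrow> nat \<Rightarrow> (nat \<Rightarrow> 'v \<Rightarrow> 'k) \<Rightarrow> bool"
  where "dual_basis scl n x \<longleftrightarrow>
    inj_on x {..n} \<and> functional_basis (x ` {..n}) (dual_space scl)"

definition compatible_basis ::
  "('k::field \<Rightarrow> 'v::ab_group_add \<Rightarrow> 'v) \<Rightarrow> nat \<Rightarrow> (nat \<Rightarrow> 'v \<Rightarrow> 'k) \<Rightarrow>
    'i set \<Rightarrow> ('i \<Rightarrow> 'v set) \<Rightarrow> bool"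
  where "compatible_basis scl n x I W \<longleftrightarrow>
    (\<exists>B. (\<forall>i\<in>I. functional_basis (B i) (summand_dual scl I W i)) \<and> x ` {..n} = (\<Union>i\<in>I. B i))"

definition terminal_variable ::
  "('g, 'x) monoid_scheme \<Rightarrow> ('g \<Rightarrow> 'v \<Rightarrow> 'v) \<Rightarrow> nat \<Rightarrow> (nat \<Rightarrow> 'v \<Rightarrow> 'k::field) \<Rightarrow> nat \<Rightarrow> bool"
  where "terminal_variable G \<rho> n x i \<longleftrightarrow>
    kG_submodule fscale G (dual_act G \<rho>) (functional.span (x ` ({..n} - {i})))"


section \<open>Polynomial rings in indexed variables\<close>

text \<open>Polynomials are finitely supported maps from exponent vectors to coefficients; the variable
  with index \<open>i\<close> is \<open>Var i\<close>.\<close>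

type_synonym 'k mpoly = "(nat \<Rightarrow>\<^sub>0 nat) \<Rightarrow>\<^sub>0 'k"

definition Const :: "'k::field \<Rightarrow> 'k mpoly"
  where "Const c = Poly_Mapping.single 0 c"

definition Var :: "nat \<Rightarrow> 'k::field mpoly"
  where "Var i = Poly_Mapping.single (Poly_Mapping.single i 1) 1"

definition vars :: "'k::field mpoly \<Rightarrow> nat set"
  where "vars f = (\<Union>m\<in>Poly_Mapping.keys f. Poly_Mapping.keys m)"

definition mpoly_ring :: "nat set \<Rightarrow> 'k::field mpoly ring"
  where "mpoly_ring I =
    \<lparr>carrier = {f. vars f \<subseteq> I}, monoid.mult = (*), one = 1, ring.zero = 0, add = (+)\<rparr>"

definition total_degree :: "'k::field mpoly \<Rightarrow> nat"
  where "total_degree f =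
    Max (insert 0 ((\<lambda>m. \<Sum>j\<in>Poly_Mapping.keys m. Poly_Mapping.lookup m j) ` Poly_Mapping.keys f))"

definition subst :: "(nat \<Rightarrow> 'k::field mpoly) \<Rightarrow> 'k mpoly \<Rightarrow> 'k mpoly"
  where "subst s f = (\<Sum>m\<in>Poly_Mapping.keys f. Const (Poly_Mapping.lookup f m) *
    (\<Prod>j\<in>Poly_Mapping.keys m. s j ^ Poly_Mapping.lookup m j))"

text \<open>\<open>f\<close> viewed as a univariate polynomial in the variable \<open>i\<close>, with coefficients not
  involving that variable.\<close>

definition poly_in :: "nat \<Rightarrow> 'k::field mpoly \<Rightarrow> 'k mpoly poly"
  where "poly_in i f = (\<Sum>m\<in>Poly_Mapping.keys f.
    Polynomial.monom (Poly_Mapping.single (Poly_Mapping.update i 0 m) (Poly_Mapping.lookup f m))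
      (Poly_Mapping.lookup m i))"


section \<open>Invariants and coinvariants\<close>

text \<open>Given a basis \<open>x 0, ..., x n\<close> of the dual space, the symmetric algebra of the dual is
  \<open>mpoly_ring {..n}\<close>, where \<open>Var j\<close> is \<open>x j\<close> and a functional becomes the linear form with its
  coordinates as coefficients. The action is the unique one by algebra automorphisms that
  extends the action on the dual. (Over a finite field polynomials are not functions, so it
  cannot be defined by composition.)\<close>

definition linear_form :: "nat \<Rightarrow> (nat \<Rightarrow> 'v \<Rightarrow> 'k::field) \<Rightarrow> ('v \<Rightarrow> 'k) \<Rightarrow> 'k mpoly"
  where "linear_form n x f =
    (\<Sum>j\<le>n. Const (functional.representation (x ` {..n}) f (x j)) * Var j)"

definition poly_act ::
  "('g, 'x) monoid_scheme \<Rightarrow> ('g \<Rightarrow> 'v \<Rightarrow> 'v) \<Rightarrow> nat \<Rightarrow> (nat \<Rightarrow> 'v \<Rightarrow> 'k::field) \<Rightarrow>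
    'g \<Rightarrow> 'k mpoly \<Rightarrow> 'k mpoly"
  where "poly_act G \<rho> n x g = subst (\<lambda>j. linear_form n x (dual_act G \<rho> g (x j)))"

definition invariant_polys ::
  "('g, 'x) monoid_scheme \<Rightarrow> ('g \<Rightarrow> 'v \<Rightarrow> 'v) \<Rightarrow> nat \<Rightarrow> (nat \<Rightarrow> 'v \<Rightarrow> 'k::field) \<Rightarrow> 'k mpoly set"
  where "invariant_polys G \<rho> n x =
    {f \<in> carrier (mpoly_ring {..n}). \<forall>g\<in>carrier G. poly_act G \<rho> n x g f = f}"

definition hilbert_ideal ::
  "('g, 'x) monoid_scheme \<Rightarrow> ('g \<Rightarrow> 'v \<Rightarrow> 'v) \<Rightarrow> nat \<Rightarrow> (nat \<Rightarrow> 'v \<Rightarrow> 'k::field) \<Rightarrow> 'k mpoly set"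
  where "hilbert_ideal G \<rho> n x =
    Idl\<^bsub>mpoly_ring {..n}\<^esub> {f \<in> invariant_polys G \<rho> n x. Poly_Mapping.lookup f 0 = 0}"

definition coinvariants ::
  "('g, 'x) monoid_scheme \<Rightarrow> ('g \<Rightarrow> 'v \<Rightarrow> 'v) \<Rightarrow> nat \<Rightarrow> (nat \<Rightarrow> 'v \<Rightarrow> 'k::field) \<Rightarrow> 'k mpoly set ring"
  where "coinvariants G \<rho> n x = mpoly_ring {..n} Quot hilbert_ideal G \<rho> n x"

definition monic_invariant ::
  "('g, 'x) monoid_scheme \<Rightarrow> ('g \<Rightarrow> 'v \<Rightarrow> 'v) \<Rightarrow> nat \<Rightarrow> (nat \<Rightarrow> 'v \<Rightarrow> 'k::field) \<Rightarrow> nat \<Rightarrow>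
    'k mpoly \<Rightarrow> bool"
  where "monic_invariant G \<rho> n x i f \<longleftrightarrow> f \<in> invariant_polys G \<rho> n x \<and>
    lead_coeff (poly_in i f) = 1 \<and> 0 < Polynomial.degree (poly_in i f)"

text \<open>The admissible choices of the polynomial \<open>N(x i)\<close>, and their common degree in \<open>x i\<close>.\<close>

definition is_N ::
  "('g, 'x) monoid_scheme \<Rightarrow> ('g \<Rightarrow> 'v \<Rightarrow> 'v) \<Rightarrow> nat \<Rightarrow> (nat \<Rightarrow> 'v \<Rightarrow> 'k::field) \<Rightarrow> nat \<Rightarrow>
    'k mpoly \<Rightarrow> bool"
  where "is_N G \<rho> n x i =
    is_arg_min (\<lambda>f. Polynomial.degree (poly_in i f)) (monic_invariant G \<rho> n x i)"

definition var_degree ::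
  "('g, 'x) monoid_scheme \<Rightarrow> ('g \<Rightarrow> 'v \<Rightarrow> 'v) \<Rightarrow> nat \<Rightarrow> (nat \<Rightarrow> 'v \<Rightarrow> 'k::field) \<Rightarrow> nat \<Rightarrow> nat"
  where "var_degree G \<rho> n x i =
    (LEAST d. \<exists>f. monic_invariant G \<rho> n x i f \<and> Polynomial.degree (poly_in i f) = d)"

definition orbit_norm ::
  "('g, 'x) monoid_scheme \<Rightarrow> ('g \<Rightarrow> 'v \<Rightarrow> 'v) \<Rightarrow> nat \<Rightarrow> (nat \<Rightarrow> 'v \<Rightarrow> 'k::field) \<Rightarrow>
    'k mpoly \<Rightarrow> 'k mpoly"
  where "orbit_norm G \<rho> n x f = (\<Prod>h\<in>orbit G (poly_act G \<rho> n x) f. h)"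


section \<open>Quotient algebras\<close>

text \<open>A quotient of \<open>mpoly_ring I\<close> is a \<open>k\<close>-algebra through the classes of the constants.\<close>

definition residue :: "nat set \<Rightarrow> 'k::field mpoly set \<Rightarrow> 'k mpoly \<Rightarrow> 'k mpoly set"
  where "residue I J f = J +>\<^bsub>mpoly_ring I\<^esub> f"

definition generated_subalgebra :: "nat set \<Rightarrow> 'k::field mpoly set \<Rightarrow> 'k mpoly set set \<Rightarrow> 'k mpoly set set"
  where "generated_subalgebra I J S =
    generate_ring (mpoly_ring I Quot J) (range (\<lambda>c. residue I J (Const c)) \<union> S)"

text \<open>Isomorphism of \<open>k\<close>-algebras, given as rings with structure maps \<open>\<eta>\<close> and \<open>\<theta>\<close> from \<open>k\<close>.\<close>

definition algebra_isomorphic ::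
  "('a, 'm) ring_scheme \<Rightarrow> ('k \<Rightarrow> 'a) \<Rightarrow> ('b, 'n) ring_scheme \<Rightarrow> ('k \<Rightarrow> 'b) \<Rightarrow> bool"
  where "algebra_isomorphic A \<eta> B \<theta> \<longleftrightarrow> (\<exists>\<phi>\<in>ring_iso A B. \<forall>c. \<phi> (\<eta> c) = \<theta> c)"

definition regular_module :: "('a, 'm) ring_scheme \<Rightarrow> ('a, 'a) module"
  where "regular_module R =
    \<lparr>carrier = carrier R, monoid.mult = monoid.mult R, one = one R, ring.zero = ring.zero R, add = add R, module.smult = monoid.mult R\<rparr>"

text \<open>A basis is a set over which every element has a unique finite expansion; the coefficient
  families are extensional on the basis so that uniqueness is meaningful.\<close>

definition free_module :: "('a, 'm) ring_scheme \<Rightarrow> ('a, 'b, 'n) module_scheme \<Rightarrow> bool"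
  where "free_module R M \<longleftrightarrow> Module.module R M \<and>
    (\<exists>B \<subseteq> carrier M. \<forall>y\<in>carrier M. \<exists>!c. c \<in> B \<rightarrow>\<^sub>E carrier R \<and> finite {b \<in> B. c b \<noteq> \<zero>\<^bsub>R\<^esub>} \<and>
      y = (\<Oplus>\<^bsub>M\<^esub>b\<in>{b \<in> B. c b \<noteq> \<zero>\<^bsub>R\<^esub>}. c b \<odot>\<^bsub>M\<^esub> b))"

end

theory Submission
  imports Defs
begin

text \<open>For a terminal variable \<open>x\<^sub>i\<close> a \<open>p\<close>-group acts by \<open>x\<^sub>i \<mapsto> x\<^sub>i + l\<close> with \<open>l\<close> free of \<open>x\<^sub>i\<close>, so the
  coefficients of \<open>f(x\<^sub>i + t)\<close> in \<open>t\<close>, the Hasse derivatives of \<open>f\<close>, are equivariant in \<open>f\<close>. Let \<open>H'\<close> be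
  generated by the homogeneous invariants of positive degree whose degree in each \<open>x\<^sub>i\<close>, \<open>i \<le> k\<close>, is less
  than \<open>d\<^sub>i\<close>. A Hasse derivative of such a generator is again one or a constant, and the constant vanishes by
  minimality of \<open>d\<^sub>i\<close>. Hence \<open>H'\<close> is closed under Hasse derivatives, therefore under taking coefficients
  with respect to \<open>x\<^sub>0, \<dots>, x\<^sub>k\<close>, and so it is generated by polynomials in \<open>A\<close>. Division by the monic
  polynomials \<open>N(x\<^sub>i) \<in> A[x\<^sub>i]\<close> is equivariant, which gives \<open>H = (N(x\<^sub>0), \<dots>, N(x\<^sub>k)) + H'\<close>, and an element of
  \<open>H\<close> of degree less than \<open>d\<^sub>i\<close> in each \<open>x\<^sub>i\<close> lies in \<open>H'\<close>. So the monomials \<open>x\<^sup>a\<close> with \<open>a\<^sub>i < d\<^sub>i\<close> form a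
  basis of the coinvariants over \<open>A/(A \<inter> H)\<close>.

  If \<open>d\<^sub>i\<close> is the size of the orbit of \<open>x\<^sub>i\<close>, it is a power of \<open>p\<close>; then the Hasse derivatives of order
  \<open>0 < j < d\<^sub>i\<close> do not see \<open>x\<^sub>i\<^sup>d\<close>, and the coefficients of the orbit product other than the leading one lie in
  \<open>H\<close>. Therefore \<open>x\<^sub>i\<close> is nilpotent of order \<open>d\<^sub>i\<close> modulo \<open>H\<close>.\<close>

section \<open>Polynomials in indexed variables\<close>

text \<open>Hasse derivatives replace ordinary ones because in characteristic p iterated derivatives
  lose the factor \<open>j!\<close>. The top Hasse derivative of f in x_i is its leading
  coefficient, which lets coefficients be recovered from derivatives by descending degree. The
  obstacle is that the divisions by the N(x_i) must not disturb each other. A minimal monic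
  invariant may contain other terminal variables, and reducing by it could then raise the degree in
  them. The decomposition of V removes this: each N(x_i) can be taken in the variables of its own
  summand, so it is free of the other terminal variables. Equivariance of division comes from
  uniqueness of remainders. Two closure properties meet in the test for membership in
  \<open>H'\<close>. A low-degree element of \<open>H\<close> is a combination of the N(x_i) plus
  some h in \<open>H'\<close>; eliminating N(x_i) means dividing h by it, and the remainder stays in
  \<open>H'\<close> only because \<open>H'\<close> is closed under taking coefficients. Finiteness
  of the dimension has a separate source: each variable x_j is a root of the product of all T - g
  x_j, and this puts its power of exponent |G| into \<open>H\<close>.\<close>

abbreviation coef :: "('a \<Rightarrow>\<^sub>0 'b::zero) \<Rightarrow> 'a \<Rightarrow> 'b" where "coef \<equiv> Poly_Mapping.lookup"
abbreviation supp :: "('a \<Rightarrow>\<^sub>0 'b::zero) \<Rightarrow> 'a set" where "supp \<equiv> Poly_Mapping.keys"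
abbreviation sgl :: "'a \<Rightarrow> 'b \<Rightarrow> 'a \<Rightarrow>\<^sub>0 'b::zero" where "sgl \<equiv> Poly_Mapping.single"

lemma coef_sum_single:
  assumes "finite S"
  shows "coef (\<Sum>m\<in>S. sgl m (c m)) m' = (if m' \<in> S then c m' else 0)"
proof -
  have "(\<Sum>x\<in>S. coef (sgl x (c x)) m') = (\<Sum>x\<in>S. if x = m' then c x else 0)"
    by (intro sum.cong) (auto simp: lookup_single when_def)
  then show ?thesis using assms by (simp add: lookup_sum)
qed

lemma sum_singles: "(\<Sum>m\<in>supp f. sgl m (coef f m)) = f"
  by (rule poly_mapping_eqI) (simp add: coef_sum_single in_keys_iff)

lemma coef_mult_single:
  fixes f :: "'k::field mpoly"
  shows "coef (sgl m c * f) (m + m') = c * coef f m'"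
proof -
  have "sgl m c * f = (\<Sum>l\<in>supp f. sgl (m + l) (c * coef f l))"
    by (subst (1) sum_singles[of f, symmetric]) (simp add: sum_distrib_left mult_single)
  then have "coef (sgl m c * f) (m + m') = (\<Sum>l\<in>supp f. coef (sgl (m + l) (c * coef f l)) (m + m'))"
    by (simp add: lookup_sum)
  also have "\<dots> = (\<Sum>l\<in>supp f. if l = m' then c * coef f l else 0)"
    by (intro sum.cong) (auto simp: lookup_single when_def)
  finally show ?thesis by (simp add: in_keys_iff)
qed

lemma coef_mult_single_not:
  fixes f :: "'k::field mpoly"
  assumes "\<And>l. m' \<noteq> m + l"
  shows "coef (sgl m c * f) m' = 0"
  using assms keys_mult[of "sgl m c" f] by (force simp: in_keys_iff split: if_splits)

lemma Const_simps [simp]: "Const 0 = 0" "Const 1 = 1"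
  by (auto simp: Const_def)

lemma Const_add: "Const (a + b) = Const a + Const b"
  and Const_mult: "Const (a * b) = Const a * Const b"
  and Const_diff: "Const (a - b) = Const a - Const b"
  and Const_uminus: "Const (- a) = - Const a"
  by (simp_all add: Const_def single_add mult_single single_diff single_uminus)

lemma Const_sum: "Const (sum f S) = (\<Sum>x\<in>S. Const (f x))"
  by (induction S rule: infinite_finite_induct) (simp_all add: Const_add)

lemma coef_Const_mult [simp]: "coef (Const c * f) m = c * coef f m"
  using coef_mult_single[of 0 c f m] by (simp add: Const_def)

lemma coef_Const [simp]: "coef (Const c) 0 = c"
  by (simp add: Const_def)

lemma Var_power: "Var i ^ a = sgl (sgl i a) 1"
  by (induction a) (auto simp: Var_def mult_single single_add[symmetric] simp flip: single_one)

section \<open>Monomials and the variables of a polynomial\<close>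

definition mprod :: "(nat \<Rightarrow> 'r::comm_monoid_mult) \<Rightarrow> (nat \<Rightarrow>\<^sub>0 nat) \<Rightarrow> 'r"
  where "mprod s m = (\<Prod>j\<in>supp m. s j ^ coef m j)"

lemma mprod_superset: "finite K \<Longrightarrow> supp m \<subseteq> K \<Longrightarrow> mprod s m = (\<Prod>j\<in>K. s j ^ coef m j)"
  unfolding mprod_def by (rule prod.mono_neutral_left) (auto simp: in_keys_iff)

lemma mprod_add: "mprod s (m + m') = mprod s m * mprod s m'"
proof -
  let ?K = "supp m \<union> supp m'"
  have "supp (m + m') \<subseteq> ?K" by (rule keys_add)
  then show ?thesis
    by (simp add: mprod_superset[of ?K] lookup_add power_add prod.distrib)
qed

lemma mprod_zero [simp]: "mprod s 0 = 1"
  by (simp add: mprod_def)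

lemma mprod_Var: "mprod Var m = sgl m 1"
proof -
  have *: "finite S \<Longrightarrow> (\<Prod>j\<in>S. (sgl (sgl j (e j)) 1 :: 'a mpoly)) = sgl (\<Sum>j\<in>S. sgl j (e j)) 1" for S e
    by (induction S rule: finite_induct) (simp_all add: mult_single single_one)
  show ?thesis
    by (simp add: mprod_def Var_power * sum_singles)
qed

lemma single_eq_Const_mprod: "sgl m c = Const c * mprod Var m"
  by (simp add: mprod_Var Const_def mult_single)

lemma vars_Const [simp]: "vars (Const c) = {}"
  by (auto simp: vars_def Const_def)

lemma vars_Var [simp]: "vars (Var i) = {i}"
  by (auto simp: vars_def Var_def)

lemma vars_zero [simp]: "vars 0 = {}" and vars_one [simp]: "vars 1 = {}"
  using vars_Const[of 0] vars_Const[of 1] by auto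

lemma vars_add: "vars (f + g) \<subseteq> vars f \<union> vars g"
  using keys_add[of f g] unfolding vars_def by blast

lemma vars_diff: "vars (f - g) \<subseteq> vars f \<union> vars g"
proof -
  have "supp (f - g) \<subseteq> supp f \<union> supp g" by (auto simp: in_keys_iff lookup_minus)
  then show ?thesis unfolding vars_def by blast
qed

lemma vars_uminus [simp]: "vars (- f) = vars f"
  unfolding vars_def by (auto simp: in_keys_iff)

lemma vars_mult: "vars (f * g) \<subseteq> vars f \<union> vars g"
proof
  fix j assume "j \<in> vars (f * g)"
  then obtain m where "m \<in> supp (f * g)" "j \<in> supp m" by (auto simp: vars_def)
  then show "j \<in> vars f \<union> vars g"
    using keys_mult[of f g] by (fastforce simp: vars_def in_keys_iff lookup_add)
qed

lemma vars_sum: "(\<And>x. x \<in> S \<Longrightarrow> vars (f x) \<subseteq> I) \<Longrightarrow> vars (sum f S) \<subseteq> I"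
  by (induction S rule: infinite_finite_induct) (use vars_add in \<open>auto, blast\<close>)

lemma vars_prod: "(\<And>x. x \<in> S \<Longrightarrow> vars (f x) \<subseteq> I) \<Longrightarrow> vars (prod f S) \<subseteq> I"
  by (induction S rule: infinite_finite_induct) (use vars_mult in \<open>auto, blast\<close>)

lemma vars_power: "vars (f ^ e) \<subseteq> vars f"
proof (induction e)
  case (Suc e) then show ?case using vars_mult[of f "f ^ e"] by auto
qed simp

lemma vars_single: "vars (sgl m c) = (if c = 0 then {} else supp m)"
  by (auto simp: vars_def)

lemma notin_vars_iff: "i \<notin> vars f \<longleftrightarrow> (\<forall>m. coef f m \<noteq> 0 \<longrightarrow> coef m i = 0)"
  by (auto simp: vars_def in_keys_iff)

lemma mpoly_induct [consumes 1, case_names Const Var add mult]: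
  assumes "vars f \<subseteq> I"
    and Const: "\<And>c. P (Const c)" and Var: "\<And>i. i \<in> I \<Longrightarrow> P (Var i)"
    and add: "\<And>f g. P f \<Longrightarrow> P g \<Longrightarrow> P (f + g)" and mult: "\<And>f g. P f \<Longrightarrow> P g \<Longrightarrow> P (f * g)"
  shows "P f"
proof -
  have one: "P 1" and zero: "P 0" using Const[of 1] Const[of 0] by auto
  have pow: "i \<in> I \<Longrightarrow> P (Var i ^ e)" for i e
    by (induction e) (auto intro: one Var mult)
  have prod: "finite S \<Longrightarrow> (\<And>j. j \<in> S \<Longrightarrow> P (h j)) \<Longrightarrow> P (prod h S)" for h and S :: "nat set"
    by (induction S rule: finite_induct) (auto intro: one mult)
  have sum: "finite S \<Longrightarrow> (\<And>j. j \<in> S \<Longrightarrow> P (h j)) \<Longrightarrow> P (sum h S)" for h and S :: "(nat \<Rightarrow>\<^sub>0 nat) set"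
    by (induction S rule: finite_induct) (auto intro: zero add)
  have "P (\<Sum>m\<in>supp f. sgl m (coef f m))"
  proof (rule sum)
    fix m assume "m \<in> supp f"
    then have "supp m \<subseteq> I" using assms(1) by (auto simp: vars_def)
    then show "P (sgl m (coef f m))"
      unfolding single_eq_Const_mprod mprod_def by (intro mult Const prod pow) auto
  qed simp
  then show ?thesis by (simp add: sum_singles)
qed

section \<open>Ring homomorphisms and evaluation\<close>

definition ring_map :: "('a::comm_ring_1 \<Rightarrow> 'b::comm_ring_1) \<Rightarrow> bool"
  where "ring_map F \<longleftrightarrow> F 1 = 1 \<and> (\<forall>f g. F (f + g) = F f + F g) \<and> (\<forall>f g. F (f * g) = F f * F g)"

lemma ring_mapD:
  assumes "ring_map F"
  shows "F 1 = 1" "F 0 = 0" "F (f + g) = F f + F g" "F (f * g) = F f * F g" "F (- f) = - F f"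
    "F (f - g) = F f - F g" "F (f ^ e) = F f ^ e" "F (sum h S) = (\<Sum>x\<in>S. F (h x))"
    "F (prod h S) = (\<Prod>x\<in>S. F (h x))"
proof -
  note * = assms[unfolded ring_map_def]
  show 1: "F 1 = 1" and add: "F (f + g) = F f + F g" and mult: "F (f * g) = F f * F g" for f g
    using * by auto
  show 0: "F 0 = 0" using add[of 0 0] by simp
  show um: "F (- f) = - F f" for f using add[of f "- f"] 0 by (simp add: add_eq_0_iff)
  show "F (f - g) = F f - F g" using add[of f "- g"] um by simp
  show "F (f ^ e) = F f ^ e" by (induction e) (simp_all add: 1 mult)
  show "F (sum h S) = (\<Sum>x\<in>S. F (h x))"
    by (induction S rule: infinite_finite_induct) (simp_all add: 0 add)
  show "F (prod h S) = (\<Prod>x\<in>S. F (h x))"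
    by (induction S rule: infinite_finite_induct) (simp_all add: 1 mult)
qed

text \<open>Replaces computation with supports: substitution, \<open>poly_in\<close>,
  \<open>taylor\<close>, \<open>grading\<close> and their composites are ring maps, so the
  commutation laws below are checked on constants and variables. The set \<open>I\<close> confines
  the check to the variables that may occur, since group actions are controlled on finitely many
  variables only.\<close>

lemma ring_map_eqI:
  assumes "ring_map F" "ring_map F'" "vars f \<subseteq> I"
    and "\<And>c. F (Const c) = F' (Const c)" "\<And>i. i \<in> I \<Longrightarrow> F (Var i) = F' (Var i)"
  shows "F f = F' f"
  using assms(3) by (induction f rule: mpoly_induct) (simp_all add: assms ring_mapD)

lemma ring_map_comp: "ring_map F \<Longrightarrow> ring_map F' \<Longrightarrow> ring_map (\<lambda>f. F (F' f))"
  by (simp add: ring_map_def)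

lemma ring_map_map_poly:
  assumes "ring_map (F :: 'a::comm_ring_1 \<Rightarrow> 'b::comm_ring_1)"
  shows "ring_map (map_poly F)"
proof -
  note F = ring_mapD[OF assms]
  show ?thesis
    unfolding ring_map_def
  proof (intro conjI allI)
    show "map_poly F (f + g) = map_poly F f + map_poly F g" for f g
      by (rule poly_eqI) (simp add: coeff_map_poly F)
    show "map_poly F (f * g) = map_poly F f * map_poly F g" for f g
      by (rule poly_eqI) (simp add: coeff_map_poly coeff_mult F)
  qed (simp add: F)
qed

text \<open>The universal property of the polynomial ring. The coefficient map \<open>c\<close> is a
  parameter so that the target may also be a ring of univariate polynomials over
  \<open>'k mpoly\<close>.\<close>

definition ev :: "('k::field \<Rightarrow> 'r::comm_ring_1) \<Rightarrow> (nat \<Rightarrow> 'r) \<Rightarrow> 'k mpoly \<Rightarrow> 'r"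
  where "ev c s f = (\<Sum>m\<in>supp f. c (coef f m) * mprod s m)"

lemma subst_eq_ev: "subst s = ev Const s"
  by (simp add: fun_eq_iff subst_def ev_def mprod_def)

context
  fixes c :: "'k::field \<Rightarrow> 'r::comm_ring_1"
  assumes c: "ring_map c"
begin

lemma ev_superset: "finite K \<Longrightarrow> supp f \<subseteq> K \<Longrightarrow> ev c s f = (\<Sum>m\<in>K. c (coef f m) * mprod s m)"
  unfolding ev_def by (rule sum.mono_neutral_left) (auto simp: in_keys_iff ring_mapD[OF c])

lemma ev_single: "ev c s (sgl m a) = c a * mprod s m"
  by (simp add: ev_superset[of "{m}"])

lemma ev_add: "ev c s (f + g) = ev c s f + ev c s g"
proof -
  let ?K = "supp f \<union> supp g"
  have "supp (f + g) \<subseteq> ?K" by (rule keys_add)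
  then show ?thesis
    by (simp add: ev_superset[of ?K] lookup_add ring_mapD[OF c] distrib_right sum.distrib)
qed

lemma ev_sum: "ev c s (sum h S) = (\<Sum>x\<in>S. ev c s (h x))"
  by (induction S rule: infinite_finite_induct) (simp_all add: ev_add ev_def[of _ _ 0])

lemma ev_mult: "ev c s (f * g) = ev c s f * ev c s g"
proof -
  have "f * g = (\<Sum>m\<in>supp f. sgl m (coef f m)) * (\<Sum>m\<in>supp g. sgl m (coef g m))"
    by (simp add: sum_singles)
  also have "\<dots> = (\<Sum>m\<in>supp f. \<Sum>l\<in>supp g. sgl (m + l) (coef f m * coef g l))"
    by (simp add: sum_product mult_single)
  finally have "ev c s (f * g) =
      (\<Sum>m\<in>supp f. \<Sum>l\<in>supp g. c (coef f m * coef g l) * mprod s (m + l))"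
    by (simp add: ev_sum ev_single)
  also have "\<dots> = ev c s f * ev c s g"
    by (simp add: ev_def sum_product ring_mapD[OF c] mprod_add mult_ac)
  finally show ?thesis .
qed

lemma ring_map_ev: "ring_map (ev c s)"
proof -
  have "ev c s 1 = 1" using ev_single[of s 0 1] by (simp add: ring_mapD[OF c])
  then show ?thesis by (simp add: ring_map_def ev_add ev_mult)
qed

lemma ev_Const [simp]: "ev c s (Const a) = c a"
  by (simp add: Const_def ev_single)

lemma ev_Var [simp]: "ev c s (Var i) = s i"
  by (simp add: Var_def ev_single mprod_def ring_mapD[OF c])

end

lemma ring_map_Const: "ring_map Const"
  by (simp add: ring_map_def Const_add Const_mult)

lemma ring_map_pConst: "ring_map (\<lambda>c. [:Const c:])"
  by (auto simp: ring_map_def Const_add Const_mult)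

lemma ring_map_subst: "ring_map (subst s)"
  by (simp add: subst_eq_ev ring_map_ev ring_map_Const)

lemmas subst_simps = ring_mapD[OF ring_map_subst]

lemma subst_Const [simp]: "subst s (Const c) = Const c"
  by (simp add: subst_eq_ev ring_map_Const)

lemma subst_Var [simp]: "subst s (Var i) = s i"
  by (simp add: subst_eq_ev ring_map_Const)

lemma subst_cong:
  assumes "vars f \<subseteq> I" "\<And>i. i \<in> I \<Longrightarrow> s i = s' i"
  shows "subst s f = subst s' f"
  by (rule ring_map_eqI[OF ring_map_subst ring_map_subst assms(1)]) (simp_all add: assms)

lemma subst_subst: "subst s (subst s' f) = subst (\<lambda>i. subst s (s' i)) f"
  by (rule ring_map_eqI[OF ring_map_comp[OF ring_map_subst ring_map_subst] ring_map_subst subset_UNIV]) simp_all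

lemma subst_Var_id: "subst Var f = f"
  by (rule ring_map_eqI[OF ring_map_subst _ subset_UNIV]) (auto simp: ring_map_def)

lemma vars_subst:
  assumes "vars f \<subseteq> I" "\<And>i. i \<in> I \<Longrightarrow> vars (s i) \<subseteq> K"
  shows "vars (subst s f) \<subseteq> K"
  using assms(1)
proof (induction f rule: mpoly_induct)
  case (add f g) then show ?case using vars_add[of "subst s f" "subst s g"] by (simp add: subst_simps) blast
next
  case (mult f g) then show ?case using vars_mult[of "subst s f" "subst s g"] by (simp add: subst_simps) blast
qed (simp_all add: assms)


section \<open>Coefficients, Hasse derivatives and the grading\<close>

definition mono_part :: "nat set \<Rightarrow> (nat \<Rightarrow>\<^sub>0 nat) \<Rightarrow> (nat \<Rightarrow>\<^sub>0 nat)"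
  where "mono_part S m = (\<Sum>j\<in>supp m \<inter> S. sgl j (coef m j))"

lemma coef_mono_part: "coef (mono_part S m) j = (if j \<in> S then coef m j else 0)"
  by (simp add: mono_part_def coef_sum_single in_keys_iff)

lemma supp_mono_part: "supp (mono_part S m) \<subseteq> S"
  by (auto simp: in_keys_iff coef_mono_part split: if_splits)

lemma mono_part_le: "mono_part S m + (m - mono_part S m) = m"
  by (rule poly_mapping_eqI) (simp add: lookup_add lookup_minus coef_mono_part)

lemma mono_part_add: "supp a \<subseteq> S \<Longrightarrow> supp m \<inter> S = {} \<Longrightarrow> mono_part S (a + m) = a"
  by (rule poly_mapping_eqI) (auto simp: lookup_add coef_mono_part in_keys_iff subset_iff disjoint_iff)

text \<open>The coefficient of the monomial \<open>a\<close> when \<open>f\<close> is regarded as a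
  polynomial in the variables of \<open>S\<close> over the remaining ones. The side condition on
  \<open>m\<close> discards monomials in which a variable of \<open>S\<close> is left over.\<close>

definition mcoef :: "nat set \<Rightarrow> (nat \<Rightarrow>\<^sub>0 nat) \<Rightarrow> 'k::field mpoly \<Rightarrow> 'k mpoly"
  where "mcoef S a f = Abs_poly_mapping (\<lambda>m. coef f (a + m) when supp m \<inter> S = {})"

lemma coef_mcoef: "coef (mcoef S a f) m = (if supp m \<inter> S = {} then coef f (a + m) else 0)"
proof -
  have "finite ((\<lambda>m. a + m) -` supp f)"
    by (rule finite_vimageI) (auto intro: injI)
  then have "finite {m. (coef f (a + m) when supp m \<inter> S = {}) \<noteq> 0}"
    by (rule rev_finite_subset) (auto simp: in_keys_iff when_def split: if_splits)
  then show ?thesis by (simp add: mcoef_def when_def)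
qed

lemma mcoef_add: "mcoef S a (f + g) = mcoef S a f + mcoef S a g"
  by (rule poly_mapping_eqI) (simp add: coef_mcoef lookup_add)

lemma mcoef_0 [simp]: "mcoef S a 0 = 0"
  by (rule poly_mapping_eqI) (simp add: coef_mcoef)

lemma mcoef_sum: "mcoef S a (sum h Y) = (\<Sum>x\<in>Y. mcoef S a (h x))"
  by (induction Y rule: infinite_finite_induct) (simp_all add: mcoef_add)

lemma vars_mcoef: "vars (mcoef S a f) \<subseteq> vars f - S"
proof
  fix j assume "j \<in> vars (mcoef S a f)"
  then obtain m where "coef (mcoef S a f) m \<noteq> 0" "j \<in> supp m" by (auto simp: vars_def in_keys_iff)
  then have "a + m \<in> supp f" "supp m \<inter> S = {}" "j \<in> supp (a + m)"
    by (auto simp: coef_mcoef in_keys_iff lookup_add split: if_splits)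
  then show "j \<in> vars f - S" using \<open>j \<in> supp m\<close> by (auto simp: vars_def)
qed

lemma coef_single_mult_mcoef:
  assumes "supp a \<subseteq> S"
  shows "coef (sgl a 1 * mcoef S a f) m = (if mono_part S m = a then coef f m else 0)"
proof (cases "\<exists>l. m = a + l")
  case True
  then obtain l where l: "m = a + l" by blast
  have "supp l \<inter> S = {} \<longleftrightarrow> mono_part S m = a"
  proof
    assume "mono_part S m = a"
    then have "coef (mono_part S (a + l)) j = coef a j" for j using l by simp
    then have "coef l j = 0" if "j \<in> S" for j
      using that by (metis coef_mono_part lookup_add add_cancel_right_right)
    then show "supp l \<inter> S = {}"
      by (auto simp: in_keys_iff)
  qed (simp add: l mono_part_add assms)
  then show ?thesis
    unfolding l using coef_mult_single[of a 1 "mcoef S a f" l] by (simp add: coef_mcoef)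
next
  case False
  then have "mono_part S m \<noteq> a" using mono_part_le[of S m] by metis
  then show ?thesis using False coef_mult_single_not[of m a 1 "mcoef S a f"] by auto
qed

text \<open>Each monomial m of f is counted exactly once, for \<open>a = mono_part S m\<close>. With
  \<open>mcoef_single_mult\<close> this makes the expansion over monomials in \<open>S\<close> exist
  and be unique.\<close>

lemma sum_single_mult_mcoef:
  assumes "finite B" "\<And>a. a \<in> B \<Longrightarrow> supp a \<subseteq> S" "mono_part S ` supp f \<subseteq> B"
  shows "(\<Sum>a\<in>B. sgl a 1 * mcoef S a f) = f"
proof (rule poly_mapping_eqI)
  fix m
  have "coef (\<Sum>a\<in>B. sgl a 1 * mcoef S a f) m = (\<Sum>a\<in>B. if mono_part S m = a then coef f m else 0)"
    using assms(2) by (simp add: lookup_sum coef_single_mult_mcoef)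
  also have "\<dots> = coef f m"
    using assms(1,3) by (cases "m \<in> supp f") (auto simp: in_keys_iff)
  finally show "coef (\<Sum>a\<in>B. sgl a 1 * mcoef S a f) m = coef f m" .
qed

lemma mcoef_single_mult:
  assumes "supp a \<subseteq> S" "supp b \<subseteq> S" "vars f \<inter> S = {}"
  shows "mcoef S a (sgl b 1 * f) = (if a = b then f else 0)"
proof (rule poly_mapping_eqI)
  fix m
  have f: "supp l \<inter> S = {}" if "coef f l \<noteq> 0" for l
    using that assms(3) by (auto simp: vars_def disjoint_iff) (metis in_keys_iff)
  show "coef (mcoef S a (sgl b 1 * f)) m = coef (if a = b then f else 0) m"
  proof (cases "supp m \<inter> S = {}")
    case S: True
    show ?thesis
    proof (cases "a = b")
      case True then show ?thesis
        using S by (simp add: coef_mcoef coef_mult_single)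
    next
      case False
      have "coef (sgl b 1 * f) (a + m) = 0"
      proof (rule ccontr)
        assume *: "\<not> ?thesis"
        then obtain l where l: "a + m = b + l" using coef_mult_single_not[of "a + m" b 1 f] by auto
        then have "coef f l \<noteq> 0" using * by (simp add: coef_mult_single)
        then have "mono_part S (b + l) = b" using f assms by (intro mono_part_add) auto
        then show False using mono_part_add[OF assms(1) S] l False by simp
      qed
      then show ?thesis using False by (simp add: coef_mcoef)
    qed
  next
    case False
    then have "coef f m = 0" using f by blast
    then show ?thesis using False by (auto simp: coef_mcoef)
  qed
qed

text \<open>Peels off one variable, so that closure under coefficients in a single variable can be
  iterated to several.\<close>

lemma mcoef_mcoef:
  assumes "supp a \<subseteq> S" "i \<notin> S"
  shows "mcoef S a (mcoef {i} (sgl i l) f) = mcoef (insert i S) (sgl i l + a) f"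
proof (rule poly_mapping_eqI)
  fix m
  have "supp (a + m) \<inter> {i} = {} \<longleftrightarrow> i \<notin> supp m"
    using assms by (auto simp: in_keys_iff lookup_add subset_iff)
  then show "coef (mcoef S a (mcoef {i} (sgl i l) f)) m = coef (mcoef (insert i S) (sgl i l + a) f) m"
    using assms by (auto simp: coef_mcoef add_ac)
qed

lemma coeff_poly_in: "coeff (poly_in i f) l = mcoef {i} (sgl i l) f"
proof (rule poly_mapping_eqI)
  fix m
  have upd: "coef x i = l \<and> Poly_Mapping.update i 0 x = m \<longleftrightarrow> coef m i = 0 \<and> x = sgl i l + m" for x
    by (auto simp: poly_mapping_eq_iff fun_eq_iff lookup_update lookup_add lookup_single when_def)
  have "coef (coeff (poly_in i f) l) m =
      (\<Sum>x\<in>supp f. if x = sgl i l + m then (if coef m i = 0 then coef f x else 0) else 0)"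
    unfolding poly_in_def coeff_sum lookup_sum
  proof (rule sum.cong[OF refl])
    fix x
    show "coef (coeff (Polynomial.monom (sgl (Poly_Mapping.update i 0 x) (coef f x)) (coef x i)) l) m =
        (if x = sgl i l + m then (if coef m i = 0 then coef f x else 0) else 0)"
      using upd[of x] by (auto simp: coeff_monom lookup_single when_def)
  qed
  also have "\<dots> = coef (mcoef {i} (sgl i l) f) m"
    by (simp add: coef_mcoef in_keys_iff)
  finally show "coef (coeff (poly_in i f) l) m = coef (mcoef {i} (sgl i l) f) m" .
qed

text \<open>The defining sum of \<open>poly_in\<close> works monomial by monomial and hides
  multiplicativity; as an evaluation it is visibly a ring map.\<close>

lemma poly_in_eq_ev:
  "poly_in i = ev (\<lambda>c. [:Const c:]) (\<lambda>j. if j = i then [:0, 1:] else [:Var j:])"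
proof
  fix f :: "'a mpoly"
  let ?s = "\<lambda>j. if j = i then [:0, 1:] else [:Var j :: 'a mpoly:]"
  have pC: "(\<Prod>j\<in>Y. [:h j:]) = [:\<Prod>j\<in>Y. h j:]" for h :: "nat \<Rightarrow> 'a mpoly" and Y
    by (induction Y rule: infinite_finite_induct) (auto simp: one_pCons)
  have pw: "[:h:] ^ e = [:h ^ e:]" for h :: "'a mpoly" and e
    by (induction e) (auto simp: one_pCons)
  have "Polynomial.monom (sgl (Poly_Mapping.update i 0 m) c) (coef m i) = [:Const c:] * mprod ?s m" for m c
  proof -
    let ?K = "insert i (supp m)"
    have "mprod ?s m = (\<Prod>j\<in>?K. ?s j ^ coef m j)"
      by (rule mprod_superset) auto
    also have "\<dots> = [:0, 1:] ^ coef m i * (\<Prod>j\<in>supp m - {i}. ?s j ^ coef m j)"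
      by (simp add: prod.insert_remove)
    also have "(\<Prod>j\<in>supp m - {i}. ?s j ^ coef m j) = [:\<Prod>j\<in>supp m - {i}. Var j ^ coef m j:]"
      unfolding pC[symmetric] pw[symmetric] by (rule prod.cong) auto
    also have "(\<Prod>j\<in>supp m - {i}. Var j ^ coef m j) = (mprod Var (Poly_Mapping.update i 0 m) :: 'a mpoly)"
    proof -
      have "mprod Var (Poly_Mapping.update i 0 m) =
          (\<Prod>j\<in>supp m - {i}. Var j ^ coef (Poly_Mapping.update i 0 m) j :: 'a mpoly)"
        by (rule mprod_superset) (auto simp: in_keys_iff lookup_update split: if_splits)
      also have "\<dots> = (\<Prod>j\<in>supp m - {i}. Var j ^ coef m j)"
        by (rule prod.cong) (auto simp: lookup_update)
      finally show ?thesis by simp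
    qed
    finally have "mprod ?s m = Polynomial.monom 1 (coef m i) * [:sgl (Poly_Mapping.update i 0 m) 1:]"
      by (simp add: mprod_Var monom_altdef)
    then show ?thesis
      by (simp add: Const_def mult_monom smult_monom mult_single flip: monom_0)
  qed
  then show "poly_in i f = ev (\<lambda>c. [:Const c:]) ?s f"
    by (simp add: poly_in_def ev_def)
qed

lemma ring_map_poly_in: "ring_map (poly_in i)"
  by (simp add: poly_in_eq_ev ring_map_ev ring_map_pConst)

lemmas poly_in_simps = ring_mapD[OF ring_map_poly_in]

lemma poly_in_Const [simp]: "poly_in i (Const c) = [:Const c:]"
  and poly_in_Var: "poly_in i (Var j) = (if j = i then [:0, 1:] else [:Var j:])"
  by (simp_all add: poly_in_eq_ev ring_map_pConst)

lemma ring_map_pCons: "ring_map (\<lambda>f. [:f:])"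
  by (auto simp: ring_map_def one_pCons)

lemma poly_in_free: "i \<notin> vars f \<Longrightarrow> poly_in i f = [:f:]"
  by (rule ring_map_eqI[OF ring_map_poly_in ring_map_pCons, of f "- {i}"]) (auto simp: poly_in_Var)

lemma poly_poly_in: "poly (poly_in i f) (Var i) = f"
proof -
  have "ring_map (\<lambda>f. poly (poly_in i f) (Var i))"
    by (simp add: ring_map_def poly_in_simps)
  moreover have "ring_map (\<lambda>f. f)" by (simp add: ring_map_def)
  ultimately show ?thesis
    by (rule ring_map_eqI[OF _ _ subset_UNIV]) (auto simp: poly_in_Var)
qed

lemma vars_coeff_poly_in: "vars (coeff (poly_in i f) l) \<subseteq> vars f - {i}"
  unfolding coeff_poly_in by (rule vars_mcoef)

lemma poly_in_power_mult: "i \<notin> vars c \<Longrightarrow> poly_in i (c * Var i ^ e) = Polynomial.monom c e"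
  by (simp add: poly_in_simps poly_in_free poly_in_Var monom_altdef)

section \<open>Taylor expansion and Hasse derivatives\<close>

definition taylor :: "nat \<Rightarrow> 'k::field mpoly \<Rightarrow> 'k mpoly poly"
  where "taylor i f = pcompose (poly_in i f) [:Var i, 1:]"

text \<open>The variable of the univariate polynomial \<open>taylor i f\<close> is the increment t,
  while x_i itself is back among the coefficients. The coefficient of \<open>t^j\<close> is thus the
  derivative of order j in x_i already divided by \<open>j!\<close>.\<close>

definition hasse :: "nat \<Rightarrow> nat \<Rightarrow> 'k::field mpoly \<Rightarrow> 'k mpoly"
  where "hasse i j f = coeff (taylor i f) j"

lemma ring_map_taylor: "ring_map (taylor i)"
  by (simp add: ring_map_def taylor_def poly_in_simps pcompose_add pcompose_mult pcompose_1)

lemmas taylor_simps = ring_mapD[OF ring_map_taylor]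

lemma taylor_free: "i \<notin> vars f \<Longrightarrow> taylor i f = [:f:]"
  by (simp add: taylor_def poly_in_free)

lemma taylor_Var: "taylor i (Var i) = [:Var i, 1:]"
  by (simp add: taylor_def poly_in_Var pcompose_pCons)

lemma hasse_add: "hasse i j (f + g) = hasse i j f + hasse i j g"
  and hasse_diff: "hasse i j (f - g) = hasse i j f - hasse i j g"
  and hasse_sum: "hasse i j (sum h Y) = (\<Sum>x\<in>Y. hasse i j (h x))"
  and hasse_0 [simp]: "hasse i j 0 = 0"
  by (simp_all add: hasse_def taylor_simps coeff_sum)

lemma hasse_mult: "hasse i j (f * g) = (\<Sum>l\<le>j. hasse i l f * hasse i (j - l) g)"
  by (simp add: hasse_def taylor_simps coeff_mult)

lemma hasse_free_mult: "i \<notin> vars c \<Longrightarrow> hasse i j (c * f) = c * hasse i j f"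
  by (simp add: hasse_def taylor_simps taylor_free)

lemma of_nat_mpoly: "(of_nat a :: 'k::field mpoly) = Const (of_nat a)"
  by (simp add: Const_def single_of_nat)

lemma hasse_Var_power: "hasse i j (Var i ^ e :: 'a::field mpoly) = Const (of_nat (e choose j)) * Var i ^ (e - j)"
proof -
  have "hasse i j (Var i ^ e :: 'a mpoly) = coeff ([:Var i, 1:] ^ e) j"
    by (simp add: hasse_def taylor_simps taylor_Var)
  also have "\<dots> = Const (of_nat (e choose j)) * Var i ^ (e - j)"
  proof (cases "j \<le> e")
    case True then show ?thesis by (simp add: coeff_linear_poly_power of_nat_mpoly)
  next
    case False
    then have "Polynomial.degree ([:Var i, 1:] ^ e :: 'a mpoly poly) < j"
      by (simp add: degree_linear_power)
    then have "coeff ([:Var i, 1:] ^ e :: 'a mpoly poly) j = 0" by (rule coeff_eq_0)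
    then show ?thesis using False by (simp add: binomial_eq_0)
  qed
  finally show ?thesis .
qed

lemma coef_hasse: "coef (hasse i j f) m = of_nat (coef m i + j choose j) * coef f (m + sgl i j)"
proof -
  have 1: "coef (hasse i j (sgl x c)) m = (if x = m + sgl i j then of_nat (coef m i + j choose j) * c else 0)" for x c
  proof -
    \<comment> \<open>\<open>y\<close> is the monomial \<open>x\<close> with its power of x_i
      removed; it passes through \<open>hasse\<close> as a constant, and only the power rule for x_i
      remains.\<close>
    define y where "y = x - sgl i (coef x i)"
    have x: "x = y + sgl i (coef x i)"
      by (rule poly_mapping_eqI) (simp add: y_def lookup_add lookup_minus lookup_single when_def)
    have y: "coef y i = 0" by (simp add: y_def lookup_minus)
    then have yv: "i \<notin> vars (sgl y c)" by (auto simp: notin_vars_iff lookup_single when_def)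
    have "sgl x c = sgl y c * Var i ^ coef x i"
      by (subst x) (simp add: Var_power mult_single)
    then have "hasse i j (sgl x c) = sgl y c * (Const (of_nat (coef x i choose j)) * Var i ^ (coef x i - j))"
      by (simp add: hasse_free_mult[OF yv] hasse_Var_power)
    also have "\<dots> = sgl (y + sgl i (coef x i - j)) (c * of_nat (coef x i choose j))"
      by (simp add: Var_power Const_def mult_single del: single_of_nat)
    finally have *: "coef (hasse i j (sgl x c)) m =
        (if y + sgl i (coef x i - j) = m then c * of_nat (coef x i choose j) else 0)"
      by (simp add: lookup_single when_def)
    show ?thesis
    proof (cases "j \<le> coef x i")
      case True
      have "y + sgl i (coef x i - j) = m \<longleftrightarrow> x = m + sgl i j"
      proof
        assume m: "y + sgl i (coef x i - j) = m"
        show "x = m + sgl i j"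
          by (subst x, subst m[symmetric]) (use True in \<open>simp add: add.assoc flip: single_add\<close>)
      next
        assume m: "x = m + sgl i j"
        have "coef (y + sgl i (coef x i - j)) l = coef m l" for l
          by (auto simp: y_def lookup_add lookup_minus lookup_single m when_def)
        then show "y + sgl i (coef x i - j) = m" by (rule poly_mapping_eqI)
      qed
      then show ?thesis unfolding * by (auto simp: lookup_add)
    next
      case False
      then have "x \<noteq> m + sgl i j" by (auto simp: lookup_add)
      then show ?thesis unfolding * using False by (simp add: binomial_eq_0)
    qed
  qed
  have "hasse i j f = (\<Sum>x\<in>supp f. hasse i j (sgl x (coef f x)))"
    by (subst (1) sum_singles[of f, symmetric]) (simp only: hasse_sum)
  then have "coef (hasse i j f) m =
      (\<Sum>x\<in>supp f. if x = m + sgl i j then of_nat (coef m i + j choose j) * coef f x else 0)"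
    by (simp add: lookup_sum 1)
  then show ?thesis by (simp add: in_keys_iff)
qed

lemma vars_hasse: "vars (hasse i j f) \<subseteq> vars f"
proof
  fix l assume "l \<in> vars (hasse i j f)"
  then obtain m where "coef (hasse i j f) m \<noteq> 0" "l \<in> supp m" by (auto simp: vars_def in_keys_iff)
  then have "m + sgl i j \<in> supp f" "l \<in> supp (m + sgl i j)"
    by (auto simp: coef_hasse in_keys_iff lookup_add)
  then show "l \<in> vars f" by (auto simp: vars_def)
qed

section \<open>Degree bounds in one variable\<close>

definition below :: "nat \<Rightarrow> nat \<Rightarrow> 'k::field mpoly \<Rightarrow> bool"
  where "below i d f \<longleftrightarrow> (\<forall>m. coef f m \<noteq> 0 \<longrightarrow> coef m i < d)"

lemma below_add: "below i d f \<Longrightarrow> below i d g \<Longrightarrow> below i d (f + g)"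
  and below_diff: "below i d f \<Longrightarrow> below i d g \<Longrightarrow> below i d (f - g)"
  and below_0 [simp]: "below i d 0"
  unfolding below_def by (auto simp: lookup_add lookup_minus) (metis add_0 diff_0_right)+

lemma below_mcoef: "below i d f \<Longrightarrow> below i d (mcoef S a f)"
  unfolding below_def by (auto simp: coef_mcoef lookup_add split: if_splits)

lemma below_hasse:
  assumes "below i d f" shows "below i d (hasse l j f)"
  unfolding below_def
proof (intro allI impI)
  fix m assume "coef (hasse l j f) m \<noteq> 0"
  then have "coef (m + sgl l j) i < d" using assms by (auto simp: below_def coef_hasse)
  then show "coef m i < d" by (simp add: lookup_add)
qed

lemma below_mult_free:
  assumes "below i d f" "i \<notin> vars g"
  shows "below i d (f * g)"
  unfolding below_def
proof (intro allI impI)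
  fix m assume "coef (f * g) m \<noteq> 0"
  then obtain a b where "m = a + b" "coef f a \<noteq> 0" "coef g b \<noteq> 0"
    using keys_mult[of f g] by (auto simp: in_keys_iff subset_iff)
  then show "coef m i < d" using assms by (auto simp: below_def notin_vars_iff lookup_add)
qed

lemma below_iff_coeff: "below i d f \<longleftrightarrow> (\<forall>l\<ge>d. coeff (poly_in i f) l = 0)"
proof
  assume f: "below i d f"
  show "\<forall>l\<ge>d. coeff (poly_in i f) l = 0"
  proof (intro allI impI poly_mapping_eqI)
    fix l m assume "d \<le> l"
    then show "coef (coeff (poly_in i f) l) m = coef 0 m"
      using f unfolding below_def by (force simp: coeff_poly_in coef_mcoef lookup_add)
  qed
next
  assume *: "\<forall>l\<ge>d. coeff (poly_in i f) l = 0"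
  show "below i d f"
    unfolding below_def
  proof (intro allI impI, rule ccontr)
    fix m assume m: "coef f m \<noteq> 0" "\<not> coef m i < d"
    let ?m = "m - sgl i (coef m i)"
    have "coef (mcoef {i} (sgl i (coef m i)) f) ?m = 0"
      using * m by (simp flip: coeff_poly_in)
    moreover have "sgl i (coef m i) + ?m = m"
      by (rule poly_mapping_eqI) (simp add: lookup_add lookup_minus lookup_single when_def)
    moreover have "supp ?m \<inter> {i} = {}" by (simp add: in_keys_iff lookup_minus)
    ultimately show False using m by (simp add: coef_mcoef)
  qed
qed

lemma degree_less_iff_coeff:
  assumes "0 < d"
  shows "Polynomial.degree p < d \<longleftrightarrow> (\<forall>l\<ge>d. coeff p l = 0)"
proof
  assume "\<forall>l\<ge>d. coeff p l = 0"
  then show "Polynomial.degree p < d"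
    using assms by (metis degree_0 leading_coeff_0_iff not_le)
qed (auto intro: coeff_eq_0)

lemma below_iff_degree: "0 < d \<Longrightarrow> below i d f \<longleftrightarrow> Polynomial.degree (poly_in i f) < d"
  unfolding below_iff_coeff by (rule degree_less_iff_coeff[symmetric])

text \<open>Composition with the monic linear polynomial \<open>[:Var i, 1:]\<close> changes neither
  the degree nor the leading coefficient.\<close>

lemma degree_taylor: "Polynomial.degree (taylor i f) = Polynomial.degree (poly_in i f)"
  and lead_coeff_taylor: "lead_coeff (taylor i f) = lead_coeff (poly_in i f)"
proof -
  show *: "Polynomial.degree (taylor i f) = Polynomial.degree (poly_in i f)"
    by (simp add: taylor_def degree_pcompose)
  show "lead_coeff (taylor i f) = lead_coeff (poly_in i f)"
    using lead_coeff_comp[of "[:Var i, 1:]" "poly_in i f"] by (simp add: taylor_def)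
qed

text \<open>Expresses the degree bound through Hasse derivatives, which commute with the group; this
  is how the bound is seen to be stable under the action.\<close>

lemma below_iff_hasse: 
  assumes "0 < d"
  shows "below i d f \<longleftrightarrow> (\<forall>j\<ge>d. hasse i j f = 0)"
  using assms degree_less_iff_coeff[of d "taylor i f"]
  by (simp add: below_iff_degree degree_taylor hasse_def)

section \<open>Total degree and homogeneous components\<close>

definition tdeg :: "(nat \<Rightarrow>\<^sub>0 nat) \<Rightarrow> nat"
  where "tdeg m = (\<Sum>j\<in>supp m. coef m j)"

lemma tdeg_superset: "finite K \<Longrightarrow> supp m \<subseteq> K \<Longrightarrow> tdeg m = (\<Sum>j\<in>K. coef m j)"
  unfolding tdeg_def by (rule sum.mono_neutral_left) (auto simp: in_keys_iff)

lemma tdeg_add: "tdeg (m + m') = tdeg m + tdeg m'"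
proof -
  let ?K = "supp m \<union> supp m'"
  have "supp (m + m') \<subseteq> ?K" by (rule keys_add)
  then show ?thesis by (simp add: tdeg_superset[of ?K] lookup_add sum.distrib)
qed

lemma tdeg_single [simp]: "tdeg (sgl i a) = a"
  by (auto simp: tdeg_def)

lemma tdeg_0_iff [simp]: "tdeg m = 0 \<longleftrightarrow> m = 0"
  by (auto simp: tdeg_def poly_mapping_eq_iff fun_eq_iff in_keys_iff)

definition homog :: "nat \<Rightarrow> 'k::field mpoly \<Rightarrow> bool"
  where "homog e f \<longleftrightarrow> (\<forall>m. coef f m \<noteq> 0 \<longrightarrow> tdeg m = e)"

lemma homog_mult:
  assumes "homog a f" "homog b g" shows "homog (a + b) (f * g)"
  unfolding homog_def
proof (intro allI impI)
  fix m assume "coef (f * g) m \<noteq> 0"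
  then obtain x y where "m = x + y" "coef f x \<noteq> 0" "coef g y \<noteq> 0"
    using keys_mult[of f g] by (auto simp: in_keys_iff subset_iff)
  then show "tdeg m = a + b" using assms by (auto simp: homog_def tdeg_add)
qed

lemma homog_one: "homog 0 1"
  by (auto simp: homog_def lookup_one when_def split: if_splits)

lemma homog_prod: "finite S \<Longrightarrow> (\<And>x. x \<in> S \<Longrightarrow> homog 1 (h x)) \<Longrightarrow> homog (card S) (prod h S)"
proof (induction S rule: finite_induct)
  case (insert x S)
  then show ?case using homog_mult[of 1 "h x" "card S" "prod h S"] by simp
qed (simp add: homog_one)

lemma homog_hasse: "homog e f \<Longrightarrow> homog (e - j) (hasse i j f)"
  unfolding homog_def by (auto simp: coef_hasse tdeg_add)

text \<open>The substitution of \<open>t x\<^sub>j\<close> for each \<open>x\<^sub>j\<close>: the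
  coefficient of \<open>t^e\<close> is the homogeneous component of degree e. As a ring map it makes
  compatibility with linear substitutions a check on variables.\<close>

definition grading :: "'k::field mpoly \<Rightarrow> 'k mpoly poly"
  where "grading = ev (\<lambda>c. [:Const c:]) (\<lambda>j. [:0, Var j:])"

definition hcomp :: "nat \<Rightarrow> 'k::field mpoly \<Rightarrow> 'k mpoly"
  where "hcomp e f = coeff (grading f) e"

lemma ring_map_grading: "ring_map grading"
  by (simp add: grading_def ring_map_ev ring_map_pConst)

lemma grading_Const [simp]: "grading (Const c) = [:Const c:]"
  and grading_Var [simp]: "grading (Var i) = [:0, Var i:]"
  by (simp_all add: grading_def ring_map_pConst)

lemma coef_hcomp: "coef (hcomp e f) m = (if tdeg m = e then coef f m else 0)"
proof -
  have pw: "[:0, h:] ^ a = Polynomial.monom (h ^ a) a" for h :: "'a mpoly" and a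
    by (induction a) (auto simp: monom_altdef one_pCons mult_ac)
  have pr: "(\<Prod>j\<in>Y. Polynomial.monom (h j) (a j)) = Polynomial.monom (\<Prod>j\<in>Y. h j) (\<Sum>j\<in>Y. a j)"
    for h :: "nat \<Rightarrow> 'a mpoly" and a Y
    by (induction Y rule: infinite_finite_induct) (auto simp: mult_monom one_pCons monom_0)
  have "mprod (\<lambda>j. [:0, Var j:] :: 'a mpoly poly) m = Polynomial.monom (sgl m 1) (tdeg m)" for m
    unfolding mprod_Var[symmetric] by (simp add: mprod_def tdeg_def pw pr)
  then have "grading f = (\<Sum>x\<in>supp f. Polynomial.monom (sgl x (coef f x)) (tdeg x))"
    by (simp add: grading_def ev_def Const_def mult_single smult_monom)
  then have "coef (hcomp e f) m = (\<Sum>x\<in>supp f. coef (if tdeg x = e then sgl x (coef f x) else 0) m)"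
    by (simp add: hcomp_def coeff_sum coeff_monom lookup_sum)
  also have "\<dots> = (\<Sum>x\<in>supp f. if x = m then (if tdeg m = e then coef f m else 0) else 0)"
    by (intro sum.cong) (auto simp: lookup_single when_def)
  also have "\<dots> = (if tdeg m = e then coef f m else 0)"
    by (simp add: in_keys_iff)
  finally show ?thesis .
qed

lemma homog_hcomp: "homog e (hcomp e f)"
  by (auto simp: homog_def coef_hcomp)

lemma vars_hcomp: "vars (hcomp e f) \<subseteq> vars f"
  unfolding vars_def by (force simp: in_keys_iff coef_hcomp split: if_splits)

lemma below_hcomp: "below i d f \<Longrightarrow> below i d (hcomp e f)"
  by (auto simp: below_def coef_hcomp)

lemma hcomp_homog: "homog e f \<Longrightarrow> hcomp a f = (if a = e then f else 0)"
  by (rule poly_mapping_eqI) (auto simp: coef_hcomp homog_def)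

lemma sum_hcomp: "(\<Sum>e\<in>tdeg ` supp f. hcomp e f) = f"
  by (rule poly_mapping_eqI) (auto simp: lookup_sum coef_hcomp in_keys_iff image_iff)

text \<open>Translating x_i by t before or after \<open>s\<close> gives the same result, since
  \<open>s\<close> sends x_i to x_i + l and neither l nor the images of the other variables contain
  x_i. Comparing coefficients of \<open>t^j\<close> in this identity of ring maps gives the
  claim.\<close>

lemma hasse_subst:
  assumes "vars f \<subseteq> I" "i \<in> I" "s i = Var i + l" "i \<notin> vars l" "\<And>j. j \<in> I \<Longrightarrow> j \<noteq> i \<Longrightarrow> i \<notin> vars (s j)"
  shows "hasse i j (subst s f) = subst s (hasse i j f)"
proof -
  have "taylor i (subst s f) = map_poly (subst s) (taylor i f)"
  proof (rule ring_map_eqI[OF ring_map_comp[OF ring_map_taylor ring_map_subst]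
          ring_map_comp[OF ring_map_map_poly[OF ring_map_subst] ring_map_taylor] assms(1)])
    fix j assume "j \<in> I"
    then show "taylor i (subst s (Var j)) = map_poly (subst s) (taylor i (Var j))"
      using assms by (cases "j = i")
        (simp_all add: taylor_Var taylor_free taylor_simps map_poly_pCons subst_simps)
  qed (simp add: taylor_free map_poly_pCons subst_simps)
  then show ?thesis by (simp add: hasse_def coeff_map_poly subst_simps)
qed

lemma grading_homog1: "homog 1 f \<Longrightarrow> grading f = [:0, f:]"
  by (rule poly_eqI) (auto simp: hcomp_homog coeff_pCons simp flip: hcomp_def split: nat.splits)

lemma hcomp_subst:
  assumes "vars f \<subseteq> I" "\<And>j. j \<in> I \<Longrightarrow> homog 1 (s j)"
  shows "hcomp e (subst s f) = subst s (hcomp e f)"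
proof -
  have "grading (subst s f) = map_poly (subst s) (grading f)"
    by (rule ring_map_eqI[OF ring_map_comp[OF ring_map_grading ring_map_subst]
          ring_map_comp[OF ring_map_map_poly[OF ring_map_subst] ring_map_grading] assms(1)])
      (simp_all add: grading_homog1[OF assms(2)] map_poly_pCons subst_simps)
  then show ?thesis by (simp add: hcomp_def coeff_map_poly subst_simps)
qed


section \<open>Ideals and division by monic polynomials\<close>

lemma carrier_mpoly_ring [simp]: "carrier (mpoly_ring I) = {f. vars f \<subseteq> I}"
  and mpoly_ring_ops [simp]: "monoid.mult (mpoly_ring I) = (*)" "one (mpoly_ring I) = 1"
    "ring.zero (mpoly_ring I) = 0" "add (mpoly_ring I) = (+)"
  by (simp_all add: mpoly_ring_def)

lemma cring_mpoly_ring: "cring (mpoly_ring I :: 'k::field mpoly ring)"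
proof (rule cringI)
  show "abelian_group (mpoly_ring I :: 'k mpoly ring)"
  proof (rule abelian_groupI)
    fix f :: "'k mpoly" assume f: "f \<in> carrier (mpoly_ring I)"
    show "\<exists>g\<in>carrier (mpoly_ring I). g \<oplus>\<^bsub>mpoly_ring I\<^esub> f = \<zero>\<^bsub>mpoly_ring I\<^esub>"
      by (rule bexI[of _ "- f"]) (use f in simp_all)
  qed (use vars_add in \<open>auto simp: add_ac, blast\<close>)
  show "comm_monoid (mpoly_ring I :: 'k mpoly ring)"
    by (rule comm_monoidI) (use vars_mult in \<open>auto simp: mult_ac, blast\<close>)
qed (auto simp: algebra_simps)

lemma ring_mpoly_ring: "ring (mpoly_ring I :: 'k::field mpoly ring)"
  using cring_mpoly_ring by (rule cring.axioms)

lemma ideal_mpoly_ringI: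
  assumes "\<And>f. f \<in> J \<Longrightarrow> vars f \<subseteq> K" "0 \<in> J" "\<And>f g. f \<in> J \<Longrightarrow> g \<in> J \<Longrightarrow> f + g \<in> J"
    and mult: "\<And>a f. vars a \<subseteq> K \<Longrightarrow> f \<in> J \<Longrightarrow> a * f \<in> J"
  shows "ideal (J :: 'k::field mpoly set) (mpoly_ring K)"
proof (rule idealI[OF ring_mpoly_ring])
  interpret R: ring "mpoly_ring K :: 'k mpoly ring" by (rule ring_mpoly_ring)
  have mult': "f * a \<in> J" if "vars a \<subseteq> K" "f \<in> J" for a f
    using mult[OF that] by (simp add: Groups.mult.commute)
  have um: "- f \<in> J" if "f \<in> J" for f
    using mult[of "- 1" f] that by simp
  have neg: "inv\<^bsub>add_monoid (mpoly_ring K)\<^esub> f = - f" if "f \<in> J" for f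
    using R.minus_equality[of "- f" f] assms(1)[OF that] by (simp add: a_inv_def)
  show "subgroup J (add_monoid (mpoly_ring K))"
    by (rule group.subgroupI) (use assms um neg R.a_group in auto)
  show "x \<otimes>\<^bsub>mpoly_ring K\<^esub> a \<in> J" "a \<otimes>\<^bsub>mpoly_ring K\<^esub> x \<in> J"
    if "a \<in> J" "x \<in> carrier (mpoly_ring K)" for a x
    using that mult mult' by auto
qed

lemma ideal_mpoly_ringD:
  assumes "ideal (J :: 'k::field mpoly set) (mpoly_ring K)"
  shows "f \<in> J \<Longrightarrow> vars f \<subseteq> K" "0 \<in> J" "f \<in> J \<Longrightarrow> g \<in> J \<Longrightarrow> f + g \<in> J"
    "vars a \<subseteq> K \<Longrightarrow> f \<in> J \<Longrightarrow> a * f \<in> J" "vars a \<subseteq> K \<Longrightarrow> f \<in> J \<Longrightarrow> f * a \<in> J"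
    "f \<in> J \<Longrightarrow> - f \<in> J" "f \<in> J \<Longrightarrow> g \<in> J \<Longrightarrow> f - g \<in> J"
    "(\<And>x. x \<in> S \<Longrightarrow> h x \<in> J) \<Longrightarrow> sum h S \<in> J"
proof -
  interpret ideal J "mpoly_ring K" by fact
  show "f \<in> J \<Longrightarrow> vars f \<subseteq> K" using Icarr[of f] by simp
  show zero: "0 \<in> J" using additive_subgroup.zero_closed[OF is_additive_subgroup] by simp
  show add: "f \<in> J \<Longrightarrow> g \<in> J \<Longrightarrow> f + g \<in> J" for f g using additive_subgroup.a_closed[OF is_additive_subgroup, of f g] by simp
  show mult: "vars a \<subseteq> K \<Longrightarrow> f \<in> J \<Longrightarrow> a * f \<in> J" for a f using I_l_closed[of f a] by simp
  then show "vars a \<subseteq> K \<Longrightarrow> f \<in> J \<Longrightarrow> f * a \<in> J" by (simp add: mult.commute)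
  show um: "f \<in> J \<Longrightarrow> - f \<in> J" for f using mult[of "- 1" f] by simp
  show "f \<in> J \<Longrightarrow> g \<in> J \<Longrightarrow> f - g \<in> J" using add[of f "- g"] um by simp
  show "(\<And>x. x \<in> S \<Longrightarrow> h x \<in> J) \<Longrightarrow> sum h S \<in> J"
    by (induction S rule: infinite_finite_induct) (auto intro: zero add)
qed

lemma genideal_mpoly_ring:
  assumes "S \<subseteq> {f. vars f \<subseteq> K}"
  shows "ideal (Idl\<^bsub>mpoly_ring K\<^esub> S) (mpoly_ring K :: 'k::field mpoly ring)"
    "f \<in> S \<Longrightarrow> f \<in> Idl\<^bsub>mpoly_ring K\<^esub> S"
    "ideal J (mpoly_ring K) \<Longrightarrow> S \<subseteq> J \<Longrightarrow> f \<in> Idl\<^bsub>mpoly_ring K\<^esub> S \<Longrightarrow> f \<in> J"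
proof -
  interpret ring "mpoly_ring K :: 'k mpoly ring" by (rule ring_mpoly_ring)
  have S: "S \<subseteq> carrier (mpoly_ring K)" using assms by auto
  show "ideal (Idl\<^bsub>mpoly_ring K\<^esub> S) (mpoly_ring K)" by (rule genideal_ideal[OF S])
  show "f \<in> S \<Longrightarrow> f \<in> Idl\<^bsub>mpoly_ring K\<^esub> S" using genideal_self[OF S] by blast
  show "ideal J (mpoly_ring K) \<Longrightarrow> S \<subseteq> J \<Longrightarrow> f \<in> Idl\<^bsub>mpoly_ring K\<^esub> S \<Longrightarrow> f \<in> J"
    using genideal_minimal by blast
qed

text \<open>The Hasse derivative of highest order is the leading coefficient, so it lies in
  \<open>J\<close>; subtracting the leading term keeps all derivatives of positive order in
  \<open>J\<close> and lowers the degree. Order 0 is left out so that \<open>f\<close> itself need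
  not be known to lie in \<open>J\<close>.\<close>

lemma coeff_in_ideal_of_hasse:
  assumes J: "ideal J (mpoly_ring K)" and "i \<in> K"
    and "\<And>j. 0 < j \<Longrightarrow> hasse i j f \<in> J"
  shows "0 < l \<Longrightarrow> coeff (poly_in i f) l \<in> J"
  using assms(3)
proof (induction "Polynomial.degree (poly_in i f)" arbitrary: f l rule: less_induct)
  case less
  note Jd = ideal_mpoly_ringD[OF J]
  show ?case
  proof (cases "Polynomial.degree (poly_in i f) = 0")
    case True then show ?thesis using less.prems(1) Jd(2) by (simp add: coeff_eq_0)
  next
    case False
    define m where "m = Polynomial.degree (poly_in i f)"
    define c where "c = coeff (poly_in i f) m"
    have "c = hasse i m f"
      using lead_coeff_taylor[of i f] by (simp add: hasse_def c_def m_def degree_taylor)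
    then have c: "c \<in> J" using less.prems(2) False by (simp add: m_def)
    have ci: "i \<notin> vars c" using vars_coeff_poly_in[of i f m] by (auto simp: c_def)
    define f' where "f' = f - c * Var i ^ m"
    have p: "poly_in i f' = poly_in i f - Polynomial.monom c m"
      by (simp add: f'_def poly_in_simps(6) poly_in_power_mult[OF ci])
    have "\<forall>l\<ge>m. coeff (poly_in i f') l = 0"
      unfolding p by (auto simp: coeff_monom c_def m_def intro: coeff_eq_0)
    then have "Polynomial.degree (poly_in i f') < m"
      using False degree_less_iff_coeff[of m "poly_in i f'"] by (simp add: m_def)
    moreover have "hasse i j f' \<in> J" if "0 < j" for j
    proof -
      have "vars (hasse i j (Var i ^ m)) \<subseteq> K"
        using vars_hasse[of i j "Var i ^ m"] vars_power[of "Var i" m] \<open>i \<in> K\<close> by auto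
      then show ?thesis
        using less.prems(2)[OF that] c
        unfolding f'_def hasse_diff hasse_free_mult[OF ci] by (intro Jd(7) Jd(5))
    qed
    ultimately have "coeff (poly_in i f') l \<in> J"
      using less.hyps[of f' l] less.prems(1) by (simp add: m_def)
    moreover have "coeff (poly_in i f) l = coeff (poly_in i f') l + coeff (Polynomial.monom c m) l"
      by (simp add: p)
    ultimately show ?thesis using c Jd(2,3) by (simp add: coeff_monom)
  qed
qed

lemma hasse_zero_order [simp]: "hasse i 0 f = f"
  by (rule poly_mapping_eqI) (simp add: coef_hasse)

text \<open>By the product rule, the polynomials all of whose Hasse derivatives lie in the ideal
  form an ideal themselves, so testing generators suffices.\<close>

lemma genideal_hasse_closed:
  assumes S: "S \<subseteq> {f :: 'k::field mpoly. vars f \<subseteq> K}"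
    and h: "\<And>f j. f \<in> S \<Longrightarrow> hasse i j f \<in> Idl\<^bsub>mpoly_ring K\<^esub> S"
    and f: "f \<in> Idl\<^bsub>mpoly_ring K\<^esub> S"
  shows "hasse i j f \<in> Idl\<^bsub>mpoly_ring K\<^esub> S"
proof -
  let ?J = "Idl\<^bsub>mpoly_ring K\<^esub> S"
  note J = ideal_mpoly_ringD[OF genideal_mpoly_ring(1)[OF S]]
  have "ideal {f. vars f \<subseteq> K \<and> (\<forall>j. hasse i j f \<in> ?J)} (mpoly_ring K)"
  proof (rule ideal_mpoly_ringI)
    fix a f :: "'k mpoly" assume "vars a \<subseteq> K" "f \<in> {f. vars f \<subseteq> K \<and> (\<forall>j. hasse i j f \<in> ?J)}"
    then show "a * f \<in> {f. vars f \<subseteq> K \<and> (\<forall>j. hasse i j f \<in> ?J)}"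
      using vars_mult[of a f] vars_hasse[of i _ a] by (auto simp: hasse_mult intro!: J(8) J(4))
  next
    fix f g assume "f \<in> {f. vars f \<subseteq> K \<and> (\<forall>j. hasse i j f \<in> ?J)}"
      "g \<in> {f. vars f \<subseteq> K \<and> (\<forall>j. hasse i j f \<in> ?J)}"
    then show "f + g \<in> {f. vars f \<subseteq> K \<and> (\<forall>j. hasse i j f \<in> ?J)}"
      using vars_add[of f g] by (auto simp: hasse_add J)
  qed (auto simp: J)
  from genideal_mpoly_ring(3)[OF S this _ f] show ?thesis
    using S h by auto
qed

text \<open>Derivatives of positive order give the coefficients of positive index. The one of index
  0 is what remains of \<open>f\<close>, which lies in \<open>J\<close> as its own derivative of
  order 0.\<close>

lemma coeff_in_hasse_closed_ideal:
  assumes J: "ideal J (mpoly_ring K)" and "i \<in> K"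
    and hasse: "\<And>j. hasse i j f \<in> J"
  shows "coeff (poly_in i f) l \<in> J"
proof -
  note Jd = ideal_mpoly_ringD[OF J]
  have pos: "0 < l \<Longrightarrow> coeff (poly_in i f) l \<in> J" for l
    by (rule coeff_in_ideal_of_hasse[OF J \<open>i \<in> K\<close> hasse])
  have f: "f \<in> J" using hasse[of 0] by simp
  let ?m = "Polynomial.degree (poly_in i f)"
  have "f = (\<Sum>l\<le>?m. coeff (poly_in i f) l * Var i ^ l)"
    using poly_poly_in[of i f] by (simp add: poly_altdef)
  also have "\<dots> = coeff (poly_in i f) 0 + (\<Sum>l\<in>{1..?m}. coeff (poly_in i f) l * Var i ^ l)"
    by (simp add: atMost_atLeast0 sum.atLeast_Suc_atMost)
  finally have "coeff (poly_in i f) 0 = f - (\<Sum>l\<in>{1..?m}. coeff (poly_in i f) l * Var i ^ l)"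
    by (rule eq_diff_eq[THEN iffD2, OF sym])
  moreover have "(\<Sum>l\<in>{1..?m}. coeff (poly_in i f) l * Var i ^ l) \<in> J"
    using vars_power[of "Var i"] \<open>i \<in> K\<close> by (intro Jd(8) Jd(5) pos) fastforce+
  ultimately have "coeff (poly_in i f) 0 \<in> J" using f Jd(7) by simp
  then show ?thesis using pos by (cases "l = 0") auto
qed

lemma mcoef_in_closed:
  assumes "finite S"
    and "\<And>i l f. i \<in> S \<Longrightarrow> f \<in> J \<Longrightarrow> coeff (poly_in i f) l \<in> J"
    and "supp a \<subseteq> S" "f \<in> (J :: 'k::field mpoly set)"
  shows "mcoef S a f \<in> J"
  using assms
proof (induction S arbitrary: a f rule: finite_induct)
  case empty
  then have "mcoef {} a f = f" by (intro poly_mapping_eqI) (simp add: coef_mcoef)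
  then show ?case using empty by simp
next
  case (insert i S)
  let ?b = "mono_part S a"
  have "a = sgl i (coef a i) + ?b"
    using insert.prems(2) insert.hyps(2)
    by (intro poly_mapping_eqI) (auto simp: lookup_add coef_mono_part lookup_single when_def in_keys_iff)
  then have "mcoef (insert i S) a f = mcoef S ?b (coeff (poly_in i f) (coef a i))"
    using mcoef_mcoef[OF supp_mono_part insert.hyps(2), of a "coef a i" f] by (simp add: coeff_poly_in)
  then show ?case
    using insert.IH[of ?b "coeff (poly_in i f) (coef a i)"] insert.prems supp_mono_part by auto
qed

text \<open>The set \<open>M\<close> carries whatever must survive the division. It only has to be
  closed under differences and to contain the multiples of \<open>N\<close> subtracted in long
  division. It is used for degree bounds in other variables, for \<open>H'\<close>, and for
  \<open>UNIV\<close> when nothing has to be kept.\<close>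

lemma division_by_monic:
  fixes N :: "'k::field mpoly"
  assumes "0 < d" and N: "below i (Suc d) N" "coeff (poly_in i N) d = 1"
    and diff: "\<And>f g. f \<in> M \<Longrightarrow> g \<in> M \<Longrightarrow> f - g \<in> M"
    and red: "\<And>f e a. f \<in> M \<Longrightarrow> coeff (poly_in i f) e * Var i ^ a * N \<in> M"
    and K: "i \<in> K" "vars N \<subseteq> K"
    and f: "f \<in> M" "vars f \<subseteq> K"
  obtains q where "vars q \<subseteq> K" "f - q * N \<in> M" "below i d (f - q * N)"
proof -
  have "\<exists>q. vars q \<subseteq> K \<and> f - q * N \<in> M \<and> below i d (f - q * N)"
    using f
  proof (induction "Polynomial.degree (poly_in i f)" arbitrary: f rule: less_induct)
    case less
    define m where "m = Polynomial.degree (poly_in i f)"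
    show ?case
    proof (cases "m < d")
      case True
      then have "below i d f" using \<open>0 < d\<close> by (simp add: below_iff_degree m_def)
      then show ?thesis using less.prems by (intro exI[of _ 0]) simp
    next
      case False
      define c where "c = coeff (poly_in i f) m"
      have ci: "i \<notin> vars c" and cK: "vars c \<subseteq> K"
        using vars_coeff_poly_in[of i f m] less.prems(2) by (auto simp: c_def)
      define u where "u = c * Var i ^ (m - d)"
      have uK: "vars u \<subseteq> K"
        using vars_mult[of c "Var i ^ (m - d)"] vars_power[of "Var i" "m - d"] K cK by (auto simp: u_def)
      define f' where "f' = f - u * N"
      have p: "poly_in i f' = poly_in i f - Polynomial.monom c (m - d) * poly_in i N"
        by (simp only: f'_def u_def poly_in_simps(4)[of i "c * Var i ^ (m - d)" N] poly_in_simps(6) poly_in_power_mult[OF ci])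
      have "\<forall>l\<ge>m. coeff (poly_in i f') l = 0"
      proof (intro allI impI)
        fix l assume "m \<le> l"
        then have "coeff (poly_in i f) l = (if l = m then c else 0)"
          by (auto simp: c_def m_def intro: coeff_eq_0)
        moreover have "coeff (Polynomial.monom c (m - d) * poly_in i N) l = (if l = m then c else 0)"
          using N \<open>m \<le> l\<close> False by (auto simp: coeff_monom_mult below_iff_coeff)
        ultimately show "coeff (poly_in i f') l = 0" by (simp add: p)
      qed
      then have "Polynomial.degree (poly_in i f') < m"
        using False \<open>0 < d\<close> degree_less_iff_coeff[of m "poly_in i f'"] by simp
      moreover have "f' \<in> M"
        unfolding f'_def u_def c_def using less.prems(1) by (intro diff red)
      moreover have "vars f' \<subseteq> K"
        unfolding f'_def using vars_diff[of f "u * N"] vars_mult[of u N] less.prems(2) uK K by blast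
      ultimately obtain q where "vars q \<subseteq> K" "f' - q * N \<in> M" "below i d (f' - q * N)"
        using less.hyps m_def by blast
      moreover have "f' - q * N = f - (u + q) * N" by (simp add: f'_def algebra_simps)
      moreover have "vars (u + q) \<subseteq> K" using vars_add[of u q] uK \<open>vars q \<subseteq> K\<close> by auto
      ultimately show ?thesis by metis
    qed
  qed
  then show ?thesis using that by blast
qed

text \<open>Uniqueness of the remainder: over a domain a nonzero multiple of a polynomial with a
  nonzero coefficient at index d has degree at least d.\<close>

lemma below_mult_monic:
  fixes N :: "'k::field mpoly"
  assumes "0 < d" "below i (Suc d) N" "coeff (poly_in i N) d = 1" "below i d (s * N)"
  shows "s = 0"
proof (rule ccontr)
  assume "s \<noteq> 0"
  then have s: "poly_in i s \<noteq> 0" using poly_poly_in[of i s] by fastforce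
  have N: "poly_in i N \<noteq> 0" using assms(3) by auto
  have "d \<le> Polynomial.degree (poly_in i N)" using assms(3) by (intro le_degree) simp
  then have "d \<le> Polynomial.degree (poly_in i (s * N))"
    using s N by (simp add: poly_in_simps(4) degree_mult_eq)
  then show False using assms(1,4) by (simp add: below_iff_degree)
qed


section \<open>Generators of the Hilbert ideal\<close>

text \<open>The constant term is evaluation at the origin.\<close>

lemma ring_map_coef_0: "ring_map (\<lambda>f :: 'k::field mpoly. coef f 0)"
proof -
  have "mprod (\<lambda>_. 0 :: 'k) m = (if m = 0 then 1 else 0)" for m
    by (auto simp: mprod_def poly_mapping_eq_iff fun_eq_iff in_keys_iff)
  then have "ev (\<lambda>c. c) (\<lambda>_. 0) f = coef f 0" for f :: "'k mpoly"
    by (simp add: ev_def if_distrib[of "\<lambda>x. _ * x"] in_keys_iff cong: if_cong)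
  then show ?thesis
    using ring_map_ev[of "\<lambda>c. c" "\<lambda>_. 0 :: 'k"] by (simp add: ring_map_def)
qed

lemmas coef_0_simps = ring_mapD[OF ring_map_coef_0]

lemma homog_coef_0: "homog e f \<Longrightarrow> 0 < e \<Longrightarrow> coef f 0 = 0"
  unfolding homog_def using tdeg_0_iff[of 0] by fastforce

text \<open>The representation reduced to coordinates: \<open>L g j\<close> is the linear form g
  x_j, and g acts on polynomials by \<open>subst (L g)\<close>. \<open>L_terminal\<close> is the
  place where a p-group in characteristic p enters, and the set \<open>S\<close> in
  \<open>L_block\<close> stands for the variables that come from the i-th summand.\<close>

locale terminal_action = group G for G :: "('g, 'x) monoid_scheme" (structure) +
  fixes L :: "'g \<Rightarrow> nat \<Rightarrow> 'k::field mpoly" and n k :: nat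
  assumes fin: "finite (carrier G)"
    and kn: "k \<le> n"
    and vars_L: "g \<in> carrier G \<Longrightarrow> j \<le> n \<Longrightarrow> vars (L g j) \<subseteq> {..n}"
    and homog_L: "g \<in> carrier G \<Longrightarrow> j \<le> n \<Longrightarrow> homog 1 (L g j)"
    and L_one: "j \<le> n \<Longrightarrow> L \<one> j = Var j"
    and L_mult: "g \<in> carrier G \<Longrightarrow> h \<in> carrier G \<Longrightarrow> j \<le> n \<Longrightarrow> L (g \<otimes> h) j = subst (L g) (L h j)"
    and L_terminal: "g \<in> carrier G \<Longrightarrow> i \<le> k \<Longrightarrow> \<exists>l. L g i = Var i + l \<and> i \<notin> vars l"
    and L_other: "g \<in> carrier G \<Longrightarrow> i \<le> k \<Longrightarrow> j \<le> n \<Longrightarrow> j \<noteq> i \<Longrightarrow> i \<notin> vars (L g j)"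
    and L_block: "i \<le> k \<Longrightarrow> \<exists>S. S \<inter> {..k} = {i} \<and> (\<forall>g\<in>carrier G. \<forall>j\<le>n.
      (j \<in> S \<longrightarrow> vars (L g j) \<subseteq> S) \<and> (j \<notin> S \<longrightarrow> vars (L g j) \<inter> S = {}))"
begin

abbreviation "R \<equiv> mpoly_ring {..n} :: 'k mpoly ring"

definition Invs :: "'k mpoly set"
  where "Invs = {f. vars f \<subseteq> {..n} \<and> (\<forall>g\<in>carrier G. subst (L g) f = f)}"

definition H :: "'k mpoly set"
  where "H = Idl\<^bsub>R\<^esub> {f \<in> Invs. coef f 0 = 0}"

definition monic_inv :: "nat \<Rightarrow> 'k mpoly \<Rightarrow> bool"
  where "monic_inv i f \<longleftrightarrow> f \<in> Invs \<and> lead_coeff (poly_in i f) = 1 \<and> 0 < Polynomial.degree (poly_in i f)"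

definition d :: "nat \<Rightarrow> nat"
  where "d i = (LEAST e. \<exists>f. monic_inv i f \<and> Polynomial.degree (poly_in i f) = e)"

lemma InvsD: "f \<in> Invs \<Longrightarrow> vars f \<subseteq> {..n}" "f \<in> Invs \<Longrightarrow> g \<in> carrier G \<Longrightarrow> subst (L g) f = f"
  by (auto simp: Invs_def)

lemma Invs_Const [simp]: "Const c \<in> Invs"
  by (simp add: Invs_def)

lemma Invs_diff: "f \<in> Invs \<Longrightarrow> f' \<in> Invs \<Longrightarrow> f - f' \<in> Invs"
  using vars_diff[of f f'] by (auto simp: Invs_def subst_simps)

lemma Invs_mult: "f \<in> Invs \<Longrightarrow> f' \<in> Invs \<Longrightarrow> f * f' \<in> Invs"
  using vars_mult[of f f'] by (auto simp: Invs_def subst_simps)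

lemma vars_act: "g \<in> carrier G \<Longrightarrow> vars f \<subseteq> {..n} \<Longrightarrow> vars (subst (L g) f) \<subseteq> {..n}"
  by (rule vars_subst) (auto intro: vars_L[THEN subsetD, simplified])

lemma hasse_act:
  assumes "g \<in> carrier G" "i \<le> k" "vars f \<subseteq> {..n}"
  shows "hasse i j (subst (L g) f) = subst (L g) (hasse i j f)"
proof -
  obtain l where l: "L g i = Var i + l" "i \<notin> vars l" using L_terminal assms by blast
  show ?thesis
    using hasse_subst[where I = "{..n}" and i = i and s = "L g" and l = l] assms kn L_other l by simp
qed

lemma Invs_hasse:
  assumes "f \<in> Invs" "i \<le> k" shows "hasse i j f \<in> Invs"
  using assms hasse_act[of _ i f j] vars_hasse[of i j f] by (auto simp: Invs_def)

lemma Invs_hcomp: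
  assumes "f \<in> Invs" shows "hcomp e f \<in> Invs"
proof -
  have "hcomp e (subst (L g) f) = subst (L g) (hcomp e f)" if "g \<in> carrier G" for g
    by (rule hcomp_subst[of f "{..n}"]) (use InvsD[OF assms] homog_L that in auto)
  then show ?thesis using assms vars_hcomp[of e f] by (auto simp: Invs_def)
qed

lemma below_act:
  assumes "g \<in> carrier G" "i \<le> k" "vars f \<subseteq> {..n}" "0 < e" "below i e f"
  shows "below i e (subst (L g) f)"
  using assms by (simp add: below_iff_hasse hasse_act subst_simps)

text \<open>Left translation by h permutes the group. \<open>F\<close> is arbitrary so that this
  covers both the norm of a variable and its characteristic polynomial.\<close>

lemma act_translate:
  assumes h: "h \<in> carrier G" and "j \<le> n"
  shows "(\<Prod>g\<in>carrier G. F (subst (L h) (L g j))) = (\<Prod>g\<in>carrier G. F (L g j))"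
proof -
  have "bij_betw (\<lambda>g. h \<otimes> g) (carrier G) (carrier G)"
    by (rule bij_betw_byWitness[of _ "\<lambda>g. inv h \<otimes> g"]) (use h in \<open>auto simp flip: m_assoc\<close>)
  then have "(\<Prod>g\<in>carrier G. F (L g j)) = (\<Prod>g\<in>carrier G. F (L (h \<otimes> g) j))"
    by (rule prod.reindex_bij_betw[symmetric])
  then show ?thesis using assms by (simp add: L_mult cong: prod.cong)
qed

lemma poly_in_L:
  assumes "g \<in> carrier G" "i \<le> k"
  shows "Polynomial.degree (poly_in i (L g i)) = 1" "lead_coeff (poly_in i (L g i)) = 1"
proof -
  obtain l where l: "L g i = Var i + l" "i \<notin> vars l" using L_terminal assms by blast
  then have "poly_in i (L g i) = [:l, 1:]"
    by (simp add: poly_in_simps poly_in_Var poly_in_free)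
  then show "Polynomial.degree (poly_in i (L g i)) = 1" "lead_coeff (poly_in i (L g i)) = 1" by simp_all
qed

text \<open>The product of all g x_i over the group is invariant, and each factor is monic of degree
  1 in x_i. This makes the minimum in \<open>d\<close> meaningful.\<close>

lemma monic_inv_ex:
  assumes "i \<le> k" shows "\<exists>f. monic_inv i f"
proof
  let ?f = "\<Prod>g\<in>carrier G. L g i"
  have in': "i \<le> n" using assms kn by simp
  have p: "poly_in i ?f = (\<Prod>g\<in>carrier G. poly_in i (L g i))" by (simp add: poly_in_simps)
  have nz: "poly_in i (L g i) \<noteq> 0" if "g \<in> carrier G" for g
    using poly_in_L[OF that assms] by auto
  have "Polynomial.degree (poly_in i ?f) = (\<Sum>g\<in>carrier G. 1)"
    unfolding p using nz by (subst degree_prod_eq_sum_degree) (auto simp: poly_in_L assms)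
  moreover have "lead_coeff (poly_in i ?f) = 1"
    unfolding p lead_coeff_prod by (intro prod.neutral ballI poly_in_L assms)
  moreover have "vars ?f \<subseteq> {..n}"
    using vars_L in' by (intro vars_prod) auto
  moreover have "subst (L h) ?f = ?f" if "h \<in> carrier G" for h
    using act_translate[OF that in', of "\<lambda>f. f"] by (simp add: subst_simps)
  moreover have "0 < card (carrier G)" using fin one_closed by (auto simp: card_gt_0_iff)
  ultimately show "monic_inv i ?f" by (simp add: monic_inv_def Invs_def)
qed

lemma d_attained: "i \<le> k \<Longrightarrow> \<exists>f. monic_inv i f \<and> Polynomial.degree (poly_in i f) = d i"
  unfolding d_def by (rule LeastI_ex) (use monic_inv_ex in blast)

lemma d_pos: "i \<le> k \<Longrightarrow> 0 < d i"
  using d_attained[of i] by (auto simp: monic_inv_def)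

lemma d_least: "monic_inv i f \<Longrightarrow> d i \<le> Polynomial.degree (poly_in i f)"
  unfolding d_def by (rule Least_le) blast

text \<open>A description by single coefficients passes through \<open>map_poly\<close> and
  differences, where \<open>lead_coeff\<close> and \<open>degree\<close> cannot be computed
  directly.\<close>

lemma monic_degree_iff:
  fixes p :: "'k mpoly poly"
  shows "lead_coeff p = 1 \<and> Polynomial.degree p = e \<longleftrightarrow> (\<forall>l>e. coeff p l = 0) \<and> coeff p e = 1"
proof
  assume *: "(\<forall>l>e. coeff p l = 0) \<and> coeff p e = 1"
  then have "Polynomial.degree p \<le> e" by (intro degree_le) simp
  moreover have "e \<le> Polynomial.degree p" using * by (intro le_degree) simp
  ultimately have "Polynomial.degree p = e" by simp
  then show "lead_coeff p = 1 \<and> Polynomial.degree p = e" using * by simp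
next
  assume *: "lead_coeff p = 1 \<and> Polynomial.degree p = e"
  then have "coeff p l = 0" if "e < l" for l using that by (intro coeff_eq_0) simp
  then show "(\<forall>l>e. coeff p l = 0) \<and> coeff p e = 1" using * by auto
qed

text \<open>Killing the variables outside a block is equivariant, so a minimal monic invariant may be
  chosen inside the block of its variable.\<close>

lemma ex_N:
  assumes "i \<le> k"
  shows "\<exists>f. monic_inv i f \<and> Polynomial.degree (poly_in i f) = d i \<and> vars f \<inter> {..k} \<subseteq> {i} \<and> coef f 0 = 0"
proof -
  obtain f0 where f0: "monic_inv i f0" "Polynomial.degree (poly_in i f0) = d i"
    using d_attained assms by blast
  obtain S where S: "S \<inter> {..k} = {i}"
    and LS: "\<And>g j. g \<in> carrier G \<Longrightarrow> j \<le> n \<Longrightarrow> j \<in> S \<Longrightarrow> vars (L g j) \<subseteq> S"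
      "\<And>g j. g \<in> carrier G \<Longrightarrow> j \<le> n \<Longrightarrow> j \<notin> S \<Longrightarrow> vars (L g j) \<inter> S = {}"
    using L_block[OF assms] by metis
  define s where "s = (\<lambda>j. if j \<in> S then Var j else 0 :: 'k mpoly)"
  have iS: "i \<in> S" using S by auto
  define f1 where "f1 = subst s f0"
  have f0I: "f0 \<in> Invs" using f0 by (simp add: monic_inv_def)
  have v1: "vars f1 \<subseteq> S \<inter> {..n}"
    unfolding f1_def
  proof (rule vars_subst[OF InvsD(1)[OF f0I]])
    fix j assume "j \<in> {..n}"
    then show "vars (s j) \<subseteq> S \<inter> {..n}" by (simp add: s_def)
  qed
  have "subst (L g) f1 = f1" if g: "g \<in> carrier G" for g
  proof -
    have "subst (L g) (subst s f0) = subst s (subst (L g) f0)"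
      unfolding subst_subst
    proof (rule subst_cong[OF InvsD(1)[OF f0I]])
      fix j assume j: "j \<in> {..n}"
      show "subst (L g) (s j) = subst s (L g j)"
      proof (cases "j \<in> S")
        case True
        have "subst s (L g j) = subst Var (L g j)"
          by (rule subst_cong[of _ S]) (use LS(1)[OF g] j True in \<open>auto simp: s_def\<close>)
        then show ?thesis using True by (simp add: s_def subst_Var_id)
      next
        case False
        \<comment> \<open>Outside the block, \<open>L g j\<close> contains only variables that
          \<open>s\<close> kills, and a linear form has no constant term.\<close>
        have "subst s (L g j) = subst (\<lambda>_. 0) (L g j)"
          by (rule subst_cong[of _ "- S"]) (use LS(2)[OF g] j False in \<open>auto simp: s_def\<close>)
        also have "\<dots> = Const (coef (L g j) 0)"
          by (rule ring_map_eqI[OF ring_map_subst ring_map_comp[OF ring_map_Const ring_map_coef_0] subset_UNIV])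
            (simp_all, simp add: Var_def lookup_single when_def poly_mapping_eq_iff fun_eq_iff)
        also have "coef (L g j) 0 = 0" using homog_coef_0[OF homog_L[OF g]] j by simp
        finally show ?thesis using False by (simp add: s_def subst_simps)
      qed
    qed
    then show ?thesis using InvsD(2)[OF f0I g] by (simp add: f1_def)
  qed
  then have f1I: "f1 \<in> Invs" using v1 by (simp add: Invs_def)
  have p1: "poly_in i f1 = map_poly (subst s) (poly_in i f0)"
    unfolding f1_def
    by (rule ring_map_eqI[OF ring_map_comp[OF ring_map_poly_in ring_map_subst]
          ring_map_comp[OF ring_map_map_poly[OF ring_map_subst] ring_map_poly_in] subset_UNIV])
      (use iS in \<open>auto simp: poly_in_Var s_def map_poly_pCons subst_simps poly_in_simps\<close>)
  \<comment> \<open>Removing the constant term puts the invariant into the Hilbert ideal. Only the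
    coefficient of index 0 changes, and \<open>d i\<close> is positive.\<close>
  define f where "f = f1 - Const (coef f1 0)"
  have "poly_in i f = poly_in i f1 - [:Const (coef f1 0):]"
    by (simp add: f_def poly_in_simps)
  moreover have "(\<forall>l>d i. coeff (poly_in i f0) l = 0) \<and> coeff (poly_in i f0) (d i) = 1"
    unfolding monic_degree_iff[symmetric] using f0 by (simp add: monic_inv_def)
  ultimately have "(\<forall>l>d i. coeff (poly_in i f) l = 0) \<and> coeff (poly_in i f) (d i) = 1"
    using d_pos[OF assms] by (auto simp: p1 coeff_map_poly subst_simps coeff_pCons split: nat.splits)
  then have "lead_coeff (poly_in i f) = 1 \<and> Polynomial.degree (poly_in i f) = d i"
    unfolding monic_degree_iff .
  moreover have "f \<in> Invs" using f1I by (simp add: f_def Invs_diff)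
  moreover have "vars f \<inter> {..k} \<subseteq> {i}"
    using vars_diff[of f1 "Const (coef f1 0)"] v1 S by (auto simp: f_def)
  moreover have "coef f 0 = 0" by (simp add: f_def coef_0_simps)
  ultimately show ?thesis using d_pos[OF assms] by (auto simp: monic_inv_def)
qed

definition N :: "nat \<Rightarrow> 'k mpoly"
  where "N i = (SOME f. monic_inv i f \<and> Polynomial.degree (poly_in i f) = d i \<and>
    vars f \<inter> {..k} \<subseteq> {i} \<and> coef f 0 = 0)"

lemma N:
  assumes "i \<le> k"
  shows "monic_inv i (N i)" "Polynomial.degree (poly_in i (N i)) = d i" "vars (N i) \<inter> {..k} \<subseteq> {i}"
    "coef (N i) 0 = 0"
  using someI_ex[OF ex_N[OF assms]] by (simp_all add: N_def)

lemma N_Invs: "i \<le> k \<Longrightarrow> N i \<in> Invs"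
  using N(1) by (simp add: monic_inv_def)

lemma N_monic:
  assumes "i \<le> k"
  shows "below i (Suc (d i)) (N i)" "coeff (poly_in i (N i)) (d i) = 1"
  using N(1,2)[OF assms] by (auto simp: below_iff_degree monic_inv_def)

section \<open>The ideal of low-degree invariants\<close>

definition gens :: "'k mpoly set"
  where "gens = {f \<in> Invs. (\<exists>e>0. homog e f) \<and> (\<forall>i\<le>k. below i (d i) f)}"

definition H' :: "'k mpoly set"
  where "H' = Idl\<^bsub>R\<^esub> gens"

lemma gens_vars: "gens \<subseteq> {f. vars f \<subseteq> {..n}}"
  by (auto simp: gens_def dest: InvsD(1))

lemma H'_ideal: "ideal H' R"
  unfolding H'_def by (rule genideal_mpoly_ring) (rule gens_vars)

lemmas H'D = ideal_mpoly_ringD[OF H'_ideal]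

lemma H_ideal: "ideal H R"
  unfolding H_def by (rule genideal_mpoly_ring) (auto dest: InvsD(1))

lemmas HD = ideal_mpoly_ringD[OF H_ideal]

lemma HI: "f \<in> Invs \<Longrightarrow> coef f 0 = 0 \<Longrightarrow> f \<in> H"
  unfolding H_def by (rule genideal_mpoly_ring(2)) (auto dest: InvsD(1))

lemma ideal_coef_0: "ideal {f :: 'k mpoly. vars f \<subseteq> K \<and> coef f 0 = 0} (mpoly_ring K)"
  by (rule ideal_mpoly_ringI) (use vars_add vars_mult in \<open>auto simp: coef_0_simps, blast+\<close>)

lemma H_coef_0: "f \<in> H \<Longrightarrow> coef f 0 = 0"
proof -
  assume f: "f \<in> H"
  have "{f \<in> Invs. coef f 0 = 0} \<subseteq> {f. vars f \<subseteq> {..n} \<and> coef f 0 = 0}" using InvsD(1) by auto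
  then have "f \<in> {f. vars f \<subseteq> {..n} \<and> coef f 0 = 0}"
    using genideal_mpoly_ring(3)[of "{f \<in> Invs. coef f 0 = 0}" "{..n}", OF _ ideal_coef_0, of f] f
    unfolding H_def by auto
  then show ?thesis by simp
qed

lemma hasse_gens:
  assumes f: "f \<in> gens" and i: "i \<le> k"
  shows "hasse i j f \<in> H'"
proof -
  obtain e where e: "0 < e" "homog e f" and fI: "f \<in> Invs" and fb: "\<And>i. i \<le> k \<Longrightarrow> below i (d i) f"
    using f by (auto simp: gens_def)
  show ?thesis
  proof (cases "j < e")
    case True
    then have *: "hasse i j f \<in> gens"
      unfolding gens_def using homog_hasse[OF e(2)] Invs_hasse[OF fI i]
      by (auto intro!: exI[of _ "e - j"] below_hasse fb)
    show ?thesis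
      unfolding H'_def by (rule genideal_mpoly_ring(2)[OF gens_vars *])
  next
    case False
    \<comment> \<open>Otherwise the scaled \<open>f\<close> would be a monic invariant of degree \<open>e < d i\<close>.\<close>
    have zero: "coef f (sgl i e) = 0"
    proof (rule ccontr)
      assume c: "coef f (sgl i e) \<noteq> 0"
      define f' where "f' = Const (inverse (coef f (sgl i e))) * f"
      have l: "coef f' m \<noteq> 0 \<Longrightarrow> tdeg m = e" for m using e(2) by (auto simp: f'_def homog_def)
      have "coeff (poly_in i f') l = 0" if "l > e" for l
        by (rule poly_mapping_eqI) (use l that in \<open>fastforce simp: coeff_poly_in coef_mcoef tdeg_add\<close>)
      moreover have "coef (coeff (poly_in i f') e) m = coef 1 m" for m
        using l[of "sgl i e + m"] c
        by (cases "m = 0") (auto simp: coeff_poly_in coef_mcoef tdeg_add lookup_one f'_def)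
      then have "coeff (poly_in i f') e = 1" by (rule poly_mapping_eqI)
      ultimately have "lead_coeff (poly_in i f') = 1 \<and> Polynomial.degree (poly_in i f') = e"
        by (simp add: monic_degree_iff)
      moreover have "f' \<in> Invs" using fI by (simp add: f'_def Invs_mult)
      ultimately have "d i \<le> e" using d_least[of i f'] e(1) by (auto simp: monic_inv_def)
      moreover have "e < d i" using fb[OF i] c by (auto simp: below_def)
      ultimately show False by simp
    qed
    \<comment> \<open>For \<open>j \<ge> e\<close> the only monomial of degree e that could
      contribute is the power of x_i with exponent e, when j = e, and its coefficient has just been
      shown to vanish.\<close>
    have "hasse i j f = 0"
    proof (rule poly_mapping_eqI, rule ccontr)
      fix m assume "coef (hasse i j f) m \<noteq> coef 0 m"
      then have *: "coef f (m + sgl i j) \<noteq> 0" by (auto simp: coef_hasse)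
      then have "tdeg m + j = e" using e(2) by (auto simp: homog_def tdeg_add)
      then have "m = 0" "j = e" using False by auto
      then show False using * zero by simp
    qed
    then show ?thesis using H'D(2) by simp
  qed
qed

lemma H'_mcoef:
  assumes "f \<in> H'" "supp a \<subseteq> {..k}"
  shows "mcoef {..k} a f \<in> H'"
proof (rule mcoef_in_closed[OF _ _ assms(2,1)])
  fix i l f assume i: "i \<in> {..k}" and f: "f \<in> H'"
  show "coeff (poly_in i f) l \<in> H'"
  proof (rule coeff_in_hasse_closed_ideal[OF H'_ideal])
    show "hasse i j f \<in> H'" for j
      using genideal_hasse_closed[OF gens_vars] hasse_gens i f unfolding H'_def by simp
  qed (use i kn in auto)
qed simp

section \<open>Reduction modulo the polynomials N(x_i)\<close>

definition N_ideal :: "'k mpoly set"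
  where "N_ideal = Idl\<^bsub>R\<^esub> (N ` {..k})"

lemma N_vars: "N ` {..k} \<subseteq> {f. vars f \<subseteq> {..n}}"
  using N_Invs InvsD(1) by auto

lemma N_ideal_ideal: "ideal N_ideal R"
  unfolding N_ideal_def by (rule genideal_mpoly_ring) (rule N_vars)

lemmas N_idealD = ideal_mpoly_ringD[OF N_ideal_ideal]

lemma N_in_N_ideal: "i \<le> k \<Longrightarrow> N i \<in> N_ideal"
  unfolding N_ideal_def by (rule genideal_mpoly_ring(2)[OF N_vars]) auto

lemma N_ideal_subset_H: "f \<in> N_ideal \<Longrightarrow> f \<in> H"
  unfolding N_ideal_def
  by (rule genideal_mpoly_ring(3)[OF N_vars H_ideal]) (auto intro!: HI simp: N_Invs N)

text \<open>The terminal variables are treated one at a time. Invariance of the remainder follows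
  from its uniqueness: r and its translate by g differ by a multiple of \<open>N i\<close> and both
  have degree less than \<open>d i\<close> in x_i, hence they agree.\<close>

lemma reduction:
  assumes "finite S" "S \<subseteq> {..k}" "vars f \<subseteq> {..n}"
  shows "\<exists>r. vars r \<subseteq> {..n} \<and> (\<forall>j\<in>S. below j (d j) r) \<and> f - r \<in> N_ideal \<and> (f \<in> Invs \<longrightarrow> r \<in> Invs)"
  using assms(1,2)
proof (induction S rule: finite_induct)
  case empty
  show ?case using assms(3) N_idealD(2) by (intro exI[of _ f]) simp
next
  case (insert i S)
  then obtain r where r: "vars r \<subseteq> {..n}" "\<forall>j\<in>S. below j (d j) r" "f - r \<in> N_ideal" "f \<in> Invs \<longrightarrow> r \<in> Invs"
    by auto
  have i: "i \<le> k" using insert by simp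
  have in': "i \<le> n" using i kn by simp
  \<comment> \<open>This keeps the bounds already achieved: subtracting multiples of
    \<open>N i\<close> in the division does not raise the degrees in the variables of
    \<open>S\<close>.\<close>
  have free: "j \<notin> vars (N i)" if "j \<in> S" for j
    using N(3)[OF i] that insert by auto
  have Nv: "vars (N i) \<subseteq> {..n}" using N_vars i by auto
  let ?M = "{f. vars f \<subseteq> {..n} \<and> (\<forall>j\<in>S. below j (d j) f)}"
  obtain q where q: "vars q \<subseteq> {..n}" "r - q * N i \<in> ?M" "below i (d i) (r - q * N i)"
  proof (rule division_by_monic[OF d_pos[OF i] N_monic[OF i], of ?M "{..n}" r])
    fix f g :: "'k mpoly" assume "f \<in> ?M" "g \<in> ?M"
    then show "f - g \<in> ?M" using vars_diff[of f g] by (auto intro: below_diff)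
  next
    fix f :: "'k mpoly" and e a assume f: "f \<in> ?M"
    let ?c = "coeff (poly_in i f) e"
    have "vars f \<subseteq> {..n}" using f by simp
    then have "vars ?c \<subseteq> {..n}" using vars_coeff_poly_in[of i f e] by auto
    moreover have "vars (Var i ^ a :: 'k mpoly) \<subseteq> {..n}" using vars_power[of "Var i" a] in' by auto
    ultimately have "vars (?c * Var i ^ a * N i) \<subseteq> {..n}"
      by (intro vars_mult[THEN subset_trans] Un_least Nv)
    moreover have "below j (d j) (?c * Var i ^ a * N i)" if "j \<in> S" for j
    proof -
      have "j \<noteq> i" using that insert.hyps by auto
      then have "j \<notin> vars (Var i ^ a :: 'k mpoly)" using vars_power[of "Var i" a] by auto
      moreover have "below j (d j) ?c" using f that by (simp add: coeff_poly_in below_mcoef)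
      ultimately show ?thesis using free[OF that] by (intro below_mult_free)
    qed
    ultimately show "?c * Var i ^ a * N i \<in> ?M" by simp
  qed (use r in' Nv in auto)
  let ?r = "r - q * N i"
  have "f - ?r = (f - r) + q * N i" by simp
  then have "f - ?r \<in> N_ideal" using r(3) q(1) N_in_N_ideal[OF i] N_idealD(3,4) by metis
  moreover have "?r \<in> Invs" if "f \<in> Invs"
  proof -
    have rI: "r \<in> Invs" using r(4) that by simp
    have "subst (L g) ?r = ?r" if g: "g \<in> carrier G" for g
    proof -
      have rv: "vars ?r \<subseteq> {..n}" using q(2) by simp
      have a: "subst (L g) ?r = r - subst (L g) q * N i"
        using InvsD(2)[OF rI g] InvsD(2)[OF N_Invs[OF i] g] by (simp add: subst_simps)
      \<comment> \<open>Both terms obey the bound, because the action preserves it; their difference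
        is a multiple of \<open>N i\<close>, so the multiplier must vanish.\<close>
      have "below i (d i) (?r - subst (L g) ?r)"
        by (intro below_diff q(3) below_act g i rv d_pos)
      moreover have "?r - subst (L g) ?r = (subst (L g) q - q) * N i"
        unfolding a by (simp add: algebra_simps)
      ultimately have "subst (L g) q - q = 0"
        using below_mult_monic[OF d_pos[OF i] N_monic[OF i]] by metis
      then show ?thesis unfolding a by simp
    qed
    then show ?thesis using q(2) by (simp add: Invs_def)
  qed
  ultimately show ?case using q by (intro exI[of _ ?r]) auto
qed

lemma H'_subset_H: "f \<in> H' \<Longrightarrow> f \<in> H"
  unfolding H'_def
  by (rule genideal_mpoly_ring(3)[OF gens_vars H_ideal]) (auto intro!: HI simp: gens_def homog_coef_0)

text \<open>It suffices to split an invariant without constant term. Its remainder modulo the N(x_i)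
  is again invariant and of low degree, so the homogeneous components of the remainder are
  generators of \<open>H'\<close>.\<close>

lemma H_decompose:
  assumes "f \<in> H" shows "\<exists>u\<in>N_ideal. \<exists>h\<in>H'. f = u + h"
proof -
  have "ideal {u + h | u h. u \<in> N_ideal \<and> h \<in> H'} R"
  proof (rule ideal_mpoly_ringI)
    fix a f :: "'k mpoly" assume a: "vars a \<subseteq> {..n}" and "f \<in> {u + h | u h. u \<in> N_ideal \<and> h \<in> H'}"
    then obtain u h where uh: "f = u + h" "u \<in> N_ideal" "h \<in> H'" by auto
    then have "a * f = a * u + a * h" "a * u \<in> N_ideal" "a * h \<in> H'"
      using a N_idealD(4) H'D(4) by (simp_all add: distrib_left)
    then show "a * f \<in> {u + h | u h. u \<in> N_ideal \<and> h \<in> H'}" by blast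
  next
    fix f g assume "f \<in> {u + h | u h. u \<in> N_ideal \<and> h \<in> H'}" "g \<in> {u + h | u h. u \<in> N_ideal \<and> h \<in> H'}"
    then obtain u h u' h' where "f = u + h" "u \<in> N_ideal" "h \<in> H'" "g = u' + h'" "u' \<in> N_ideal" "h' \<in> H'"
      by auto
    then have "f + g = (u + u') + (h + h')" "u + u' \<in> N_ideal" "h + h' \<in> H'"
      using N_idealD(3) H'D(3) by simp_all
    then show "f + g \<in> {u + h | u h. u \<in> N_ideal \<and> h \<in> H'}" by blast
  next
    fix f assume "f \<in> {u + h | u h. u \<in> N_ideal \<and> h \<in> H'}"
    then obtain u h where uh: "f = u + h" "u \<in> N_ideal" "h \<in> H'" by auto
    then show "vars f \<subseteq> {..n}" using vars_add[of u h] N_idealD(1) H'D(1) by blast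
  next
    show "0 \<in> {u + h | u h. u \<in> N_ideal \<and> h \<in> H'}"
      using N_idealD(2) H'D(2) by (auto intro!: exI[of _ 0])
  qed
  moreover have "f \<in> {u + h | u h. u \<in> N_ideal \<and> h \<in> H'}" if f: "f \<in> Invs" "coef f 0 = 0" for f
  proof -
    obtain r where r: "vars r \<subseteq> {..n}" "\<forall>j\<in>{..k}. below j (d j) r" "f - r \<in> N_ideal" "r \<in> Invs"
      using reduction[of "{..k}" f] f InvsD(1) by auto
    \<comment> \<open>The generators of \<open>H'\<close> have positive degree, so the component of
      degree 0 has to be excluded.\<close>
    have "coef r 0 = 0"
      using H_coef_0[OF N_ideal_subset_H[OF r(3)]] f by (simp add: coef_0_simps)
    have "hcomp e r \<in> H'" for e
    proof (cases "e = 0")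
      case True
      have "hcomp 0 r = 0"
        by (rule poly_mapping_eqI) (auto simp: coef_hcomp \<open>coef r 0 = 0\<close>)
      then show ?thesis using True H'D(2) by simp
    next
      case False
      then have "hcomp e r \<in> gens"
        using Invs_hcomp[OF r(4)] homog_hcomp r(2) by (auto simp: gens_def intro: below_hcomp)
      then show ?thesis unfolding H'_def using genideal_mpoly_ring(2)[of gens] gens_vars by blast
    qed
    then have "r \<in> H'" using sum_hcomp[of r] H'D(8) by metis
    moreover have "f = (f - r) + r" by simp
    ultimately show ?thesis using r(3) by blast
  qed
  then have "{f \<in> Invs. coef f 0 = 0} \<subseteq> {u + h | u h. u \<in> N_ideal \<and> h \<in> H'}" by blast
  moreover have "{f \<in> Invs. coef f 0 = 0} \<subseteq> {f. vars f \<subseteq> {..n}}" using InvsD(1) by auto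
  ultimately have "f \<in> {u + h | u h. u \<in> N_ideal \<and> h \<in> H'}"
    using genideal_mpoly_ring(3)[of "{f \<in> Invs. coef f 0 = 0}" "{..n}"] assms
    unfolding H_def by meson
  then show ?thesis by auto
qed

text \<open>Write f as a combination of the N(x_i) plus some h in \<open>H'\<close>. Reduce h and
  the coefficients of the other N(x_j) modulo \<open>N i\<close>, and collect all multiples of
  \<open>N i\<close> into one. Everything else then has degree less than \<open>d i\<close> in x_i,
  so the collected multiplier is 0 and \<open>N i\<close> disappears from the expression.\<close>

lemma H_below_in_H':
  assumes "f \<in> H" "\<And>i. i \<le> k \<Longrightarrow> below i (d i) f"
  shows "f \<in> H'"
proof -
  obtain u h where u: "u \<in> N_ideal" "h \<in> H'" "f = u + h" using H_decompose assms(1) by blast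
  have "\<exists>q. (\<forall>i\<le>k. vars (q i) \<subseteq> {..n}) \<and> u = (\<Sum>i\<le>k. q i * N i)"
  proof -
    let ?J = "{(\<Sum>i\<le>k. q i * N i) | q. \<forall>i\<le>k. vars (q i) \<subseteq> {..n}}"
    have "ideal ?J R"
    proof (rule ideal_mpoly_ringI)
      fix f assume "f \<in> ?J"
      then obtain q where q: "f = (\<Sum>i\<le>k. q i * N i)" "\<And>i. i \<le> k \<Longrightarrow> vars (q i) \<subseteq> {..n}" by auto
      show "vars f \<subseteq> {..n}" unfolding q(1)
      proof (rule vars_sum)
        fix i assume "i \<in> {..k}"
        then show "vars (q i * N i) \<subseteq> {..n}" using vars_mult[of "q i" "N i"] q(2)[of i] N_vars by auto
      qed
    next
      show "0 \<in> ?J" by (auto intro!: exI[of _ "\<lambda>_. 0"])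
    next
      fix f g assume "f \<in> ?J" "g \<in> ?J"
      then obtain q q' where q: "f = (\<Sum>i\<le>k. q i * N i)" "\<And>i. i \<le> k \<Longrightarrow> vars (q i) \<subseteq> {..n}"
        and q': "g = (\<Sum>i\<le>k. q' i * N i)" "\<And>i. i \<le> k \<Longrightarrow> vars (q' i) \<subseteq> {..n}" by auto
      have "vars (q i + q' i) \<subseteq> {..n}" if "i \<le> k" for i
        using vars_add[of "q i" "q' i"] q(2)[OF that] q'(2)[OF that] by blast
      moreover have "f + g = (\<Sum>i\<le>k. (q i + q' i) * N i)"
        by (simp add: q(1) q'(1) distrib_right sum.distrib)
      ultimately show "f + g \<in> ?J" by (intro CollectI exI[of _ "\<lambda>i. q i + q' i"]) simp
    next
      fix a f :: "'k mpoly" assume a: "vars a \<subseteq> {..n}" and "f \<in> ?J"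
      then obtain q where q: "f = (\<Sum>i\<le>k. q i * N i)" "\<And>i. i \<le> k \<Longrightarrow> vars (q i) \<subseteq> {..n}" by auto
      have "vars (a * q i) \<subseteq> {..n}" if "i \<le> k" for i
        by (intro vars_mult[THEN subset_trans] Un_least q(2)[OF that] a)
      moreover have "a * f = (\<Sum>i\<le>k. (a * q i) * N i)"
        by (simp add: q(1) sum_distrib_left mult.assoc)
      ultimately show "a * f \<in> ?J" by (intro CollectI exI[of _ "\<lambda>i. a * q i"]) simp
    qed
    moreover have "N j \<in> ?J" if "j \<le> k" for j
    proof -
      have "(\<Sum>i\<le>k. (if i = j then 1 else 0) * N i) = (\<Sum>i\<le>k. if i = j then N i else 0)"
        by (rule sum.cong) auto
      then have "N j = (\<Sum>i\<le>k. (if i = j then 1 else 0) * N i)" using that by simp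
      moreover have "\<forall>i\<le>k. vars (if i = j then 1 else 0 :: 'k mpoly) \<subseteq> {..n}" by simp
      ultimately show ?thesis by (intro CollectI exI[of _ "\<lambda>i. if i = j then 1 else 0"]) simp
    qed
    ultimately show ?thesis
      using genideal_mpoly_ring(3)[OF N_vars, of ?J u] u(1) unfolding N_ideal_def by auto
  qed
  then obtain q where q: "\<And>i. i \<le> k \<Longrightarrow> vars (q i) \<subseteq> {..n}" "f = (\<Sum>i\<in>{..k}. q i * N i) + h"
    using u(3) by blast
  \<comment> \<open>Induction over the set of those N(x_i) still present, with f fixed and the
    multipliers and h varying.\<close>
  have "f \<in> H'" if "finite S" "S \<subseteq> {..k}" "\<And>i. i \<in> S \<Longrightarrow> vars (q i) \<subseteq> {..n}" "h \<in> H'"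
    "f = (\<Sum>i\<in>S. q i * N i) + h" for S q h
    using that
  proof (induction S arbitrary: q h rule: finite_induct)
    case empty then show ?case by simp
  next
    case (insert i S)
    have i: "i \<le> k" using insert.prems by simp
    have in': "i \<le> n" using i kn by simp
    have Nv: "vars (N i) \<subseteq> {..n}" using N_vars i by auto
    have "\<exists>p. vars p \<subseteq> {..n} \<and> below i (d i) (q j - p * N i)" if "j \<in> S" for j
      by (rule division_by_monic[OF d_pos[OF i] N_monic[OF i], of UNIV "{..n}" "q j"])
        (use insert.prems(2)[of j] that Nv in' in auto)
    then obtain p where p: "\<And>j. j \<in> S \<Longrightarrow> vars (p j) \<subseteq> {..n}"
      "\<And>j. j \<in> S \<Longrightarrow> below i (d i) (q j - p j * N i)" by metis
    \<comment> \<open>The remainder of \<open>h\<close> stays in \<open>H'\<close> because every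
      quotient term is built from a coefficient of an element of \<open>H'\<close>.\<close>
    obtain p' where p': "vars p' \<subseteq> {..n}" "h - p' * N i \<in> H'" "below i (d i) (h - p' * N i)"
    proof (rule division_by_monic[OF d_pos[OF i] N_monic[OF i], of H' "{..n}" h])
      fix f e a assume f: "f \<in> H'"
      have "coeff (poly_in i f) e \<in> H'"
        by (rule coeff_in_hasse_closed_ideal[OF H'_ideal])
          (use in' i genideal_hasse_closed[OF gens_vars] hasse_gens f in \<open>auto simp: H'_def\<close>)
      moreover have "vars (Var i ^ a * N i) \<subseteq> {..n}"
        using vars_mult[of "Var i ^ a" "N i"] vars_power[of "Var i" a] Nv in' by auto
      ultimately show "coeff (poly_in i f) e * Var i ^ a * N i \<in> H'"
        using H'D(5)[of "Var i ^ a * N i"] by (simp add: mult.assoc)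
    qed (use H'D(7) in' Nv insert.prems H'D(1) in auto)
    let ?q = "\<lambda>j. q j - p j * N i" and ?h = "h - p' * N i"
    \<comment> \<open>The total multiplier of \<open>N i\<close> after the reductions: the original
      one, the quotient of h, and the quotients of the other multipliers.\<close>
    define s where "s = q i + p' + (\<Sum>j\<in>S. p j * N j)"
    have f: "f = s * N i + ((\<Sum>j\<in>S. ?q j * N j) + ?h)"
      using insert.hyps unfolding insert.prems(4) s_def
      by (simp add: algebra_simps sum_subtractf sum_distrib_left sum_distrib_right)
    have free: "i \<notin> vars (N j)" if "j \<in> S" for j
      using N(3)[of j] that insert.hyps insert.prems(1) i by blast
    have "below i (d i) (\<Sum>j\<in>S. ?q j * N j)"
    proof -
      have "finite T \<Longrightarrow> T \<subseteq> S \<Longrightarrow> below i (d i) (\<Sum>j\<in>T. ?q j * N j)" for T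
        by (induction T rule: finite_induct) (auto intro!: below_add below_mult_free p(2) free)
      then show ?thesis using insert.hyps by simp
    qed
    then have "below i (d i) ((\<Sum>j\<in>S. ?q j * N j) + ?h)" using p'(3) by (rule below_add)
    then have "below i (d i) (f - ((\<Sum>j\<in>S. ?q j * N j) + ?h))"
      by (rule below_diff[OF assms(2)[OF i]])
    moreover have "f - ((\<Sum>j\<in>S. ?q j * N j) + ?h) = s * N i"
      by (subst f) (rule add_diff_cancel_right')
    ultimately have "below i (d i) (s * N i)" by simp
    then have "s = 0" using below_mult_monic[OF d_pos[OF i] N_monic[OF i]] by blast
    then have "f = (\<Sum>j\<in>S. ?q j * N j) + ?h" using f by simp
    moreover have "vars (?q j) \<subseteq> {..n}" if "j \<in> S" for j
      using vars_diff[of "q j" "p j * N i"] vars_mult[of "p j" "N i"] p(1)[OF that] insert.prems(2)[of j] Nv that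
      by blast
    ultimately show ?case using insert.IH[of ?q ?h] insert.prems(1) p'(2) by auto
  qed
  from this[of "{..k}" q h] q u(2) show ?thesis by simp
qed

text \<open>An element of \<open>H'\<close> is a combination of its coefficients with respect to the
  terminal variables; these again lie in \<open>H'\<close> and contain only the remaining
  variables.\<close>

lemma H_generators: "H = Idl\<^bsub>R\<^esub> (N ` {..k} \<union> {f \<in> H'. vars f \<subseteq> {Suc k..n}})"
proof -
  let ?S = "N ` {..k} \<union> {f \<in> H'. vars f \<subseteq> {Suc k..n}}"
  have S: "?S \<subseteq> {f. vars f \<subseteq> {..n}}" using N_vars H'D(1) by blast
  note Id = ideal_mpoly_ringD[OF genideal_mpoly_ring(1)[OF S]]
  show ?thesis
  proof (intro equalityI subsetI)
    fix f assume f: "f \<in> Idl\<^bsub>R\<^esub> ?S"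
    show "f \<in> H"
      by (rule genideal_mpoly_ring(3)[OF S H_ideal _ f])
        (auto intro: N_ideal_subset_H N_in_N_ideal H'_subset_H)
  next
    fix f assume "f \<in> H"
    then obtain u h where u: "u \<in> N_ideal" "h \<in> H'" "f = u + h" using H_decompose by blast
    have "u \<in> Idl\<^bsub>R\<^esub> ?S"
      by (rule genideal_mpoly_ring(3)[OF N_vars genideal_mpoly_ring(1)[OF S] _ u(1)[unfolded N_ideal_def]])
        (auto intro: genideal_mpoly_ring(2)[OF S])
    moreover have "h \<in> Idl\<^bsub>R\<^esub> ?S"
    proof -
      have "h = (\<Sum>a\<in>mono_part {..k} ` supp h. sgl a 1 * mcoef {..k} a h)"
        by (rule sum_single_mult_mcoef[symmetric]) (use supp_mono_part in auto)
      moreover have "\<dots> \<in> Idl\<^bsub>R\<^esub> ?S"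
      proof (intro Id(8) Id(4))
        fix a assume "a \<in> mono_part {..k} ` supp h"
        then have a: "supp a \<subseteq> {..k}" using supp_mono_part by auto
        then show "vars (sgl a 1 :: 'k mpoly) \<subseteq> {..n}" using kn by (auto simp: vars_single)
        have "vars (mcoef {..k} a h) \<subseteq> {..n} - {..k}"
          using vars_mcoef[of "{..k}" a h] H'D(1)[OF u(2)] by blast
        then have "mcoef {..k} a h \<in> ?S"
          using H'_mcoef[OF u(2) a] by fastforce
        then show "mcoef {..k} a h \<in> Idl\<^bsub>R\<^esub> ?S" using genideal_mpoly_ring(2)[of ?S] S by blast
      qed
      ultimately show ?thesis by simp
    qed
    ultimately show "f \<in> Idl\<^bsub>R\<^esub> ?S" using u(3) Id(3) by simp
  qed
qed

end


section \<open>A basis of the coinvariants\<close>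

text \<open>Compare coefficients in \<open>(t + 1)^q = t^q + 1\<close> for q a power of the
  characteristic.\<close>

lemma binomial_prime_power_eq_0:
  assumes "Factorial_Ring.prime CHAR('k::field)" "0 < j" "j < CHAR('k) ^ a"
  shows "(of_nat (CHAR('k) ^ a choose j) :: 'k) = 0"
proof -
  let ?q = "CHAR('k) ^ a"
  have "([:1, 1:] :: 'k poly) ^ ?q = ([:0, 1:] + 1) ^ ?q" by (simp add: one_pCons)
  also have "\<dots> = [:0, 1:] ^ ?q + 1 ^ ?q"
    by (rule freshmans_dream'[of _ a]) (use assms(1) in simp_all)
  finally have "coeff ([:1, 1:] ^ ?q) j = coeff ([:0, 1:] ^ ?q + 1 :: 'k poly) j" by simp
  moreover have "coeff ([:1, 1:] ^ ?q :: 'k poly) j = of_nat (?q choose j)"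
    using assms(3) by (simp add: coeff_linear_poly_power)
  moreover have "coeff ([:0, 1:] ^ ?q + 1 :: 'k poly) j = 0"
    using assms(2,3) by (simp add: coeff_1 coeff_monom flip: monom_altdef[of 1, simplified])
  ultimately show ?thesis by simp
qed

context terminal_action
begin

section \<open>Finite bases of A modulo the Hilbert ideal\<close>

lemma Var_power_in_H:
  assumes "j \<le> n"
  shows "Var j ^ card (carrier G) \<in> H"
proof -
  define q where "q = card (carrier G)"
  \<comment> \<open>The polynomial \<open>P\<close> has x_j as a root and invariant coefficients.
    Once its non-leading coefficients are known to lie in \<open>H\<close>, the equation P(x_j) = 0
    expresses the leading power modulo \<open>H\<close>.\<close>
  define P where "P = (\<Prod>g\<in>carrier G. [:- L g j, 1:])"
  have P_act: "map_poly (subst (L h)) P = P" if h: "h \<in> carrier G" for h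
  proof -
    have "map_poly (subst (L h)) P = (\<Prod>g\<in>carrier G. [:- subst (L h) (L g j), 1:])"
      by (simp add: P_def ring_mapD[OF ring_map_map_poly[OF ring_map_subst]] map_poly_pCons subst_simps)
    also have "\<dots> = P"
      unfolding P_def by (rule act_translate[OF h assms, of "\<lambda>f. [:- f, 1:]"])
    finally show ?thesis .
  qed
  have deg: "Polynomial.degree P = q"
    unfolding P_def q_def by (subst degree_prod_eq_sum_degree) auto
  have lead: "coeff P q = 1"
    using lead_coeff_prod[of "\<lambda>g. [:- L g j, 1:]" "carrier G"] unfolding deg[symmetric] by (simp add: P_def)
  have vars_P: "vars (coeff P e) \<subseteq> {..n}" for e
  proof -
    have "finite S \<Longrightarrow> S \<subseteq> carrier G \<Longrightarrow> vars (coeff (\<Prod>g\<in>S. [:- L g j, 1:]) e) \<subseteq> {..n}" for S e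
    proof (induction S arbitrary: e rule: finite_induct)
      case empty then show ?case by (simp add: coeff_1)
    next
      case (insert g S)
      let ?Q = "\<Prod>g\<in>S. [:- L g j, 1:]"
      have "vars (L g j * coeff ?Q e) \<subseteq> {..n}"
        using insert by (intro vars_mult[THEN subset_trans] Un_least vars_L assms) auto
      moreover have "vars (coeff (pCons 0 ?Q) e) \<subseteq> {..n}"
        using insert by (cases e) auto
      moreover have "coeff (\<Prod>g\<in>insert g S. [:- L g j, 1:]) e = coeff (pCons 0 ?Q) e - L g j * coeff ?Q e"
        using insert.hyps by simp
      ultimately show ?case
        using vars_diff[of "coeff (pCons 0 ?Q) e" "L g j * coeff ?Q e"] by auto
    qed
    then show ?thesis using fin by (simp add: P_def)
  qed
  have coeff_Invs: "coeff P e \<in> Invs" for e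
    unfolding Invs_def
  proof (intro CollectI conjI ballI vars_P)
    fix g assume "g \<in> carrier G"
    then show "subst (L g) (coeff P e) = coeff P e"
      using P_act by (metis coeff_map_poly subst_simps(2))
  qed
  \<comment> \<open>At the origin every linear form vanishes, so \<open>P\<close> becomes a pure
    power of its variable and the lower coefficients have no constant term.\<close>
  have "map_poly (\<lambda>f. coef f 0) P = (\<Prod>g\<in>carrier G. [:0, 1:])"
    unfolding P_def ring_mapD(9)[OF ring_map_map_poly[OF ring_map_coef_0]]
    by (rule prod.cong)
      (use homog_coef_0[OF homog_L] assms in \<open>simp_all add: map_poly_pCons coef_0_simps\<close>)
  then have "coef (coeff P e) 0 = coeff ([:0, 1:] ^ q) e" for e
    unfolding q_def by (metis (no_types) coeff_map_poly coef_0_simps(2) prod_constant)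
  moreover have "[:0, 1 :: 'k:] ^ q = Polynomial.monom 1 q" by (simp add: monom_altdef)
  ultimately have "coeff P e \<in> H" if "e < q" for e
    using HI[OF coeff_Invs] that by simp
  then have "(\<Sum>e<q. coeff P e * Var j ^ e) \<in> H"
    using vars_power[of "Var j"] assms by (intro HD(8) HD(5)) fastforce+
  moreover have "0 = poly P (Var j)"
  proof -
    have "poly P (Var j) = (\<Prod>g\<in>carrier G. Var j - L g j)"
      by (simp add: P_def poly_prod)
    also have "\<dots> = 0" using fin one_closed L_one[OF assms] by (intro prod_zero bexI[of _ \<one>]) auto
    finally show ?thesis by simp
  qed
  then have "0 = (\<Sum>e<q. coeff P e * Var j ^ e) + Var j ^ q"
    by (simp add: poly_altdef deg lead flip: lessThan_Suc_atMost)
  then have "Var j ^ q = - (\<Sum>e<q. coeff P e * Var j ^ e)"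
    by (simp add: eq_neg_iff_add_eq_0 add.commute)
  ultimately show ?thesis using HD(6) by (simp add: q_def)
qed

lemma single_in_H:
  assumes "Var i ^ e \<in> H" "e \<le> coef m i" "supp m \<subseteq> {..n}"
  shows "sgl m c \<in> H"
proof -
  have "m - sgl i e + sgl i e = m"
    by (rule poly_mapping_eqI) (use assms(2) in \<open>auto simp: lookup_add lookup_minus lookup_single when_def\<close>)
  then have "sgl m c = sgl (m - sgl i e) c * Var i ^ e"
    by (simp add: Var_power mult_single)
  moreover have "vars (sgl (m - sgl i e) c) \<subseteq> {..n}"
    using assms(3) by (auto simp: vars_single in_keys_iff lookup_minus subset_iff)
  ultimately show ?thesis using HD(4) assms(1) by simp
qed

definition spans_mod_H :: "'k mpoly set \<Rightarrow> bool"
  where "spans_mod_H E \<longleftrightarrow>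
    (\<forall>f. vars f \<subseteq> {Suc k..n} \<longrightarrow> (\<exists>c. f - (\<Sum>b\<in>E. Const (c b) * b) \<in> H))"

text \<open>Monomials with all exponents below |G| span, since any other monomial lies in
  \<open>H\<close>. A spanning set of least cardinality is then independent modulo
  \<open>H\<close>.\<close>

lemma ex_basis_mod_H:
  "\<exists>E. finite E \<and> (\<forall>b\<in>E. vars b \<subseteq> {Suc k..n}) \<and> spans_mod_H E \<and>
    (\<forall>c. (\<Sum>b\<in>E. Const (c b) * b) \<in> H \<longrightarrow> (\<forall>b\<in>E. c b = 0))"
proof -
  let ?q = "card (carrier G)"
  let ?B = "\<lambda>E. finite E \<and> (\<forall>b\<in>E. vars b \<subseteq> {Suc k..n}) \<and> spans_mod_H E"
  define M where "M = {m :: nat \<Rightarrow>\<^sub>0 nat. supp m \<subseteq> {Suc k..n} \<and> (\<forall>i. coef m i < ?q)}"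
  have "finite M"
  proof (rule finite_imageD)
    have "(\<lambda>m. restrict (coef m) {Suc k..n}) ` M \<subseteq> (\<Pi>\<^sub>E i\<in>{Suc k..n}. {..<?q})"
      by (auto simp: M_def)
    then show "finite ((\<lambda>m. restrict (coef m) {Suc k..n}) ` M)"
      by (rule finite_subset) (intro finite_PiE, auto)
    show "inj_on (\<lambda>m. restrict (coef m) {Suc k..n}) M"
    proof (rule inj_onI, rule poly_mapping_eqI)
      fix m m' :: "nat \<Rightarrow>\<^sub>0 nat" and j
      assume m: "m \<in> M" "m' \<in> M" "restrict (coef m) {Suc k..n} = restrict (coef m') {Suc k..n}"
      show "coef m j = coef m' j"
      proof (cases "j \<in> {Suc k..n}")
        case True then show ?thesis using m(3) by (metis restrict_apply')
      next
        case False
        then have "j \<notin> supp m" "j \<notin> supp m'" using m(1,2) unfolding M_def by blast+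
        then show ?thesis by (simp add: in_keys_iff)
      qed
    qed
  qed
  have "?B ((\<lambda>m. sgl m 1) ` M)"
    unfolding spans_mod_H_def
  proof (intro conjI allI impI)
    show "finite ((\<lambda>m. sgl m (1 :: 'k)) ` M)" using \<open>finite M\<close> by simp
    show "\<forall>b\<in>(\<lambda>m. sgl m (1 :: 'k)) ` M. vars b \<subseteq> {Suc k..n}" by (auto simp: vars_single M_def)
    fix f :: "'k mpoly" assume f: "vars f \<subseteq> {Suc k..n}"
    \<comment> \<open>The sum is indexed by the monomials as polynomials; \<open>THE\<close>
      recovers the exponent vector from such a monomial.\<close>
    define c where "c = (\<lambda>b :: 'k mpoly. coef f (THE m. b = sgl m 1))"
    have "(\<Sum>b\<in>(\<lambda>m. sgl m 1) ` M. Const (c b) * b) = (\<Sum>m\<in>M. sgl m (coef f m))"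
    proof (subst sum.reindex)
      show "inj_on (\<lambda>m. sgl m (1 :: 'k)) M"
        by (rule inj_onI) (metis lookup_single_eq lookup_single_not_eq zero_neq_one)
      have "(THE m'. sgl m (1 :: 'k) = sgl m' 1) = m" for m :: "nat \<Rightarrow>\<^sub>0 nat"
        by (rule the_equality) (simp, metis lookup_single_eq lookup_single_not_eq zero_neq_one)
      then show "sum ((\<lambda>b. Const (c b) * b) \<circ> (\<lambda>m. sgl m 1)) M = (\<Sum>m\<in>M. sgl m (coef f m))"
        by (simp add: c_def Const_def mult_single)
    qed
    also have "\<dots> = (\<Sum>m\<in>M \<inter> supp f. sgl m (coef f m))"
      using \<open>finite M\<close> by (intro sum.mono_neutral_right) (auto simp: in_keys_iff)
    finally have "f - (\<Sum>b\<in>(\<lambda>m. sgl m 1) ` M. Const (c b) * b) = (\<Sum>m\<in>supp f - M. sgl m (coef f m))"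
      using sum.Int_Diff[of "supp f" "\<lambda>m. sgl m (coef f m)" M] by (simp add: sum_singles Int_commute algebra_simps)
    moreover have "(\<Sum>m\<in>supp f - M. sgl m (coef f m)) \<in> H"
    proof (rule HD(8))
      fix m assume m: "m \<in> supp f - M"
      then have sm: "supp m \<subseteq> {Suc k..n}" using f by (auto simp: vars_def)
      then obtain i where i: "?q \<le> coef m i" using m by (auto simp: M_def not_less)
      moreover have "0 < ?q" using fin one_closed by (auto simp: card_gt_0_iff)
      ultimately have "i \<in> supp m" by (simp add: in_keys_iff)
      then have in': "i \<le> n" using sm by auto
      have "supp m \<subseteq> {..n}" using sm by auto
      then show "sgl m (coef f m) \<in> H"
        by (rule single_in_H[OF Var_power_in_H[OF in'] i])
    qed
    ultimately have "f - (\<Sum>b\<in>(\<lambda>m. sgl m 1) ` M. Const (c b) * b) \<in> H" by (simp only:)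
    then show "\<exists>c. f - (\<Sum>b\<in>(\<lambda>m. sgl m 1) ` M. Const (c b) * b) \<in> H"
      by (rule exI[of _ c])
  qed
  then obtain E where E: "?B E" and least: "\<And>E'. ?B E' \<Longrightarrow> card E \<le> card E'"
    using ex_has_least_nat[of ?B "(\<lambda>m. sgl m 1) ` M" card] by blast
  have "c b0 = 0" if c: "(\<Sum>b\<in>E. Const (c b) * b) \<in> H" and b0: "b0 \<in> E" for c b0
  proof (rule ccontr)
    assume nz: "c b0 \<noteq> 0"
    \<comment> \<open>The relation scaled so that \<open>b0\<close> has coefficient 1, which allows
      \<open>b0\<close> to be eliminated modulo \<open>H\<close>.\<close>
    define u where "u = Const (inverse (c b0)) * (\<Sum>b\<in>E. Const (c b) * b)"
    have "u \<in> H" unfolding u_def using c by (intro HD(4)) auto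
    have "u = (\<Sum>b\<in>E. Const (c b / c b0) * b)"
      unfolding u_def sum_distrib_left by (rule sum.cong) (simp_all add: divide_inverse Const_mult mult_ac)
    then have u: "u = b0 + (\<Sum>b\<in>E - {b0}. Const (c b / c b0) * b)"
      using nz by (simp add: sum.remove[OF conjunct1[OF E] b0])
    have "?B (E - {b0})"
      unfolding spans_mod_H_def
    proof (intro conjI allI impI)
      fix f :: "'k mpoly" assume "vars f \<subseteq> {Suc k..n}"
      then obtain e where e: "f - (\<Sum>b\<in>E. Const (e b) * b) \<in> H" using E by (auto simp: spans_mod_H_def)
      \<comment> \<open>The coefficients after replacing \<open>b0\<close> by the other elements
        through the relation \<open>u\<close>.\<close>
      let ?e = "\<lambda>b. e b - e b0 * (c b / c b0)"
      have "f - (\<Sum>b\<in>E - {b0}. Const (?e b) * b) = (f - (\<Sum>b\<in>E. Const (e b) * b)) + Const (e b0) * u"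
        unfolding u sum.remove[OF conjunct1[OF E] b0]
        by (simp add: Const_diff Const_mult left_diff_distrib sum_subtractf sum_distrib_left distrib_left
            mult.assoc times_divide_eq_right[symmetric] del: times_divide_eq_right)
      also have "\<dots> \<in> H" using e \<open>u \<in> H\<close> by (intro HD(3) HD(4)) auto
      finally show "\<exists>e. f - (\<Sum>b\<in>E - {b0}. Const (e b) * b) \<in> H" by (rule exI[of _ ?e])
    qed (use E in auto)
    then have "card E \<le> card (E - {b0})" by (rule least)
    moreover have "card (E - {b0}) < card E" using E b0 by (intro psubset_card_mono) auto
    ultimately show False by simp
  qed
  then show ?thesis using E by blast
qed

section \<open>Expansion over monomials of bounded degree\<close>

definition box :: "(nat \<Rightarrow>\<^sub>0 nat) set"
  where "box = {a. supp a \<subseteq> {..k} \<and> (\<forall>i\<le>k. coef a i < d i)}"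

lemma bij_box: "bij_betw (\<lambda>a. restrict (coef a) {..k}) box (\<Pi>\<^sub>E i\<in>{..k}. {..<d i})"
proof (rule bij_betw_byWitness[where f' = "\<lambda>h. \<Sum>j\<le>k. sgl j (h j)"])
  show "\<forall>a\<in>box. (\<Sum>j\<le>k. sgl j (restrict (coef a) {..k} j)) = a"
    by (auto intro!: poly_mapping_eqI simp: coef_sum_single box_def) (metis atMost_iff in_keys_iff subsetD)
  show "\<forall>h\<in>\<Pi>\<^sub>E i\<in>{..k}. {..<d i}. restrict (coef (\<Sum>j\<le>k. sgl j (h j))) {..k} = h"
    by (auto simp: fun_eq_iff coef_sum_single restrict_def PiE_def extensional_def)
  show "(\<lambda>a. restrict (coef a) {..k}) ` box \<subseteq> (\<Pi>\<^sub>E i\<in>{..k}. {..<d i})"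
    by (simp add: box_def image_subset_iff restrict_PiE_iff)
  show "(\<lambda>h. \<Sum>j\<le>k. sgl j (h j)) ` (\<Pi>\<^sub>E i\<in>{..k}. {..<d i}) \<subseteq> box"
    by (auto simp: box_def coef_sum_single in_keys_iff split: if_splits)
qed

lemma finite_box: "finite box"
  using bij_betw_finite[OF bij_box] finite_PiE[of "{..k}" "\<lambda>i. {..<d i}"] by simp

lemma card_box: "card box = (\<Prod>i\<le>k. d i)"
  using bij_betw_same_card[OF bij_box] by (simp add: card_PiE)

text \<open>The remainder modulo the N(x_i) contains only monomials whose terminal part lies in
  \<open>box\<close>.\<close>

lemma box_span:
  assumes "vars f \<subseteq> {..n}"
  shows "\<exists>u. (\<forall>a\<in>box. vars (u a) \<subseteq> {Suc k..n}) \<and> f - (\<Sum>a\<in>box. sgl a 1 * u a) \<in> H"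
proof -
  obtain r where r: "vars r \<subseteq> {..n}" "\<forall>j\<in>{..k}. below j (d j) r" "f - r \<in> N_ideal"
    using reduction[of "{..k}" f] assms by auto
  have "(\<Sum>a\<in>box. sgl a 1 * mcoef {..k} a r) = r"
  proof (rule sum_single_mult_mcoef[OF finite_box])
    show "supp a \<subseteq> {..k}" if "a \<in> box" for a using that by (simp add: box_def)
    show "mono_part {..k} ` supp r \<subseteq> box"
      using r(2) supp_mono_part[of "{..k}"] by (auto simp: box_def below_def coef_mono_part in_keys_iff split: if_splits)
  qed
  moreover have "vars (mcoef {..k} a r) \<subseteq> {Suc k..n}" for a
    using vars_mcoef[of "{..k}" a r] r(1) by fastforce
  ultimately show ?thesis using N_ideal_subset_H[OF r(3)] by (intro exI[of _ "\<lambda>a. mcoef {..k} a r"]) simp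
qed

text \<open>The combination satisfies all degree bounds, so its membership in \<open>H\<close>
  improves to membership in \<open>H'\<close>; there each coefficient can be extracted without
  leaving the ideal.\<close>

lemma box_independent:
  assumes u: "\<And>a. a \<in> box \<Longrightarrow> vars (u a) \<subseteq> {Suc k..n}" and H: "(\<Sum>a\<in>box. sgl a 1 * u a) \<in> H"
    and b: "b \<in> box"
  shows "u b \<in> H"
proof -
  let ?f = "\<Sum>a\<in>box. sgl a 1 * u a"
  have "below i (d i) ?f" if i: "i \<le> k" for i
  proof -
    have "below i (d i) (sgl a 1 * u a)" if a: "a \<in> box" for a
    proof (rule below_mult_free)
      show "below i (d i) (sgl a (1 :: 'k))"
        using a i by (auto simp: box_def below_def lookup_single when_def split: if_splits)
      show "i \<notin> vars (u a)" using u[OF a] i by auto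
    qed
    moreover have "finite S \<Longrightarrow> (\<And>a. a \<in> S \<Longrightarrow> below i (d i) (h a)) \<Longrightarrow> below i (d i) (sum h S)"
      for S and h :: "(nat \<Rightarrow>\<^sub>0 nat) \<Rightarrow> 'k mpoly"
      by (induction S rule: finite_induct) (auto intro: below_add)
    ultimately show ?thesis using finite_box by simp
  qed
  then have "?f \<in> H'" using H_below_in_H'[OF H] by blast
  then have "mcoef {..k} b ?f \<in> H'" using H'_mcoef b by (simp add: box_def)
  also have "mcoef {..k} b ?f = (\<Sum>a\<in>box. if b = a then u a else 0)"
    unfolding mcoef_sum
  proof (rule sum.cong[OF refl])
    fix a assume "a \<in> box"
    then show "mcoef {..k} b (sgl a 1 * u a) = (if b = a then u a else 0)"
      using b u[of a] by (intro mcoef_single_mult) (auto simp: box_def)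
  qed
  finally show ?thesis using b finite_box H'_subset_H by simp
qed

section \<open>Orbits and nilpotency of the terminal variables\<close>

lemma act_act:
  assumes "g \<in> carrier G" "h \<in> carrier G" "vars f \<subseteq> {..n}"
  shows "subst (L (g \<otimes> h)) f = subst (L g) (subst (L h) f)"
  unfolding subst_subst by (rule subst_cong[OF assms(3)]) (use assms L_mult in auto)

lemma act_one: "vars f \<subseteq> {..n} \<Longrightarrow> subst (L \<one>) f = f"
  using subst_cong[of f "{..n}" "L \<one>" Var] L_one by (simp add: subst_Var_id)

text \<open>\<open>Bij\<close> consists of extensional maps, hence the restriction to polynomials in
  the variables up to n. This makes the orbit-stabilizer theorem applicable.\<close>

lemma group_action_restrict:
  "group_action G {f. vars f \<subseteq> {..n}} (\<lambda>g. restrict (subst (L g)) {f. vars f \<subseteq> {..n}})"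
proof -
  let ?E = "{f :: 'k mpoly. vars f \<subseteq> {..n}}"
  have bij: "bij_betw (subst (L g)) ?E ?E" if g: "g \<in> carrier G" for g
    by (rule bij_betw_byWitness[where f' = "subst (L (inv g))"])
      (use g vars_act[OF g] vars_act[OF inv_closed[OF g]] act_one in \<open>auto simp flip: act_act\<close>)
  have Bij: "restrict (subst (L g)) ?E \<in> Bij ?E" if g: "g \<in> carrier G" for g
  proof -
    have "bij_betw (restrict (subst (L g)) ?E) ?E ?E"
      using bij[OF g] by (rule bij_betw_cong[THEN iffD1, rotated]) simp
    then show ?thesis by (simp add: Bij_def)
  qed
  have "(\<lambda>g. restrict (subst (L g)) ?E) \<in> hom G (BijGroup ?E)"
  proof (rule homI)
    fix g h assume "g \<in> carrier G" "h \<in> carrier G"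
    then show "restrict (subst (L (g \<otimes> h))) ?E =
        restrict (subst (L g)) ?E \<otimes>\<^bsub>BijGroup ?E\<^esub> restrict (subst (L h)) ?E"
      using Bij vars_act by (auto simp: BijGroup_def compose_def fun_eq_iff act_act)
  qed (use Bij in \<open>simp add: BijGroup_def\<close>)
  then show ?thesis
    by (intro group_action.intro group_hom.intro group_hom_axioms.intro is_group group_BijGroup)
qed

lemma card_orbit_dvd:
  assumes "j \<le> n"
  shows "card ((\<lambda>g. L g j) ` carrier G) dvd Coset.order G"
proof -
  let ?E = "{f :: 'k mpoly. vars f \<subseteq> {..n}}"
  interpret A: group_action G ?E "\<lambda>g. restrict (subst (L g)) ?E"
    by (rule group_action_restrict)
  have "orbit G (\<lambda>g. restrict (subst (L g)) ?E) (Var j) = (\<lambda>g. L g j) ` carrier G"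
    using assms by (auto simp: orbit_def)
  then show ?thesis
    using A.orbit_stabilizer_theorem[of "Var j"] assms by (metis (mono_tags) dvd_triv_left mem_Collect_eq
      vars_Var empty_subsetI insert_subset atMost_iff)
qed

lemma terminal_nilpotent:
  assumes p: "Factorial_Ring.prime CHAR('k)" and order: "Coset.order G = CHAR('k) ^ m"
    and i: "i \<le> k" and d: "d i = card ((\<lambda>g. L g i) ` carrier G)"
  shows "Var i ^ d i \<in> H"
proof -
  let ?O = "(\<lambda>g. L g i) ` carrier G"
  have in': "i \<le> n" using i kn by simp
  obtain a where a: "d i = CHAR('k) ^ a"
    using card_orbit_dvd[OF in'] divides_primepow_nat[OF p] unfolding order d by auto
  define F where "F = (\<Prod>h\<in>?O. h)"
  have vO: "vars h \<subseteq> {..n}" if "h \<in> ?O" for h using that vars_L in' by auto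
  have "F \<in> Invs"
    unfolding Invs_def
  proof (intro CollectI conjI ballI)
    show "vars F \<subseteq> {..n}" unfolding F_def using vO by (intro vars_prod)
    fix g assume g: "g \<in> carrier G"
    have "bij_betw (subst (L g)) ?O ?O"
    proof (rule bij_betw_byWitness[where f' = "subst (L (inv g))"])
      show "\<forall>h\<in>?O. subst (L (inv g)) (subst (L g) h) = h" "\<forall>h\<in>?O. subst (L g) (subst (L (inv g)) h) = h"
        using g vO act_one by (auto simp flip: act_act)
      show "subst (L g) ` ?O \<subseteq> ?O" "subst (L (inv g)) ` ?O \<subseteq> ?O"
        using g in' by (auto simp flip: L_mult)
    qed
    then have "(\<Prod>h\<in>?O. subst (L g) h) = F" unfolding F_def by (rule prod.reindex_bij_betw)
    then show "subst (L g) F = F" by (simp add: F_def subst_simps)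
  qed
  have "homog (card ?O) F"
    unfolding F_def by (rule homog_prod) (use fin homog_L in' in auto)
  then have hom: "homog (d i) F" by (simp add: d)
  have pF: "poly_in i F = (\<Prod>h\<in>?O. poly_in i h)" by (simp add: F_def poly_in_simps)
  have "Polynomial.degree (poly_in i F) = (\<Sum>h\<in>?O. 1)"
    unfolding pF
  proof (subst degree_prod_eq_sum_degree)
    show "\<forall>h\<in>?O. poly_in i h \<noteq> 0" using poly_in_L[OF _ i] by fastforce
    show "(\<Sum>h\<in>?O. Polynomial.degree (poly_in i h)) = (\<Sum>h\<in>?O. 1)"
      by (rule sum.cong) (use poly_in_L[OF _ i] in auto)
  qed
  then have deg: "Polynomial.degree (poly_in i F) = d i" by (simp add: d)
  have lead: "coeff (poly_in i F) (d i) = 1"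
    unfolding deg[symmetric] pF lead_coeff_prod by (rule prod.neutral) (use poly_in_L[OF _ i] in auto)
  \<comment> \<open>Hasse derivatives of positive order say nothing about the coefficient of index
    0; here it vanishes because x_i lies in its own orbit and so divides \<open>F\<close>.\<close>
  have zero: "coeff (poly_in i F) 0 = 0"
  proof -
    have "Var i \<in> ?O" using L_one[OF in'] one_closed by force
    then have "poly_in i (Var i) dvd poly_in i F"
      unfolding pF using fin by (intro dvd_prodI) auto
    then show ?thesis by (auto simp: poly_in_Var elim!: dvdE)
  qed
  define f where "f = F - Var i ^ d i"
  have pf: "poly_in i f = poly_in i F - Polynomial.monom 1 (d i)"
    by (simp add: f_def poly_in_simps poly_in_Var monom_altdef)
  have hf: "hasse i j f \<in> H" if j: "0 < j" for j
  proof (cases "j < d i")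
    case True
    have "hasse i j (Var i ^ d i :: 'k mpoly) = 0"
      unfolding hasse_Var_power a using binomial_prime_power_eq_0[OF p j] True a by simp
    moreover have "hasse i j F \<in> H"
      using Invs_hasse[OF \<open>F \<in> Invs\<close> i] homog_coef_0[OF homog_hasse[OF hom]] True by (intro HI) auto
    ultimately show ?thesis by (simp add: f_def hasse_diff)
  next
    case False
    \<comment> \<open>The leading terms of \<open>F\<close> and of the power of x_i cancel, so
      derivatives of order at least \<open>d i\<close> are zero.\<close>
    have "below i (d i) f"
      unfolding below_iff_coeff pf using lead deg by (auto simp: coeff_monom intro: coeff_eq_0)
    then have "hasse i j f = 0" using False by (simp add: below_iff_hasse[OF d_pos[OF i]])
    then show ?thesis using HD(2) by simp
  qed
  have "coeff (poly_in i f) l \<in> H" for l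
  proof (cases "l = 0")
    case True
    then show ?thesis using zero d_pos[OF i] HD(2) by (simp add: pf coeff_monom)
  next
    case False
    then show ?thesis by (intro coeff_in_ideal_of_hasse[OF H_ideal _ hf]) (use in' in auto)
  qed
  then have "poly (poly_in i f) (Var i) \<in> H"
    unfolding poly_altdef using vars_power[of "Var i"] in' by (intro HD(8) HD(5)) fastforce+
  then have "f \<in> H" by (simp add: poly_poly_in)
  moreover have "F \<in> H" using \<open>F \<in> Invs\<close> homog_coef_0[OF hom d_pos[OF i]] by (rule HI)
  ultimately have "F - f \<in> H" using HD(7) by blast
  then show ?thesis by (simp add: f_def)
qed

end


section \<open>Quotients of polynomial rings\<close>

lemma subfield_Const: "subfield (range Const) (mpoly_ring I :: 'k::field mpoly ring)"
proof -
  interpret cring "mpoly_ring I :: 'k mpoly ring" by (rule cring_mpoly_ring)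
  let ?K = "range Const :: 'k mpoly set"
  have neg: "\<ominus>\<^bsub>mpoly_ring I\<^esub> Const c = (Const (- c) :: 'k mpoly)" for c
    by (rule minus_equality) (simp_all add: Const_uminus)
  have "subring ?K (mpoly_ring I)"
  proof (rule subringI)
    show "\<one>\<^bsub>mpoly_ring I\<^esub> \<in> ?K" using Const_simps(2) by (metis mpoly_ring_ops(2) rangeI)
  qed (auto simp: neg simp flip: Const_add Const_mult)
  then have "subcring ?K (mpoly_ring I)" by (rule subcringI')
  moreover have "Units (mpoly_ring I\<lparr>carrier := ?K\<rparr>) = ?K - {\<zero>\<^bsub>mpoly_ring I\<^esub>}"
  proof (intro equalityI subsetI)
    fix f :: "'k mpoly" assume "f \<in> Units (mpoly_ring I\<lparr>carrier := ?K\<rparr>)"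
    then show "f \<in> ?K - {\<zero>\<^bsub>mpoly_ring I\<^esub>}" by (auto simp: Units_def)
  next
    fix f :: "'k mpoly" assume "f \<in> ?K - {\<zero>\<^bsub>mpoly_ring I\<^esub>}"
    then obtain c where f: "f = Const c" "Const c \<noteq> (0 :: 'k mpoly)" by auto
    then have "c \<noteq> 0" by auto
    with f have c: "f = Const c" "c \<noteq> 0" by auto
    then have "Const (inverse c) * f = 1" "f * Const (inverse c) = 1"
      by (simp_all add: Const_mult[symmetric])
    then show "f \<in> Units (mpoly_ring I\<lparr>carrier := ?K\<rparr>)" using c by (auto simp: Units_def)
  qed
  ultimately show ?thesis by (rule subfieldI)
qed

context
  fixes I :: "nat set" and J :: "'k::field mpoly set"
  assumes J: "ideal J (mpoly_ring I)"
begin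

abbreviation (input) "cl \<equiv> residue I J"
abbreviation (input) "Qt \<equiv> mpoly_ring I Quot J"

lemma ring_hom_residue: "ring_hom_ring (mpoly_ring I) Qt cl"
  using ideal.rcos_ring_hom_ring[OF J] by (simp add: residue_def[abs_def])

lemma cring_quotient: "cring Qt"
  by (rule ideal.quotient_is_cring[OF J cring_mpoly_ring])

lemma residue_simps:
  shows "vars f \<subseteq> I \<Longrightarrow> vars g \<subseteq> I \<Longrightarrow> cl f \<oplus>\<^bsub>Qt\<^esub> cl g = cl (f + g)"
    "vars f \<subseteq> I \<Longrightarrow> vars g \<subseteq> I \<Longrightarrow> cl f \<otimes>\<^bsub>Qt\<^esub> cl g = cl (f * g)"
    "\<zero>\<^bsub>Qt\<^esub> = cl 0" "\<one>\<^bsub>Qt\<^esub> = cl 1" "vars f \<subseteq> I \<Longrightarrow> \<ominus>\<^bsub>Qt\<^esub> cl f = cl (- f)"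
    "vars f \<subseteq> I \<Longrightarrow> cl f \<in> carrier Qt"
proof -
  interpret h: ring_hom_ring "mpoly_ring I" Qt cl by (rule ring_hom_residue)
  show "vars f \<subseteq> I \<Longrightarrow> vars g \<subseteq> I \<Longrightarrow> cl f \<oplus>\<^bsub>Qt\<^esub> cl g = cl (f + g)"
    "vars f \<subseteq> I \<Longrightarrow> vars g \<subseteq> I \<Longrightarrow> cl f \<otimes>\<^bsub>Qt\<^esub> cl g = cl (f * g)"
    "vars f \<subseteq> I \<Longrightarrow> cl f \<in> carrier Qt"
    using h.hom_add[of f g] h.hom_mult[of f g] h.hom_closed[of f] by simp_all
  show "\<zero>\<^bsub>Qt\<^esub> = cl 0" "\<one>\<^bsub>Qt\<^esub> = cl 1"
    using h.hom_zero h.hom_one by simp_all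
  have "vars f \<subseteq> I \<Longrightarrow> \<ominus>\<^bsub>mpoly_ring I\<^esub> f = - f"
    by (rule h.R.minus_equality) simp_all
  then show "vars f \<subseteq> I \<Longrightarrow> \<ominus>\<^bsub>Qt\<^esub> cl f = cl (- f)" using h.hom_a_inv[of f] by simp
qed

lemma residue_eq_iff:
  assumes "vars f \<subseteq> I" "vars g \<subseteq> I"
  shows "cl f = cl g \<longleftrightarrow> f - g \<in> J"
proof -
  interpret R: ring "mpoly_ring I :: 'k mpoly ring" by (rule ring_mpoly_ring)
  have "\<ominus>\<^bsub>mpoly_ring I\<^esub> g = - g"
    by (rule R.minus_equality) (use assms in simp_all)
  then show ?thesis
    using R.quotient_eq_iff_same_a_r_cos[OF J, of f g] assms by (simp add: residue_def a_minus_def)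
qed

lemma carrier_quotient: "carrier Qt = cl ` {f. vars f \<subseteq> I}"
  by (auto simp: FactRing_def A_RCOSETS_def' residue_def)

lemma combine_residue:
  assumes "distinct xs" "\<And>x. x \<in> set xs \<Longrightarrow> vars (e x) \<subseteq> I"
  shows "ring.combine Qt (map (\<lambda>x. cl (Const (c x))) xs) (map (\<lambda>x. cl (e x)) xs) =
    cl (\<Sum>x\<in>set xs. Const (c x) * e x)"
  using assms
proof (induction xs)
  case Nil
  interpret cring Qt by (rule cring_quotient)
  show ?case by (simp add: residue_simps)
next
  case (Cons x xs)
  interpret cring Qt by (rule cring_quotient)
  have x: "vars (e x) \<subseteq> I" using Cons.prems by simp
  have "vars (\<Sum>x\<in>set xs. Const (c x) * e x) \<subseteq> I" "vars (Const (c x) * e x) \<subseteq> I"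
    using Cons.prems vars_mult[of "Const (c _)" "e _"] by (auto intro!: vars_sum) blast+
  then show ?case using Cons x by (simp add: residue_simps)
qed

text \<open>Translates spanning and independence modulo \<open>J\<close> into vector space
  dimension. The family is indexed by \<open>Y\<close> so that products can be used as basis
  vectors; \<open>1 \<notin> J\<close> keeps the image of the constants a field.\<close>

lemma dimension_quotient:
  assumes Y: "finite Y" and e: "\<And>x. x \<in> Y \<Longrightarrow> vars (e x) \<subseteq> I"
    and span: "\<And>f. vars f \<subseteq> I \<Longrightarrow> \<exists>c. f - (\<Sum>x\<in>Y. Const (c x) * e x) \<in> J"
    and indep: "\<And>c. (\<Sum>x\<in>Y. Const (c x) * e x) \<in> J \<Longrightarrow> \<forall>x\<in>Y. c x = 0"
    and one: "1 \<notin> J"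
  shows "ring.dimension Qt (card Y) (range (\<lambda>c. cl (Const c))) (carrier Qt)"
proof -
  interpret cring Qt by (rule cring_quotient)
  note JD = ideal_mpoly_ringD[OF J]
  let ?K = "range (\<lambda>c. cl (Const c))"
  obtain xs where xs: "set xs = Y" "distinct xs" using finite_distinct_list[OF Y] by blast
  let ?Us = "map (\<lambda>x. cl (e x)) xs"
  have "\<one>\<^bsub>Qt\<^esub> \<noteq> \<zero>\<^bsub>Qt\<^esub>" using one by (simp add: residue_simps residue_eq_iff)
  then have "subfield (cl ` range Const) Qt"
    by (intro ring_hom_ring.img_is_subfield[OF ring_hom_residue subfield_Const])
  then have K: "subfield ?K Qt" by (simp add: image_image)
  have Us: "set ?Us \<subseteq> carrier Qt" using xs e by (auto simp: residue_simps)
  \<comment> \<open>Turns a list of scalars from the image of the field into a function on the index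
    set; distinct indices make this consistent.\<close>
  have fam: "\<exists>c. Ks = map (\<lambda>x. cl (Const (c x))) xs"
    if "length Ks = length xs" "set Ks \<subseteq> ?K" "distinct xs" for Ks and xs :: "'a list"
    using that
  proof (induction Ks xs rule: list_induct2)
    case (Cons y Ks x xs)
    then obtain c a where c: "Ks = map (\<lambda>x. cl (Const (c x))) xs" "y = cl (Const a)" by auto
    have "map (\<lambda>z. cl (Const ((c(x := a)) z))) xs = Ks"
      unfolding c using Cons.prems by (intro map_cong) auto
    then show ?case using c by (intro exI[of _ "c(x := a)"]) auto
  qed simp
  have vs: "vars (\<Sum>x\<in>Y. Const (c x) * e x) \<subseteq> I" for c
    using e vars_mult[of "Const (c _)" "e _"] by (intro vars_sum) fastforce
  have "independent ?K ?Us"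
  proof (rule trivial_combine_imp_independent[OF K Us])
    fix Ks assume Ks: "set Ks \<subseteq> ?K" "combine Ks ?Us = \<zero>\<^bsub>Qt\<^esub>"
    let ?z = "cl (Const 0)"
    \<comment> \<open>Coefficient lists of any length have to be handled. Padding with zeros and
      cutting to the length of the basis leaves the combination unchanged.\<close>
    define Ks' where "Ks' = take (length xs) (Ks @ replicate (length xs) ?z)"
    have len: "length Ks' = length xs" by (simp add: Ks'_def)
    have "?z \<in> ?K" by (rule rangeI)
    then have "set Ks' \<subseteq> ?K" using Ks(1) by (auto simp: Ks'_def dest!: in_set_takeD)
    then obtain c where c: "Ks' = map (\<lambda>x. cl (Const (c x))) xs" using fam[OF len] xs(2) by blast
    have "combine Ks' ?Us = combine (Ks @ replicate (length xs) ?z) ?Us"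
      unfolding Ks'_def using combine_take[of ?Us "Ks @ replicate (length xs) ?z"] by (simp only: length_map)
    also have "\<dots> = combine Ks ?Us"
      using combine_append_replicate[OF Us, of Ks "length xs"] by (simp add: residue_simps)
    finally have "cl (\<Sum>x\<in>Y. Const (c x) * e x) = cl 0"
      using combine_residue[OF xs(2), of e c] xs e Ks(2) c by (simp add: residue_simps)
    then have "(\<Sum>x\<in>Y. Const (c x) * e x) \<in> J" using vs by (simp add: residue_eq_iff)
    then have "set Ks' \<subseteq> {\<zero>\<^bsub>Qt\<^esub>}" using indep[of c] xs c by (auto simp: residue_simps)
    moreover have "set (take (length xs) Ks) \<subseteq> set Ks'" by (auto simp: Ks'_def)
    ultimately show "set (take (length ?Us) Ks) \<subseteq> {\<zero>\<^bsub>Qt\<^esub>}" by auto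
  qed
  moreover have "Span ?K ?Us = carrier Qt"
  proof
    show "Span ?K ?Us \<subseteq> carrier Qt" by (rule Span_in_carrier[OF _ Us]) (auto simp: residue_simps)
    show "carrier Qt \<subseteq> Span ?K ?Us"
    proof
      fix y assume "y \<in> carrier Qt"
      then obtain f where f: "y = cl f" "vars f \<subseteq> I" by (auto simp: carrier_quotient)
      obtain c where "f - (\<Sum>x\<in>Y. Const (c x) * e x) \<in> J" using span f by blast
      then have "y = combine (map (\<lambda>x. cl (Const (c x))) xs) ?Us"
        using combine_residue[OF xs(2), of e c] xs e f vs by (simp add: residue_eq_iff)
      then show "y \<in> Span ?K ?Us"
        unfolding Span_eq_combine_set_length_version[OF K Us] by force
    qed
  qed
  ultimately have "dimension (length ?Us) ?K (carrier Qt)" by (rule dimensionI[OF K])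
  then show ?thesis using distinct_card[OF xs(2)] xs(1) by simp
qed

text \<open>Allows elements of the generated subalgebra to be handled through polynomial
  representatives in the variables of \<open>S\<close>.\<close>

lemma generated_subalgebra_residue:
  assumes "S \<subseteq> I"
  shows "generated_subalgebra I J ((\<lambda>i. cl (Var i)) ` S) = cl ` {f. vars f \<subseteq> S}"
proof
  interpret cring Qt by (rule cring_quotient)
  let ?g = "range (\<lambda>c. cl (Const c)) \<union> (\<lambda>i. cl (Var i)) ` S"
  show "generated_subalgebra I J ((\<lambda>i. cl (Var i)) ` S) \<subseteq> cl ` {f. vars f \<subseteq> S}"
  proof
    fix y assume "y \<in> generated_subalgebra I J ((\<lambda>i. cl (Var i)) ` S)"
    then have "y \<in> generate_ring Qt ?g" by (simp add: generated_subalgebra_def)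
    then show "y \<in> cl ` {f. vars f \<subseteq> S}"
    proof (induction rule: generate_ring.induct)
      case one then show ?case by (rule image_eqI[of _ _ 1]) (simp_all add: residue_simps)
    next
      case (incl h)
      then show ?case by auto
    next
      case (a_inv h)
      then obtain f where "h = cl f" "vars f \<subseteq> S" by auto
      then show ?case using assms by (intro image_eqI[of _ _ "- f"]) (auto simp: residue_simps)
    next
      case (eng_add h1 h2)
      then obtain f g where "h1 = cl f" "vars f \<subseteq> S" "h2 = cl g" "vars g \<subseteq> S" by auto
      then show ?case using assms vars_add[of f g]
        by (intro image_eqI[of _ _ "f + g"]) (auto simp: residue_simps)
    next
      case (eng_mult h1 h2)
      then obtain f g where "h1 = cl f" "vars f \<subseteq> S" "h2 = cl g" "vars g \<subseteq> S" by auto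
      then show ?case using assms vars_mult[of f g]
        by (intro image_eqI[of _ _ "f * g"]) (auto simp: residue_simps)
    qed
  qed
  show "cl ` {f. vars f \<subseteq> S} \<subseteq> generated_subalgebra I J ((\<lambda>i. cl (Var i)) ` S)"
  proof clarify
    fix f :: "'k mpoly" assume "vars f \<subseteq> S"
    then have "vars f \<subseteq> S \<and> cl f \<in> generate_ring Qt ?g"
    proof (induction f rule: mpoly_induct)
      case (Const c) then show ?case by (auto intro: generate_ring.incl)
    next
      case (Var i) then show ?case by (auto intro: generate_ring.incl)
    next
      case (add f g)
      then have "cl (f + g) = cl f \<oplus>\<^bsub>Qt\<^esub> cl g"
        using assms by (intro residue_simps(1)[symmetric]) auto
      then show ?case using add vars_add[of f g] by (auto intro: generate_ring.eng_add)
    next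
      case (mult f g)
      then have "cl (f * g) = cl f \<otimes>\<^bsub>Qt\<^esub> cl g"
        using assms by (intro residue_simps(2)[symmetric]) auto
      then show ?case using mult vars_mult[of f g] by (auto intro: generate_ring.eng_mult)
    qed
    then show "cl f \<in> generated_subalgebra I J ((\<lambda>i. cl (Var i)) ` S)"
      by (simp add: generated_subalgebra_def)
  qed
qed

lemma ring_subalgebra:
  assumes "S \<subseteq> I"
  shows "cring (Qt\<lparr>carrier := cl ` {f. vars f \<subseteq> S}\<rparr>)"
proof -
  interpret cring Qt by (rule cring_quotient)
  let ?g = "range (\<lambda>c. cl (Const c)) \<union> (\<lambda>i. cl (Var i)) ` S"
  have "?g \<subseteq> carrier Qt" using assms by (auto simp: residue_simps)
  then have "subring (generate_ring Qt ?g) Qt" by (rule generate_ring_is_subring)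
  then have "subcring (generate_ring Qt ?g) Qt" by (rule subcringI')
  then have "subcring (cl ` {f. vars f \<subseteq> S}) Qt"
    using generated_subalgebra_residue[OF assms] by (simp add: generated_subalgebra_def)
  then show ?thesis using subcring_iff subcringE(1) by blast
qed

lemma module_subalgebra:
  assumes "S \<subseteq> I"
  shows "Module.module (Qt\<lparr>carrier := cl ` {f. vars f \<subseteq> S}\<rparr>) (regular_module Qt)"
proof -
  interpret cring Qt by (rule cring_quotient)
  have T: "x \<in> carrier Qt" if "x \<in> cl ` {f. vars f \<subseteq> S}" for x
    using that assms by (auto simp: residue_simps)
  have "abelian_group (regular_module Qt)"
  proof (rule abelian_groupI)
    fix x assume "x \<in> carrier (regular_module Qt)"
    then show "\<exists>y\<in>carrier (regular_module Qt). y \<oplus>\<^bsub>regular_module Qt\<^esub> x = \<zero>\<^bsub>regular_module Qt\<^esub>"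
      by (intro bexI[of _ "\<ominus>\<^bsub>Qt\<^esub> x"]) (simp_all add: regular_module_def l_neg)
  qed (simp_all add: regular_module_def a_ac)
  then show ?thesis
    by (rule moduleI[OF ring_subalgebra[OF assms]])
      (use T in \<open>simp_all add: regular_module_def l_distr r_distr m_assoc\<close>)
qed

end


section \<open>Structure of the coinvariants\<close>

context terminal_action
begin

abbreviation "Q \<equiv> R Quot H"
abbreviation "cls \<equiv> residue {..n} H"

definition power_ideal :: "'k mpoly set"
  where "power_ideal = Idl\<^bsub>mpoly_ring {..k}\<^esub> ((\<lambda>i. Var i ^ d i) ` {..k})"

lemma one_notin_H: "1 \<notin> H"
  using H_coef_0[of 1] by auto

lemma Const_in_H: "Const c \<in> H \<Longrightarrow> c = 0"
  using H_coef_0[of "Const c"] by simp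

text \<open>The products of a monomial from \<open>box\<close> with an element of \<open>E\<close>
  form a basis modulo \<open>H\<close>. The sums are grouped by \<open>b\<close> so that the inner
  sum is a polynomial in the terminal variables: one basis serves both the dimension and freeness
  over the subalgebra.\<close>

definition product_basis :: "'k mpoly set \<Rightarrow> bool"
  where "product_basis E \<longleftrightarrow> finite E \<and> (\<forall>b\<in>E. vars b \<subseteq> {Suc k..n}) \<and>
    (\<forall>f. vars f \<subseteq> {..n} \<longrightarrow> (\<exists>c. f - (\<Sum>b\<in>E. (\<Sum>a\<in>box. sgl a (c a b)) * b) \<in> H)) \<and>
    (\<forall>c a b. (\<Sum>b\<in>E. (\<Sum>a\<in>box. sgl a (c a b)) * b) \<in> H \<longrightarrow> a \<in> box \<longrightarrow> b \<in> E \<longrightarrow> c a b = 0)"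

lemma product_basisD:
  assumes "product_basis E"
  shows "finite E" "b \<in> E \<Longrightarrow> vars b \<subseteq> {Suc k..n}"
    "vars f \<subseteq> {..n} \<Longrightarrow> \<exists>c. f - (\<Sum>b\<in>E. (\<Sum>a\<in>box. sgl a (c a b)) * b) \<in> H"
    "(\<Sum>b\<in>E. (\<Sum>a\<in>box. sgl a (c a b)) * b) \<in> H \<Longrightarrow> a \<in> box \<Longrightarrow> b \<in> E \<Longrightarrow> c a b = 0"
  using assms unfolding product_basis_def by simp_all

lemma ex_product_basis: "\<exists>E. product_basis E"
proof -
  obtain E where E: "finite E" "\<And>b. b \<in> E \<Longrightarrow> vars b \<subseteq> {Suc k..n}" "spans_mod_H E"
    and ind: "\<And>c. (\<Sum>b\<in>E. Const (c b) * b) \<in> H \<Longrightarrow> \<forall>b\<in>E. c b = 0"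
    using ex_basis_mod_H by blast
  have swap: "(\<Sum>b\<in>E. (\<Sum>a\<in>box. sgl a (c a b)) * b) = (\<Sum>a\<in>box. sgl a 1 * (\<Sum>b\<in>E. Const (c a b) * b))" for c
  proof -
    have "(\<Sum>b\<in>E. (\<Sum>a\<in>box. sgl a (c a b)) * b) = (\<Sum>b\<in>E. \<Sum>a\<in>box. sgl a (c a b) * b)"
      by (simp add: sum_distrib_right)
    also have "\<dots> = (\<Sum>a\<in>box. \<Sum>b\<in>E. sgl a (c a b) * b)" by (rule sum.swap)
    also have "\<dots> = (\<Sum>a\<in>box. sgl a 1 * (\<Sum>b\<in>E. Const (c a b) * b))"
      by (simp add: sum_distrib_left Const_def mult_single flip: mult.assoc)
    finally show ?thesis .
  qed
  show ?thesis
    unfolding product_basis_def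
  proof (rule exI[of _ E], intro conjI ballI allI impI)
    fix f :: "'k mpoly" assume "vars f \<subseteq> {..n}"
    then have "\<exists>u. (\<forall>a\<in>box. vars (u a) \<subseteq> {Suc k..n}) \<and> f - (\<Sum>a\<in>box. sgl a 1 * u a) \<in> H"
      by (rule box_span)
    then obtain u where uu: "(\<forall>a\<in>box. vars (u a) \<subseteq> {Suc k..n}) \<and> f - (\<Sum>a\<in>box. sgl a 1 * u a) \<in> H" ..
    then have u: "\<And>a. a \<in> box \<Longrightarrow> vars (u a) \<subseteq> {Suc k..n}" "f - (\<Sum>a\<in>box. sgl a 1 * u a) \<in> H"
      by simp_all
    have "\<exists>c. u a - (\<Sum>b\<in>E. Const (c b) * b) \<in> H" if "a \<in> box" for a
      using E(3) u(1)[OF that] by (simp add: spans_mod_H_def)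
    then have "\<exists>c. \<forall>a\<in>box. u a - (\<Sum>b\<in>E. Const (c a b) * b) \<in> H" by (intro bchoice ballI)
    then obtain c where "\<forall>a\<in>box. u a - (\<Sum>b\<in>E. Const (c a b) * b) \<in> H" ..
    then have c: "\<And>a. a \<in> box \<Longrightarrow> u a - (\<Sum>b\<in>E. Const (c a b) * b) \<in> H" by simp
    have "(\<Sum>a\<in>box. sgl a 1 * (u a - (\<Sum>b\<in>E. Const (c a b) * b))) \<in> H"
      by (intro HD(8) HD(4) c) (use kn in \<open>auto simp: vars_single box_def\<close>)
    then have "(f - (\<Sum>a\<in>box. sgl a 1 * u a)) +
        (\<Sum>a\<in>box. sgl a 1 * (u a - (\<Sum>b\<in>E. Const (c a b) * b))) \<in> H"
      using u(2) by (rule HD(3)[rotated])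
    moreover have "(f - (\<Sum>a\<in>box. sgl a 1 * u a)) +
        (\<Sum>a\<in>box. sgl a 1 * (u a - (\<Sum>b\<in>E. Const (c a b) * b))) =
        f - (\<Sum>b\<in>E. (\<Sum>a\<in>box. sgl a (c a b)) * b)"
      unfolding swap by (simp add: right_diff_distrib sum_subtractf)
    ultimately show "\<exists>c. f - (\<Sum>b\<in>E. (\<Sum>a\<in>box. sgl a (c a b)) * b) \<in> H"
      by (intro exI[of _ c]) simp
  next
    fix c a b assume *: "(\<Sum>b\<in>E. (\<Sum>a\<in>box. sgl a (c a b)) * b) \<in> H" "a \<in> box" "b \<in> E"
    have "(\<Sum>b\<in>E. Const (c a b) * b) \<in> H"
    proof (rule box_independent[OF _ *(1)[unfolded swap] *(2)])
      show "vars (\<Sum>b\<in>E. Const (c a b) * b) \<subseteq> {Suc k..n}" for a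
        using E(2) vars_mult[of "Const (c a _)"] by (intro vars_sum) fastforce
    qed
    then show "c a b = 0" using ind[of "c a"] *(3) by simp
  qed (use E in auto)
qed

lemma dimension_coinvariants:
  "\<exists>D. ring.dimension Q D (range (\<lambda>c. cls (Const c))) (carrier Q) \<and> (\<Prod>i\<le>k. d i) dvd D"
proof -
  obtain E where pb: "product_basis E" using ex_product_basis by (elim exE)
  note E = product_basisD(1,2)[OF pb] and span = product_basisD(3)[OF pb] and ind = product_basisD(4)[OF pb]
  let ?e = "\<lambda>(a, b). sgl a 1 * b :: 'k mpoly"
  have eq: "(\<Sum>x\<in>box \<times> E. Const (c x) * ?e x) = (\<Sum>b\<in>E. (\<Sum>a\<in>box. sgl a (c (a, b))) * b)" for c
  proof -
    have "(\<Sum>x\<in>box \<times> E. Const (c x) * ?e x) = (\<Sum>a\<in>box. \<Sum>b\<in>E. sgl a (c (a, b)) * b)"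
      unfolding sum.cartesian_product
      by (rule sum.cong) (auto simp: Const_def mult_single simp flip: mult.assoc)
    also have "\<dots> = (\<Sum>b\<in>E. \<Sum>a\<in>box. sgl a (c (a, b)) * b)" by (rule sum.swap)
    finally show ?thesis by (simp add: sum_distrib_right)
  qed
  have "ring.dimension Q (card (box \<times> E)) (range (\<lambda>c. cls (Const c))) (carrier Q)"
  proof (rule dimension_quotient[OF H_ideal, where e = ?e])
    show "finite (box \<times> E)" using finite_box E by simp
    show "vars (?e x) \<subseteq> {..n}" if x: "x \<in> box \<times> E" for x
    proof -
      obtain a b where ab: "x = (a, b)" "a \<in> box" "b \<in> E" using x by auto
      have "vars b \<subseteq> {..n}" using E(2)[OF ab(3)] by auto
      moreover have "vars (sgl a (1 :: 'k)) \<subseteq> {..n}" using ab(2) kn by (auto simp: vars_single box_def)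
      ultimately show ?thesis using vars_mult[of "sgl a 1" b] ab(1) by auto
    qed
    show "\<exists>c. f - (\<Sum>x\<in>box \<times> E. Const (c x) * ?e x) \<in> H" if "vars f \<subseteq> {..n}" for f
    proof -
      obtain c where "f - (\<Sum>b\<in>E. (\<Sum>a\<in>box. sgl a (c a b)) * b) \<in> H" using span[OF \<open>vars f \<subseteq> {..n}\<close>] by blast
      then show ?thesis unfolding eq by (intro exI[of _ "\<lambda>(a, b). c a b"]) simp
    qed
    show "\<forall>x\<in>box \<times> E. c x = 0" if "(\<Sum>x\<in>box \<times> E. Const (c x) * ?e x) \<in> H" for c
      using ind[of "\<lambda>a b. c (a, b)"] that unfolding eq by auto
  qed (rule one_notin_H)
  moreover have "(\<Prod>i\<le>k. d i) dvd card (box \<times> E)" by (simp add: card_cartesian_product card_box)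
  ultimately show ?thesis by blast
qed

lemma power_gens_vars: "(\<lambda>i. Var i ^ d i) ` {..k} \<subseteq> {f :: 'k mpoly. vars f \<subseteq> {..k}}"
  using vars_power[of "Var _"] by fastforce

lemma power_ideal_ideal: "ideal power_ideal (mpoly_ring {..k})"
  unfolding power_ideal_def by (rule genideal_mpoly_ring(1)[OF power_gens_vars])

text \<open>A monomial in the terminal variables outside \<open>box\<close> is divisible by some
  generator of \<open>power_ideal\<close>.\<close>

lemma truncate_mod_power_ideal:
  assumes "vars f \<subseteq> {..k}"
  shows "f - (\<Sum>a\<in>box. sgl a (coef f a)) \<in> power_ideal"
proof -
  note PD = ideal_mpoly_ringD[OF power_ideal_ideal]
  have "(\<Sum>a\<in>box. sgl a (coef f a)) = (\<Sum>a\<in>box \<inter> supp f. sgl a (coef f a))"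
    using finite_box by (intro sum.mono_neutral_right) (auto simp: in_keys_iff)
  then have "f - (\<Sum>a\<in>box. sgl a (coef f a)) = (\<Sum>m\<in>supp f - box. sgl m (coef f m))"
    using sum.Int_Diff[of "supp f" "\<lambda>m. sgl m (coef f m)" box] by (simp add: sum_singles Int_commute algebra_simps)
  also have "\<dots> \<in> power_ideal"
  proof (rule PD(8))
    fix m assume m: "m \<in> supp f - box"
    then have sm: "supp m \<subseteq> {..k}" using assms by (auto simp: vars_def)
    then obtain i where i: "i \<le> k" "d i \<le> coef m i" using m by (auto simp: box_def not_less)
    have "m - sgl i (d i) + sgl i (d i) = m"
      by (rule poly_mapping_eqI) (use i in \<open>auto simp: lookup_add lookup_minus lookup_single when_def\<close>)
    then have "sgl m (coef f m) = sgl (m - sgl i (d i)) (coef f m) * Var i ^ d i"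
      by (simp add: Var_power mult_single)
    moreover have "vars (sgl (m - sgl i (d i)) (coef f m)) \<subseteq> {..k}"
      using sm by (auto simp: vars_single in_keys_iff lookup_minus subset_iff)
    moreover have "Var i ^ d i \<in> power_ideal"
      unfolding power_ideal_def by (rule genideal_mpoly_ring(2)[OF power_gens_vars]) (use i in auto)
    ultimately show "sgl m (coef f m) \<in> power_ideal" using PD(4) by simp
  qed
  finally show ?thesis .
qed

section \<open>The case of nilpotent terminal variables of order d_i\<close>

context
  assumes nil: "\<And>i. i \<le> k \<Longrightarrow> Var i ^ d i \<in> H"
begin

lemma power_ideal_subset_H: "f \<in> power_ideal \<Longrightarrow> f \<in> H"
proof -
  assume f: "f \<in> power_ideal"
  have "ideal {f \<in> H. vars f \<subseteq> {..k}} (mpoly_ring {..k})"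
  proof (rule ideal_mpoly_ringI)
    fix f g assume "f \<in> {f \<in> H. vars f \<subseteq> {..k}}" "g \<in> {f \<in> H. vars f \<subseteq> {..k}}"
    then show "f + g \<in> {f \<in> H. vars f \<subseteq> {..k}}" using HD(3)[of f g] vars_add[of f g] by auto
  next
    fix a f :: "'k mpoly" assume a: "vars a \<subseteq> {..k}" "f \<in> {f \<in> H. vars f \<subseteq> {..k}}"
    then have "vars a \<subseteq> {..n}" using kn by auto
    then show "a * f \<in> {f \<in> H. vars f \<subseteq> {..k}}" using HD(4)[of a f] a vars_mult[of a f] by auto
  qed (use HD(2) in auto)
  then have "f \<in> {f \<in> H. vars f \<subseteq> {..k}}"
    using genideal_mpoly_ring(3)[OF power_gens_vars] f nil power_gens_vars unfolding power_ideal_def by blast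
  then show "f \<in> H" by simp
qed

text \<open>Truncation to \<open>box\<close> changes f only by elements of
  \<open>power_ideal\<close>, hence of \<open>H\<close>. Independence then puts each truncated
  coefficient, a constant, into the proper ideal \<open>H\<close>, so it is 0.\<close>

lemma H_inter_eq_power_ideal:
  assumes "vars f \<subseteq> {..k}"
  shows "f \<in> H \<longleftrightarrow> f \<in> power_ideal"
proof
  assume f: "f \<in> H"
  note t = truncate_mod_power_ideal[OF assms]
  have eq: "f - (f - (\<Sum>a\<in>box. sgl a (coef f a))) = (\<Sum>a\<in>box. sgl a 1 * Const (coef f a))"
    by (simp add: Const_def mult_single)
  have "(\<Sum>a\<in>box. sgl a 1 * Const (coef f a)) \<in> H"
    using HD(7)[OF f power_ideal_subset_H[OF t]] unfolding eq .
  then have "Const (coef f a) \<in> H" if "a \<in> box" for a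
    using box_independent[of "\<lambda>a. Const (coef f a)"] that by simp
  then have "coef f a = 0" if "a \<in> box" for a using Const_in_H that by blast
  then show "f \<in> power_ideal" using t by simp
qed (rule power_ideal_subset_H)

text \<open>The classes of \<open>E\<close> form a basis over the subalgebra. Expansions come from
  the product basis by reading the inner sums as scalars.\<close>

lemma free_coinvariants: "free_module (Q\<lparr>carrier := cls ` {f. vars f \<subseteq> {..k}}\<rparr>) (regular_module Q)"
proof -
  let ?T = "cls ` {f. vars f \<subseteq> {..k}}"
  let ?M = "regular_module Q"
  interpret Q: cring Q by (rule cring_quotient[OF H_ideal])
  note rs = residue_simps[OF H_ideal] and re = residue_eq_iff[OF H_ideal]
  have kn': "{..k} \<subseteq> {..n}" using kn by auto
  have module: "Module.module (Q\<lparr>carrier := ?T\<rparr>) ?M" by (rule module_subalgebra[OF H_ideal kn'])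
  interpret M: abelian_group ?M using module by (rule Module.module.axioms)
  have M: "carrier ?M = carrier Q" "add ?M = add Q" "ring.zero ?M = \<zero>\<^bsub>Q\<^esub>" "module.smult ?M = monoid.mult Q"
    by (simp_all add: regular_module_def)
  obtain E where pb: "product_basis E" using ex_product_basis by (elim exE)
  note E = product_basisD(1,2)[OF pb] and span = product_basisD(3)[OF pb] and ind = product_basisD(4)[OF pb]
  have Ev: "vars b \<subseteq> {..n}" if "b \<in> E" for b using E(2)[OF that] by auto
  have vm: "vars (v * b) \<subseteq> {..n}" if "vars v \<subseteq> {..k}" "b \<in> E" for v b
    by (intro vars_mult[THEN subset_trans] Un_least Ev subset_trans[OF _ kn'] that)
  have vs: "vars (\<Sum>b\<in>S. v b * b) \<subseteq> {..n}" if "\<And>b. b \<in> S \<Longrightarrow> vars (v b) \<subseteq> {..k}" "S \<subseteq> E" for v S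
    by (rule vars_sum, rule vm) (use that in auto)
  \<comment> \<open>Linear independence over the subalgebra: truncating the coefficients to
    \<open>box\<close> alters the relation only by elements of \<open>H\<close> and reduces it to
    independence of the product basis over the field.\<close>
  have key: "w b \<in> H" if w: "\<And>b. b \<in> E \<Longrightarrow> vars (w b) \<subseteq> {..k}" and s: "(\<Sum>b\<in>E. w b * b) \<in> H" and b: "b \<in> E" for w b
  proof -
    let ?t = "\<lambda>b. \<Sum>a\<in>box. sgl a (coef (w b) a)"
    have d: "w b - ?t b \<in> H" if "b \<in> E" for b
      using truncate_mod_power_ideal[OF w[OF that]] by (rule power_ideal_subset_H)
    have "(\<Sum>b\<in>E. (w b - ?t b) * b) \<in> H" by (intro HD(8) HD(5) d Ev)
    then have "(\<Sum>b\<in>E. w b * b) - (\<Sum>b\<in>E. (w b - ?t b) * b) \<in> H" using s by (rule HD(7)[rotated])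
    then have "(\<Sum>b\<in>E. ?t b * b) \<in> H" by (simp add: left_diff_distrib sum_subtractf)
    then have "?t b = 0" using ind[of "\<lambda>a b. coef (w b) a"] b by simp
    then show "w b \<in> H" using d[OF b] by simp
  qed
  \<comment> \<open>The module basis is a set of classes, so different elements of \<open>E\<close>
    must not merge; otherwise their difference would be a relation with coefficient 1.\<close>
  have inj: "inj_on cls E"
  proof (rule inj_onI, rule ccontr)
    fix b b' assume b: "b \<in> E" "b' \<in> E" "cls b = cls b'" "b \<noteq> b'"
    let ?w = "\<lambda>x. if x = b then 1 else if x = b' then - 1 else 0 :: 'k mpoly"
    have "(\<Sum>x\<in>E. ?w x * x) = (\<Sum>x\<in>{b, b'}. ?w x * x)"
      using E(1) b by (intro sum.mono_neutral_right) auto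
    then have "(\<Sum>x\<in>E. ?w x * x) = b - b'" using b by simp
    then have "?w b \<in> H" using key[of ?w b] b re[OF Ev Ev] by auto
    then show False using one_notin_H by simp
  qed
  have fs: "finite S \<Longrightarrow> S \<subseteq> E \<Longrightarrow> (\<And>b. b \<in> S \<Longrightarrow> vars (v b) \<subseteq> {..k} \<and> t (cls b) = cls (v b)) \<Longrightarrow>
      (\<Oplus>\<^bsub>?M\<^esub>x\<in>cls ` S. t x \<odot>\<^bsub>?M\<^esub> x) = cls (\<Sum>b\<in>S. v b * b)" for S v t
  proof (induction S rule: finite_induct)
    case empty
    then show ?case by (simp add: M rs)
  next
    case (insert b S)
    have b: "b \<in> E" "vars (v b) \<subseteq> {..n}" "t (cls b) = cls (v b)"
      using insert.prems(1) insert.prems(2)[of b] kn' by auto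
    have tb: "t (cls b) \<odot>\<^bsub>?M\<^esub> cls b = cls (v b * b)"
      unfolding M b(3) by (rule rs(2)) (use b Ev in auto)
    have cl: "t (cls b') \<odot>\<^bsub>?M\<^esub> cls b' \<in> carrier ?M" if b': "b' \<in> insert b S" for b'
    proof -
      have b: "b' \<in> E" "vars (v b') \<subseteq> {..n}" "t (cls b') = cls (v b')"
        using insert.prems(1) insert.prems(2)[OF b'] b' kn' by auto
      show ?thesis unfolding M b(3) by (intro Q.m_closed rs(6) b Ev)
    qed
    have "cls b \<notin> cls ` S" using inj insert.hyps insert.prems(1) by (auto simp: inj_on_def)
    then have "(\<Oplus>\<^bsub>?M\<^esub>x\<in>cls ` insert b S. t x \<odot>\<^bsub>?M\<^esub> x) =
        (t (cls b) \<odot>\<^bsub>?M\<^esub> cls b) \<oplus>\<^bsub>?M\<^esub> (\<Oplus>\<^bsub>?M\<^esub>x\<in>cls ` S. t x \<odot>\<^bsub>?M\<^esub> x)"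
      unfolding image_insert by (intro M.finsum_insert) (use insert.hyps cl in auto)
    also have "\<dots> = cls (v b * b) \<oplus>\<^bsub>Q\<^esub> cls (\<Sum>b\<in>S. v b * b)"
      unfolding tb using insert.IH insert.prems by (simp add: M(2))
    also have "\<dots> = cls (v b * b + (\<Sum>b\<in>S. v b * b))"
    proof (rule rs(1))
      show "vars (v b * b) \<subseteq> {..n}" by (rule vm) (use insert.prems in auto)
      show "vars (\<Sum>b\<in>S. v b * b) \<subseteq> {..n}" by (rule vs) (use insert.prems in auto)
    qed
    finally show ?case using insert.hyps by simp
  qed
  \<comment> \<open>The module expansion sums over nonzero coefficients only. The omitted terms have
    coefficients in \<open>H\<close>, so the sum may be taken over all of \<open>E\<close>.\<close>
  have expand: "(\<Oplus>\<^bsub>?M\<^esub>x\<in>{x \<in> cls ` E. t x \<noteq> \<zero>\<^bsub>Q\<^esub>}. t x \<odot>\<^bsub>?M\<^esub> x) = cls (\<Sum>b\<in>E. v b * b)"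
    if v: "\<And>b. b \<in> E \<Longrightarrow> vars (v b) \<subseteq> {..k} \<and> t (cls b) = cls (v b)" for t v
  proof -
    let ?S = "{b \<in> E. t (cls b) \<noteq> \<zero>\<^bsub>Q\<^esub>}"
    have S: "{x \<in> cls ` E. t x \<noteq> \<zero>\<^bsub>Q\<^esub>} = cls ` ?S" by auto
    have "(\<Oplus>\<^bsub>?M\<^esub>x\<in>{x \<in> cls ` E. t x \<noteq> \<zero>\<^bsub>Q\<^esub>}. t x \<odot>\<^bsub>?M\<^esub> x) = cls (\<Sum>b\<in>?S. v b * b)"
      unfolding S
    proof (rule fs)
      show "finite ?S" using E(1) by simp
      show "?S \<subseteq> E" by (rule Collect_restrict)
      show "vars (v b) \<subseteq> {..k} \<and> t (cls b) = cls (v b)" if "b \<in> ?S" for b using v[of b] that by simp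
    qed
    also have "\<dots> = cls (\<Sum>b\<in>E. v b * b)"
    proof -
      have "(\<Sum>b\<in>E. v b * b) - (\<Sum>b\<in>?S. v b * b) = (\<Sum>b\<in>E - ?S. v b * b)"
        using E(1) by (simp add: sum_diff)
      moreover have "(\<Sum>b\<in>E - ?S. v b * b) \<in> H"
      proof (intro HD(8) HD(5))
        fix b assume b: "b \<in> E - ?S"
        then have vb: "vars (v b) \<subseteq> {..n}" "cls (v b) = cls 0" using v[of b] kn' rs(3) by auto
        then show "v b \<in> H" using re[OF vb(1), of 0] by simp
        show "vars b \<subseteq> {..n}" using b Ev by auto
      qed
      moreover have "vars (\<Sum>b\<in>E. v b * b) \<subseteq> {..n}" "vars (\<Sum>b\<in>?S. v b * b) \<subseteq> {..n}"
        by (rule vs; use v in auto)+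
      ultimately have "cls (\<Sum>b\<in>E. v b * b) = cls (\<Sum>b\<in>?S. v b * b)"
        using re by simp
      then show ?thesis by simp
    qed
    finally show ?thesis .
  qed
  have "\<exists>!t. t \<in> cls ` E \<rightarrow>\<^sub>E ?T \<and> finite {x \<in> cls ` E. t x \<noteq> \<zero>\<^bsub>Q\<^esub>} \<and>
      y = (\<Oplus>\<^bsub>?M\<^esub>x\<in>{x \<in> cls ` E. t x \<noteq> \<zero>\<^bsub>Q\<^esub>}. t x \<odot>\<^bsub>?M\<^esub> x)" if y: "y \<in> carrier ?M" for y
  proof -
    obtain f where f: "y = cls f" "vars f \<subseteq> {..n}" using y by (auto simp: M carrier_quotient[OF H_ideal])
    obtain c where c: "f - (\<Sum>b\<in>E. (\<Sum>a\<in>box. sgl a (c a b)) * b) \<in> H" using span f(2) by blast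
    let ?v = "\<lambda>b. \<Sum>a\<in>box. sgl a (c a b)"
    have v: "vars (?v b) \<subseteq> {..k}" for b
      by (rule vars_sum) (auto simp: vars_single box_def)
    \<comment> \<open>By injectivity of the class map on \<open>E\<close>, \<open>inv_into\<close>
      returns the unique representative; the restriction makes the family extensional.\<close>
    let ?t = "restrict (\<lambda>x. cls (?v (inv_into E cls x))) (cls ` E)"
    have t: "vars (?v b) \<subseteq> {..k} \<and> ?t (cls b) = cls (?v b)" if "b \<in> E" for b
      using v that inj by simp
    show ?thesis
    proof (rule ex1I[of _ ?t])
      have "y = cls (\<Sum>b\<in>E. ?v b * b)"
        unfolding f(1) using c re[OF f(2) vs[of E ?v]] v by simp
      also have "\<dots> = (\<Oplus>\<^bsub>?M\<^esub>x\<in>{x \<in> cls ` E. ?t x \<noteq> \<zero>\<^bsub>Q\<^esub>}. ?t x \<odot>\<^bsub>?M\<^esub> x)"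
        by (rule expand[of ?v ?t, symmetric]) (rule t)
      finally have "y = (\<Oplus>\<^bsub>?M\<^esub>x\<in>{x \<in> cls ` E. ?t x \<noteq> \<zero>\<^bsub>Q\<^esub>}. ?t x \<odot>\<^bsub>?M\<^esub> x)" .
      moreover have "?t \<in> cls ` E \<rightarrow>\<^sub>E ?T" using v by auto
      ultimately show "?t \<in> cls ` E \<rightarrow>\<^sub>E ?T \<and> finite {x \<in> cls ` E. ?t x \<noteq> \<zero>\<^bsub>Q\<^esub>} \<and>
          y = (\<Oplus>\<^bsub>?M\<^esub>x\<in>{x \<in> cls ` E. ?t x \<noteq> \<zero>\<^bsub>Q\<^esub>}. ?t x \<odot>\<^bsub>?M\<^esub> x)"
        using E(1) by simp
      fix t' assume t': "t' \<in> cls ` E \<rightarrow>\<^sub>E ?T \<and> finite {x \<in> cls ` E. t' x \<noteq> \<zero>\<^bsub>Q\<^esub>} \<and>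
          y = (\<Oplus>\<^bsub>?M\<^esub>x\<in>{x \<in> cls ` E. t' x \<noteq> \<zero>\<^bsub>Q\<^esub>}. t' x \<odot>\<^bsub>?M\<^esub> x)"
      have "\<exists>f. vars f \<subseteq> {..k} \<and> t' (cls b) = cls f" if "b \<in> E" for b
      proof -
        have "t' (cls b) \<in> ?T" using t' that by (auto simp: PiE_iff)
        then show ?thesis by auto
      qed
      then have "\<exists>v'. \<forall>b\<in>E. vars (v' b) \<subseteq> {..k} \<and> t' (cls b) = cls (v' b)" by (intro bchoice ballI)
      then obtain v' where "\<forall>b\<in>E. vars (v' b) \<subseteq> {..k} \<and> t' (cls b) = cls (v' b)" ..
      then have v': "\<And>b. b \<in> E \<Longrightarrow> vars (v' b) \<subseteq> {..k} \<and> t' (cls b) = cls (v' b)" by simp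
      have "cls (\<Sum>b\<in>E. v' b * b) = cls (\<Sum>b\<in>E. ?v b * b)"
        using expand[of v' t'] v' t' \<open>y = cls (\<Sum>b\<in>E. ?v b * b)\<close> by simp
      then have "(\<Sum>b\<in>E. v' b * b) - (\<Sum>b\<in>E. ?v b * b) \<in> H"
        using re[OF vs[of E v'] vs[of E ?v]] v v' by simp
      then have s: "(\<Sum>b\<in>E. (v' b - ?v b) * b) \<in> H" by (simp add: left_diff_distrib sum_subtractf)
      have "t' (cls b) = ?t (cls b)" if b: "b \<in> E" for b
      proof -
        have "v' b - ?v b \<in> H"
          by (rule key[OF _ s b]) (use vars_diff v v' in blast)
        moreover have "vars (v' b) \<subseteq> {..n}" "vars (?v b) \<subseteq> {..n}" 
          by (rule subset_trans[OF _ kn'], use v[of b] v'[OF b] in simp)+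
        ultimately have "cls (v' b) = cls (?v b)" using re by blast
        then show ?thesis using t[OF b] v'[OF b] by simp
      qed
      moreover have "t' \<in> extensional (cls ` E)" "?t \<in> extensional (cls ` E)" using t' by (auto simp: PiE_iff)
      ultimately show "t' = ?t" by (intro extensionalityI[of t' "cls ` E" ?t]) auto
    qed
  qed
  moreover have "cls ` E \<subseteq> carrier ?M" using Ev by (auto simp: M rs)
  ultimately show ?thesis
    unfolding free_module_def using module by (intro conjI exI[of _ "cls ` E"]) auto
qed

text \<open>The first isomorphism theorem for the class map on polynomials in the terminal
  variables, whose kernel is \<open>power_ideal\<close>. It yields a map from the quotient to the
  subalgebra; the inverse is taken and checked on constants.\<close>

lemma subalgebra_isomorphic:
  "algebra_isomorphic (Q\<lparr>carrier := cls ` {f. vars f \<subseteq> {..k}}\<rparr>) (\<lambda>c. cls (Const c))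
    (mpoly_ring {..k} Quot power_ideal) (\<lambda>c. residue {..k} power_ideal (Const c))"
proof -
  let ?T = "cls ` {f. vars f \<subseteq> {..k}}"
  let ?QT = "Q\<lparr>carrier := ?T\<rparr>"
  let ?P = "mpoly_ring {..k} :: 'k mpoly ring"
  note rs = residue_simps[OF H_ideal] and re = residue_eq_iff[OF H_ideal]
  have kn': "{..k} \<subseteq> {..n}" using kn by auto
  have cQT: "cring ?QT" by (rule ring_subalgebra[OF H_ideal kn'])
  have "cls \<in> ring_hom ?P ?QT"
  proof (rule ring_hom_memI)
    fix f g assume "f \<in> carrier ?P" "g \<in> carrier ?P"
    then have "vars f \<subseteq> {..n}" "vars g \<subseteq> {..n}" using kn' by auto
    then show "cls (f \<otimes>\<^bsub>?P\<^esub> g) = cls f \<otimes>\<^bsub>?QT\<^esub> cls g" "cls (f \<oplus>\<^bsub>?P\<^esub> g) = cls f \<oplus>\<^bsub>?QT\<^esub> cls g"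
      by (simp_all add: rs)
  qed (simp_all add: rs)
  then interpret h: ring_hom_ring ?P ?QT cls
    by (intro ring_hom_ringI2 ring_mpoly_ring cring.axioms(1)[OF cQT])
  have ker: "a_kernel ?P ?QT cls = power_ideal"
  proof -
    have "cls f = \<zero>\<^bsub>Q\<^esub> \<longleftrightarrow> f \<in> power_ideal" if "vars f \<subseteq> {..k}" for f
    proof -
      have "vars f \<subseteq> {..n}" using that kn' by auto
      then show ?thesis using re[of f 0] H_inter_eq_power_ideal[OF that] by (simp add: rs)
    qed
    then show ?thesis
      using ideal_mpoly_ringD(1)[OF power_ideal_ideal] unfolding a_kernel_def' by auto
  qed
  let ?S = "?P Quot power_ideal"
  define \<Phi> where "\<Phi> = (\<lambda>Y. the_elem (cls ` Y))"
  have iso: "\<Phi> \<in> ring_iso ?S ?QT"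
    using h.FactRing_iso_set unfolding ker \<Phi>_def by simp
  have "ring ?S" by (rule ideal.quotient_is_ring[OF power_ideal_ideal])
  then have "inv_into (carrier ?S) \<Phi> \<in> ring_iso ?QT ?S" using iso by (rule ring_iso_set_sym)
  moreover have "inv_into (carrier ?S) \<Phi> (cls (Const c)) = residue {..k} power_ideal (Const c)" for c
  proof -
    have "\<Phi> (residue {..k} power_ideal (Const c)) = cls (Const c)"
      using h.the_elem_simp[of "Const c"] unfolding ker \<Phi>_def residue_def[of "{..k}"] by simp
    moreover have "inj_on \<Phi> (carrier ?S)" using iso by (simp add: ring_iso_def bij_betw_def)
    moreover have "residue {..k} power_ideal (Const c) \<in> carrier ?S"
      by (rule residue_simps(6)[OF power_ideal_ideal]) simp
    ultimately show ?thesis by (metis inv_into_f_f)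
  qed
  ultimately show ?thesis unfolding algebra_isomorphic_def by blast
qed

end

end


section \<open>Linear forms and the dual action\<close>

lemma sum_fun_apply: "(\<Sum>a\<in>S. h a) v = (\<Sum>a\<in>S. h a v)"
  by (induction S rule: infinite_finite_induct) simp_all

lemma homog_add: "homog e f \<Longrightarrow> homog e g \<Longrightarrow> homog e (f + g)"
  unfolding homog_def by (metis add.right_neutral lookup_add)

lemma homog_sum: "(\<And>a. a \<in> S \<Longrightarrow> homog e (h a)) \<Longrightarrow> homog e (sum h S)"
  by (induction S rule: infinite_finite_induct) (auto intro: homog_add simp: homog_def[of _ 0])

lemma homog_Const_mult_Var: "homog 1 (Const c * Var j)"
  by (auto simp: homog_def Const_def Var_def mult_single lookup_single when_def split: if_splits)

lemma total_degree_homog: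
  assumes "homog e f" "f \<noteq> 0"
  shows "total_degree f = e"
proof -
  obtain m where m: "m \<in> supp f" using assms(2) by fastforce
  have "tdeg ` supp f = {e}" using assms(1) m by (auto simp: homog_def in_keys_iff)
  then have "total_degree f = Max (insert 0 {e})"
    unfolding total_degree_def tdeg_def[abs_def, symmetric] by simp
  then show ?thesis by simp
qed

context
  fixes scl :: "'k::field \<Rightarrow> 'v::ab_group_add \<Rightarrow> 'v" and G :: "('g, 'b) monoid_scheme" (structure)
    and \<rho> :: "'g \<Rightarrow> 'v \<Rightarrow> 'v" and n :: nat and x :: "nat \<Rightarrow> 'v \<Rightarrow> 'k"
  assumes module: "fin_dim_kG_module scl G \<rho>" and basis: "dual_basis scl n x"
begin

interpretation fin_dim_kG_module scl G \<rho> by (rule module)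

lemma group_G: "group G"
  using group_hom by (rule group_hom.axioms)

interpretation Gr: group G by (rule group_G)

definition "coord f j = functional.representation (x ` {..n}) f (x j)"
definition "action_form g j = linear_form n x (dual_act G \<rho> g (x j))"

lemma inj_x: "inj_on x {..n}" and indep_x: "functional.independent (x ` {..n})"
  and span_x: "functional.span (x ` {..n}) = dual_space scl"
  using basis by (simp_all add: dual_basis_def functional_basis_def)

lemma linear_form_rep: "linear_form n x f = (\<Sum>j\<le>n. Const (coord f j) * Var j)"
  by (simp add: linear_form_def coord_def)

lemma dual_space_iff: "f \<in> dual_space scl \<longleftrightarrow> Vector_Spaces.linear scl (*) f"
  by (simp add: dual_space_def)

lemma x_dual: "j \<le> n \<Longrightarrow> x j \<in> dual_space scl"
  using functional.span_base[of "x j" "x ` {..n}"] span_x by auto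

lemma dual_act_dual:
  assumes "g \<in> carrier G" "f \<in> dual_space scl"
  shows "dual_act G \<rho> g f \<in> dual_space scl"
  unfolding dual_space_iff dual_act_def
  by (rule Vector_Spaces.linear_compose[OF linear_act]) (use assms in \<open>simp_all add: dual_space_iff\<close>)

lemma coord_expand:
  assumes "f \<in> dual_space scl"
  shows "(\<Sum>j\<le>n. fscale (coord f j) (x j)) = f"
proof -
  have "(\<Sum>b\<in>x ` {..n}. fscale (functional.representation (x ` {..n}) f b) b) = f"
    using assms by (intro functional.sum_representation_eq indep_x) (auto simp: span_x)
  then show ?thesis by (simp add: sum.reindex[OF inj_x] coord_def)
qed

lemma coord_scale: "f \<in> dual_space scl \<Longrightarrow> coord (fscale c f) j = c * coord f j"
  using functional.representation_scale[OF indep_x, of f c] by (simp add: coord_def span_x)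

lemma coord_sum:
  assumes "\<And>a. a \<in> S \<Longrightarrow> h a \<in> dual_space scl"
  shows "coord (\<Sum>a\<in>S. fscale (c a) (h a)) j = (\<Sum>a\<in>S. c a * coord (h a) j)"
proof -
  have "fscale (c a) (h a) \<in> functional.span (x ` {..n})" if "a \<in> S" for a
    by (rule functional.span_scale) (use assms[OF that] in \<open>simp add: span_x\<close>)
  then show ?thesis
    using functional.representation_sum[OF indep_x, of S "\<lambda>a. fscale (c a) (h a)"] assms
    by (simp add: coord_def[of "sum _ _"] flip: coord_def) (simp add: coord_scale cong: sum.cong)
qed

lemma coord_x: "i \<le> n \<Longrightarrow> j \<le> n \<Longrightarrow> coord (x i) j = (if i = j then 1 else 0)"
  using functional.representation_basis[OF indep_x, of "x i"] inj_x
  by (auto simp: coord_def inj_on_def)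

lemma coord_span_zero:
  assumes "B \<subseteq> x ` {..n}" "f \<in> functional.span B" "x j \<notin> B"
  shows "coord f j = 0"
  using functional.representation_extend[OF indep_x assms(2,1)] functional.representation_ne_zero[of B f "x j"] assms(3)
  by (auto simp: coord_def)

lemma dual_act_mult:
  assumes "g \<in> carrier G" "h \<in> carrier G"
  shows "dual_act G \<rho> (g \<otimes> h) f = dual_act G \<rho> g (dual_act G \<rho> h f)"
  using assms composition_rule[of _ "inv h" "inv g"] by (simp add: dual_act_def fun_eq_iff Gr.inv_mult_group)

lemma dual_act_one: "dual_act G \<rho> \<one> f = f"
  using fun_cong[OF id_eq_one] by (simp add: dual_act_def fun_eq_iff)

lemma dual_act_scale: "dual_act G \<rho> g (fscale c f) = fscale c (dual_act G \<rho> g f)"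
  and dual_act_sum: "dual_act G \<rho> g (sum h S) = (\<Sum>a\<in>S. dual_act G \<rho> g (h a))"
  by (simp_all add: dual_act_def fscale_def fun_eq_iff sum_fun_apply)

lemma coord_dual_act:
  assumes "g \<in> carrier G" "f \<in> dual_space scl"
  shows "coord (dual_act G \<rho> g f) j = (\<Sum>i\<le>n. coord f i * coord (dual_act G \<rho> g (x i)) j)"
proof -
  have "dual_act G \<rho> g f = (\<Sum>i\<le>n. fscale (coord f i) (dual_act G \<rho> g (x i)))"
    by (subst (1) coord_expand[OF assms(2), symmetric]) (simp add: dual_act_sum dual_act_scale)
  then show ?thesis using coord_sum[of "{..n}" "\<lambda>i. dual_act G \<rho> g (x i)"] dual_act_dual assms(1) x_dual by simp
qed

lemma vars_linear_form: "vars (linear_form n x f) \<subseteq> {j. j \<le> n \<and> coord f j \<noteq> 0}"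
  unfolding linear_form_rep
proof (rule vars_sum)
  fix j assume "j \<in> {..n}"
  then show "vars (Const (coord f j) * Var j) \<subseteq> {j. j \<le> n \<and> coord f j \<noteq> 0}"
    using vars_mult[of "Const (coord f j)" "Var j"] by (cases "coord f j = 0") auto
qed

text \<open>In coordinates this is multiplication of the matrices of g and h on the dual
  space.\<close>

lemma L_mult_aux:
  assumes "g \<in> carrier G" "h \<in> carrier G" "j \<le> n"
  shows "action_form (g \<otimes> h) j = subst (action_form g) (action_form h j)"
proof -
  let ?f = "dual_act G \<rho> h (x j)"
  have f: "?f \<in> dual_space scl" using dual_act_dual assms x_dual by blast
  have "subst (action_form g) (action_form h j) = (\<Sum>i\<le>n. Const (coord ?f i) * action_form g i)"
    by (simp add: action_form_def[of h] linear_form_rep subst_simps)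
  also have "\<dots> = (\<Sum>i\<le>n. \<Sum>l\<le>n. Const (coord ?f i * coord (dual_act G \<rho> g (x i)) l) * Var l)"
    by (simp add: action_form_def linear_form_rep sum_distrib_left Const_mult mult.assoc)
  also have "\<dots> = (\<Sum>l\<le>n. \<Sum>i\<le>n. Const (coord ?f i * coord (dual_act G \<rho> g (x i)) l) * Var l)"
    by (rule sum.swap)
  also have "\<dots> = (\<Sum>l\<le>n. Const (coord (dual_act G \<rho> g ?f) l) * Var l)"
    by (simp add: coord_dual_act[OF assms(1) f] Const_sum sum_distrib_right)
  finally show ?thesis using assms by (simp add: action_form_def dual_act_mult linear_form_rep)
qed

lemma L_one_aux:
  assumes "j \<le> n" shows "action_form \<one> j = Var j"
proof -
  have "action_form \<one> j = (\<Sum>l\<le>n. if l = j then Var l else 0)"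
    unfolding action_form_def dual_act_one linear_form_rep by (rule sum.cong) (use assms coord_x in auto)
  then show ?thesis using assms by simp
qed

lemma coord_other:
  assumes i: "i \<le> n" "terminal_variable G \<rho> n x i"
    and g: "g \<in> carrier G" and j: "j \<le> n" "j \<noteq> i"
  shows "coord (dual_act G \<rho> g (x j)) i = 0"
proof -
  let ?B = "x ` ({..n} - {i})"
  have "x j \<in> functional.span ?B" using j by (intro functional.span_base) auto
  then have "dual_act G \<rho> g (x j) \<in> functional.span ?B"
    using i(2) g by (auto simp: terminal_variable_def kG_submodule_def)
  moreover have "x i \<notin> ?B" using inj_x i(1) by (auto simp: inj_on_def)
  ultimately show ?thesis using coord_span_zero[of ?B] by auto
qed

text \<open>The action on the one-dimensional quotient by the other variables is a character of a
  \<open>p\<close>-group in characteristic \<open>p\<close>, hence trivial.\<close>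

lemma coord_terminal:
  assumes p: "Factorial_Ring.prime CHAR('k)" and "finite (carrier G)"
    and order: "Coset.order G = CHAR('k) ^ m"
    and i: "i \<le> n" "terminal_variable G \<rho> n x i" and g: "g \<in> carrier G"
  shows "coord (dual_act G \<rho> g (x i)) i = 1"
proof -
  let ?c = "\<lambda>g. coord (dual_act G \<rho> g (x i)) i"
  have mult: "?c (g \<otimes> h) = ?c g * ?c h" if g: "g \<in> carrier G" "h \<in> carrier G" for g h
  proof -
    let ?f = "dual_act G \<rho> h (x i)"
    have "?f \<in> dual_space scl" using dual_act_dual that x_dual i by blast
    then have "?c (g \<otimes> h) = (\<Sum>j\<le>n. coord ?f j * coord (dual_act G \<rho> g (x j)) i)"
      using that by (simp add: dual_act_mult coord_dual_act)
    \<comment> \<open>The span of the other variables is stable, so only the diagonal term survives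
      and the diagonal coefficient is multiplicative.\<close>
    also have "\<dots> = (\<Sum>j\<le>n. if j = i then coord ?f i * ?c g else 0)"
      by (rule sum.cong) (use coord_other[OF i g(1)] in auto)
    finally show ?thesis using i by simp
  qed
  have "?c (g [^] e) = ?c g ^ e" for e :: nat
    by (induction e) (use g i coord_x in \<open>simp_all add: dual_act_one mult\<close>)
  moreover have "g [^] Coset.order G = \<one>" using g by (rule Gr.pow_order_eq_1)
  ultimately have "?c g ^ (CHAR('k) ^ m) = 1"
    using i coord_x by (metis dual_act_one order)
  \<comment> \<open>In characteristic p this turns \<open>c^q = 1\<close> into
    \<open>(c - 1)^q = 0\<close>.\<close>
  moreover have "(?c g - 1 + 1) ^ (CHAR('k) ^ m) = (?c g - 1) ^ (CHAR('k) ^ m) + 1 ^ (CHAR('k) ^ m)"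
    by (rule freshmans_dream'[OF p]) simp
  ultimately have "(?c g - 1) ^ (CHAR('k) ^ m) = 0" by simp
  then show ?thesis by simp
qed

text \<open>On each summand at least one of the two memberships forces f to vanish, and the summands
  add up to the whole space.\<close>

lemma summand_dual_disjoint:
  assumes "kG_direct_sum scl G \<rho> I W" "finite I" "s \<noteq> t"
    and "f \<in> summand_dual scl I W s" "f \<in> summand_dual scl I W t"
  shows "f = 0"
proof
  fix v
  interpret f: Vector_Spaces.linear scl "(*)" f
    using assms(4) by (simp add: summand_dual_def dual_space_iff)
  have "\<exists>!w. w \<in> (\<Pi>\<^sub>E i\<in>I. W i) \<and> v = (\<Sum>i\<in>I. w i)"
    using assms(1) by (simp add: kG_direct_sum_def)
  then obtain w where w: "w \<in> (\<Pi>\<^sub>E i\<in>I. W i)" "v = (\<Sum>i\<in>I. w i)" by blast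
  have "f v = (\<Sum>i\<in>I. f (w i))" unfolding w(2) by (rule f.sum)
  also have "\<dots> = 0"
  proof (rule sum.neutral, rule ballI)
    fix i assume i: "i \<in> I"
    then have "w i \<in> W i" using w(1) by auto
    then show "f (w i) = 0"
      using assms(3-5) i by (cases "i = s") (auto simp: summand_dual_def)
  qed
  finally show "f v = 0 v" by simp
qed

lemma dual_act_summand_dual:
  assumes "kG_direct_sum scl G \<rho> I W" "g \<in> carrier G" "f \<in> summand_dual scl I W t"
  shows "dual_act G \<rho> g f \<in> summand_dual scl I W t"
proof -
  have "\<rho> (inv g) v \<in> W j" if "j \<in> I" "v \<in> W j" for j v
    using assms(1,2) that unfolding kG_direct_sum_def kG_submodule_def by (metis Gr.inv_closed image_subset_iff)
  then show ?thesis
    using assms dual_act_dual unfolding summand_dual_def by (auto simp: dual_act_def)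
qed

text \<open>The block consists of the basis elements in the dual of the i-th summand. Each such dual
  is stable under G and spanned by the basis elements in it.\<close>

lemma L_block_aux:
  assumes ds: "kG_direct_sum scl G \<rho> {..Suc k} W" and comp: "compatible_basis scl n x {..Suc k} W"
    and own: "\<forall>i\<le>k. x i \<in> summand_dual scl {..Suc k} W i" and kn: "k \<le> n" and i: "i \<le> k"
  shows "\<exists>S. S \<inter> {..k} = {i} \<and> (\<forall>g\<in>carrier G. \<forall>j\<le>n.
      (j \<in> S \<longrightarrow> vars (action_form g j) \<subseteq> S) \<and> (j \<notin> S \<longrightarrow> vars (action_form g j) \<inter> S = {}))"
proof -
  let ?D = "summand_dual scl {..Suc k} W"
  let ?S = "{j. j \<le> n \<and> x j \<in> ?D i}"
  obtain B where B: "\<And>t. t \<le> Suc k \<Longrightarrow> functional_basis (B t) (?D t)" and xB: "x ` {..n} = (\<Union>t\<le>Suc k. B t)"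
    using comp by (auto simp: compatible_basis_def)
  have Bx: "B t \<subseteq> x ` {..n}" if "t \<le> Suc k" for t using xB that by auto
  have spanB: "functional.span (B t) = ?D t" if "t \<le> Suc k" for t
    using B[OF that] by (simp add: functional_basis_def)
  have BD: "B t \<subseteq> ?D t" if "t \<le> Suc k" for t
    using functional.span_superset[of "B t"] spanB[OF that] by simp
  have "x j \<noteq> 0" if "j \<le> n" for j
    using indep_x functional.dependent_zero[of "x ` {..n}"] that by fastforce
  \<comment> \<open>A basis element is nonzero, so it belongs to the dual of one summand only, and
    the blocks do not overlap.\<close>
  then have uniq: "s = t" if "x j \<in> ?D s" "x j \<in> ?D t" "j \<le> n" for j s t
    using summand_dual_disjoint[OF ds _ _ that(1,2)] that(3) by blast
  have vars: "\<exists>t\<le>Suc k. x j \<in> ?D t \<and> vars (action_form g j) \<subseteq> {l. l \<le> n \<and> x l \<in> ?D t}"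
    if g: "g \<in> carrier G" and j: "j \<le> n" for g j
  proof -
    obtain t where t: "t \<le> Suc k" "x j \<in> B t" using xB j by blast
    have xt: "x j \<in> ?D t" using BD[OF t(1)] t(2) by blast
    have "dual_act G \<rho> g (x j) \<in> functional.span (B t)"
      unfolding spanB[OF t(1)] by (rule dual_act_summand_dual[OF ds g xt])
    then have "coord (dual_act G \<rho> g (x j)) l = 0" if "x l \<notin> B t" for l
      using coord_span_zero[OF Bx[OF t(1)] _ that] by blast
    then have "vars (action_form g j) \<subseteq> {l. l \<le> n \<and> x l \<in> B t}"
      using vars_linear_form[of "dual_act G \<rho> g (x j)"] unfolding action_form_def by blast
    then show ?thesis using BD[OF t(1)] t(1) xt by blast
  qed
  show ?thesis
  proof (rule exI[of _ ?S], intro conjI ballI allI impI)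
    show "?S \<inter> {..k} = {i}"
    proof (intro equalityI subsetI)
      fix j assume "j \<in> ?S \<inter> {..k}"
      then show "j \<in> {i}" using own uniq[of j i j] by simp
    qed (use own i kn in simp)
    fix g j assume gj: "g \<in> carrier G" "j \<le> n"
    obtain t where t: "x j \<in> ?D t" "vars (action_form g j) \<subseteq> {l. l \<le> n \<and> x l \<in> ?D t}" using vars[OF gj] by blast
    show "vars (action_form g j) \<subseteq> ?S" if "j \<in> ?S"
    proof -
      have "t = i" using uniq[OF t(1) _ gj(2)] that by simp
      then show ?thesis using t(2) by simp
    qed
    show "vars (action_form g j) \<inter> ?S = {}" if "j \<notin> ?S"
    proof -
      have "t \<noteq> i" using that t(1) gj(2) by auto
      then show ?thesis using t(2) uniq by blast
    qed
  qed
qed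

lemma terminal_action_L:
  assumes p: "Factorial_Ring.prime CHAR('k)" and fin: "finite (carrier G)"
    and order: "Coset.order G = CHAR('k) ^ m"
    and ds: "kG_direct_sum scl G \<rho> {..Suc k} W" and comp: "compatible_basis scl n x {..Suc k} W"
    and kn: "k \<le> n"
    and own: "\<forall>i\<le>k. terminal_variable G \<rho> n x i \<and> x i \<in> summand_dual scl {..Suc k} W i"
  shows "terminal_action G action_form n k"
proof (intro terminal_action.intro group_G terminal_action_axioms.intro)
  show "vars (action_form g j) \<subseteq> {..n}" for g j
    using vars_linear_form by (fastforce simp: action_form_def)
  show "homog 1 (action_form g j)" for g j
    unfolding action_form_def linear_form_rep by (intro homog_sum homog_Const_mult_Var)
  fix g i assume g: "g \<in> carrier G" and i: "i \<le> k"
  have ti: "i \<le> n" "terminal_variable G \<rho> n x i" using own i kn by auto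
  let ?f = "dual_act G \<rho> g (x i)"
  have "action_form g i = Const (coord ?f i) * Var i + (\<Sum>j\<in>{..n} - {i}. Const (coord ?f j) * Var j)"
    unfolding action_form_def linear_form_rep using ti by (intro sum.remove) auto
  moreover have "vars (\<Sum>j\<in>{..n} - {i}. Const (coord ?f j) * Var j) \<subseteq> - {i}"
    by (rule vars_sum, rule subset_trans[OF vars_mult]) auto
  ultimately show "\<exists>l. action_form g i = Var i + l \<and> i \<notin> vars l"
    using coord_terminal[OF p fin order ti g] by auto
  fix j assume j: "j \<le> n" "j \<noteq> i"
  show "i \<notin> vars (action_form g j)"
    using vars_linear_form[of "dual_act G \<rho> g (x j)"] coord_other[OF ti g j] unfolding action_form_def by blast
qed (use fin kn L_one_aux L_mult_aux L_block_aux[OF ds comp _ kn] own in auto)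

end

theorem theorem2:
  fixes p :: nat and k n :: nat
    and scl :: "'k::field \<Rightarrow> 'v::ab_group_add \<Rightarrow> 'v"
    and G :: "('g, 'b) monoid_scheme" and \<rho> :: "'g \<Rightarrow> 'v \<Rightarrow> 'v"
    and V :: "nat \<Rightarrow> 'v set" and U :: "'v set"
    and x :: "nat \<Rightarrow> 'v \<Rightarrow> 'k"
  defines "W \<equiv> V(Suc k := U)"
    and "d \<equiv> var_degree G \<rho> n x"
    and "R \<equiv> (mpoly_ring {..n} :: 'k mpoly ring)"
    and "A \<equiv> (carrier (mpoly_ring {Suc k..n}) :: 'k mpoly set)"
    and "H \<equiv> hilbert_ideal G \<rho> n x"
    and "Q \<equiv> coinvariants G \<rho> n x"
  defines "Xbar \<equiv> (\<lambda>i. residue {..n} H (Var i))"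
  defines "T \<equiv> generated_subalgebra {..n} H (Xbar ` {..k})"
  defines "J \<equiv> (Idl\<^bsub>mpoly_ring {..k}\<^esub> ((\<lambda>i. Var i ^ d i) ` {..k}) :: 'k mpoly set)"
  assumes "Factorial_Ring.prime p" and "CHAR('k) = p"
    and "finite (carrier G)" and "\<exists>m. Coset.order G = p ^ m"
    and "fin_dim_kG_module scl G \<rho>"
    and "kG_direct_sum scl G \<rho> {..Suc k} W"
    and "\<forall>i\<le>k. \<not> trivial_on G \<rho> (V i)" and "trivial_on G \<rho> U"
    and "k \<le> n" and "dual_basis scl n x" and "compatible_basis scl n x {..Suc k} W"
    and "\<forall>i\<le>k. terminal_variable G \<rho> n x i \<and> x i \<in> summand_dual scl {..Suc k} W i"
  shows "(\<exists>N P. (\<forall>i\<le>k. is_N G \<rho> n x i (N i)) \<and> P \<subseteq> A \<and> H = Idl\<^bsub>R\<^esub> (N ` {..k} \<union> P)) \<and>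
    (\<exists>D. ring.dimension Q D (range (\<lambda>c. residue {..n} H (Const c))) (carrier Q) \<and>
      (\<Prod>i\<le>k. d i) dvd D) \<and>
    ((\<forall>i\<le>k. d i = total_degree (orbit_norm G \<rho> n x (Var i))) \<longrightarrow>
      free_module (Q\<lparr>carrier := T\<rparr>) (regular_module Q) \<and>
      algebra_isomorphic
        (Q\<lparr>carrier := T\<rparr>) (\<lambda>c. residue {..n} H (Const c))
        (mpoly_ring {..k} Quot J) (\<lambda>c. residue {..k} J (Const c)))"
proof -
  obtain m where order: "Coset.order G = CHAR('k) ^ m" using assms by blast
  have p: "Factorial_Ring.prime CHAR('k)" using assms by simp
  let ?L = "\<lambda>g j. linear_form n x (dual_act G \<rho> g (x j))"
  \<comment> \<open>The interpretation uses the linear forms exactly as they occur in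
    \<open>poly_act\<close>, so that the notions of the statement unfold to those of the
    locale.\<close>
  have L: "Submission.action_form G \<rho> n x = ?L"
    by (intro ext) (simp add: action_form_def[OF \<open>fin_dim_kG_module scl G \<rho>\<close> \<open>dual_basis scl n x\<close>])
  interpret T: terminal_action G ?L n k
    unfolding L[symmetric] by (rule terminal_action_L) (use assms order in auto)
  have act: "poly_act G \<rho> n x g = subst (?L g)" for g by (simp add: poly_act_def)
  have Invs: "invariant_polys G \<rho> n x = T.Invs"
    by (simp add: invariant_polys_def T.Invs_def act)
  have H: "H = T.H" by (simp add: H_def hilbert_ideal_def T.H_def Invs)
  have Q: "Q = R Quot T.H" by (simp add: Q_def coinvariants_def R_def flip: H H_def)
  have monic: "monic_invariant G \<rho> n x = T.monic_inv"
    by (simp add: fun_eq_iff monic_invariant_def T.monic_inv_def Invs)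
  have d: "d = T.d" by (simp add: fun_eq_iff d_def var_degree_def T.d_def monic)
  have J: "J = T.power_ideal" by (simp add: J_def T.power_ideal_def d)
  have T: "T = residue {..n} T.H ` {f. vars f \<subseteq> {..k}}"
    unfolding T_def Xbar_def H by (rule generated_subalgebra_residue[OF T.H_ideal]) (use T.kn in auto)
  have "is_N G \<rho> n x i (T.N i)" if "i \<le> k" for i
    unfolding is_N_def is_arg_min_def monic
    using T.N(1,2)[OF that] T.d_least[of i] by (auto simp: not_less)
  then have 1: "\<exists>N P. (\<forall>i\<le>k. is_N G \<rho> n x i (N i)) \<and> P \<subseteq> A \<and> H = Idl\<^bsub>R\<^esub> (N ` {..k} \<union> P)"
    using T.H_generators unfolding H R_def A_def
    by (intro exI[of _ T.N] exI[of _ "{f \<in> T.H'. vars f \<subseteq> {Suc k..n}}"]) auto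
  have 2: "free_module (Q\<lparr>carrier := T\<rparr>) (regular_module Q) \<and>
      algebra_isomorphic (Q\<lparr>carrier := T\<rparr>) (\<lambda>c. residue {..n} H (Const c))
        (mpoly_ring {..k} Quot J) (\<lambda>c. residue {..k} J (Const c))"
    if deg: "\<forall>i\<le>k. d i = total_degree (orbit_norm G \<rho> n x (Var i))"
  proof -
    have "Var i ^ T.d i \<in> T.H" if i: "i \<le> k" for i
    proof (rule T.terminal_nilpotent[OF p order i])
      let ?O = "(\<lambda>g. ?L g i) ` carrier G"
      have "orbit G (poly_act G \<rho> n x) (Var i) = ?O"
        by (auto simp: orbit_def act)
      then have "orbit_norm G \<rho> n x (Var i) = (\<Prod>h\<in>?O. h)" by (simp add: orbit_norm_def)
      moreover have "homog (card ?O) (\<Prod>h\<in>?O. h)"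
        by (rule homog_prod) (use T.fin T.homog_L i T.kn in auto)
      \<comment> \<open>\<open>total_degree\<close> is 0 on the zero polynomial, so the orbit
        product must be nonzero before its total degree can be read as the size of the
        orbit.\<close>
      moreover have "?L g i \<noteq> 0" if "g \<in> carrier G" for g
        using T.poly_in_L(1)[OF that i] by (auto simp: poly_in_simps)
      then have "(\<Prod>h\<in>?O. h) \<noteq> 0" using T.fin by (auto simp: prod_zero_iff)
      ultimately show "T.d i = card ?O" using deg i total_degree_homog by (simp add: d)
    qed
    then show ?thesis
      unfolding T Q R_def H J using T.free_coinvariants T.subalgebra_isomorphic by blast
  qed
  show ?thesis
    using 1 2 T.dimension_coinvariants unfolding Q R_def H d by blast
qed

end
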